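(* Assume that $\mathcal{D}(M^{1/2})\subset_c\mathcal{D}(A^{1/2})$ and let $0\le\tau\le 1/2$. If $\sigma\ge\tau$ and the eigenvectors $u_1,u_2,\dots,u_\ell$ of $A$ are all in $\mathcal{D}(M^\sigma)$, then $$\Lambda_j^{(n,\tau)}=\lambda_j+o\big(\mu_{n+1}^{2\tau-2\sigma}\big),\qquad 1\le j\le\ell,$$ and, for all large $n$, there exist eigenvectors $u_{j,n}$ of $A$ in the $\lambda_j$-eigenspace, normalized in $\mathcal{H}_{\tau-1/2}$, such that $$\|u_{j,n}-u_j^{(n,\tau)}\|_\tau=o\big(\mu_{n+1}^{\tau-\sigma}\big),\qquad 1\le j\le\ell,$$ both as $n\to\infty$.
   Context: $\mathcal{H}=\mathcal{H}_0$ is a separable complex Hilbert space with inner product $\langle\cdot,\cdot\rangle$ and norm $\|\cdot\|=\|\cdot\|_0$. $A$ is a selfadjoint operator in $\mathcal{H}$ that is positive definite ($\langle Au,u\rangle\ge\alpha\|u\|^2$ for $u\in\mathcal{D}(A)$, some $\alpha>0$), and the lower part of its spectrum consists of isolated eigenvalues of finite multiplicity $0<\lambda_1\le\lambda_2\le\dots$ (counted with multiplicity) lying below $\lambda_\infty$, the least point of the essential spectrum ($\lambda_\infty=\infty$ if $A^{-1}$ is compact), with corresponding orthonormal eigenvectors $u_1,u_2,\dots$. The eigenpairs with indices $1,\dots,\ell$ are among these. $T=A^{-1}$. For real $\tau$, $\mathcal{H}_\tau=\mathcal{D}(A^\tau)$ with inner product $\langle u,v\rangle_\tau=\langle A^\tau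 u,A^\tau v\rangle$ and norm $\|u\|_\tau=\|A^\tau u\|$; for $\tau<0$ it is the completion of $\mathcal{H}$ in that norm. $T$ acts as a bounded selfadjoint operator in each $\mathcal{H}_\tau$. $\mathcal{G}_0$ is a Hilbert space consisting of the same elements as $\mathcal{H}_0$ with an equivalent norm; its inner product and norm are $(\cdot,\cdot)_0$ and $|\cdot|_0$. $M$ is a positive definite selfadjoint operator in $\mathcal{G}_0$ with $M^{-1}$ compact, with eigenvalues $0<\mu_1\le\mu_2\le\dots\to\infty$ (counted with multiplicity) and corresponding eigenvectors $q_1,q_2,\dots$ orthonormal in $\mathcal{G}_0$. For $s\ge0$, $\mathcal{D}(M^s)$ carries the norm $|M^sv|_0$. $\mathcal{V}_1\subset_c\mathcal{V}_0$ means $\mathcal{V}_1\subset\mathcal{V}_0$ with continuous injection. Rayleigh–Ritz method in $\mathcal{H}_\tau$ with trial vectors $q_k$: $\Lambda_1^{(n,\tau)}\le\dots\le\Lambda_n^{(n,\tau)}$ are the eigenvalues of $[\langle q_i,q_j\rangle_\tau]_{i,j=1}^n\mathbf{x}=\Lambda[\langle Tq_i,q_j\rangle_\tau]_{i,j=1}^n\mathbf{x}$, and $u_1^{(n,\tau)},\dots,u_n^{(n,\tau)}\in\mathrm{span}\{q_1,\dots,q_n\}$ are the corresponding eigenvectors normalized so that $\langle u_i^{(n,\tau)},u_j^{(n,\tau)}\rangle_{\tau-1/2}=\delta_{ij}$ and $\langle u_i^{(n,\tau)},u_j^{(n,\tau)}\rangle_\tau=\Lambda_i^{(n,\tau)}\delta_{ij}$.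 *)

theory Defs
  imports "HOL-Analysis.Analysis" "HOL-Library.Landau_Symbols" "HOL-Library.Extended_Nat"
begin

text \<open>Complex Hilbert spaces, on top of the real hierarchy so that norm, topology and
  completeness are those of the library. The inner product is antilinear in its first and
  linear in its second argument.\<close>

class complex_vector = real_vector +
  fixes scaleC :: "complex \<Rightarrow> 'a \<Rightarrow> 'a" (infixr "*\<^sub>C" 75)
  assumes scaleC_add_right: "c *\<^sub>C (x + y) = c *\<^sub>C x + c *\<^sub>C y"
    and scaleC_add_left: "(c + d) *\<^sub>C x = c *\<^sub>C x + d *\<^sub>C x"
    and scaleC_scaleC: "c *\<^sub>C d *\<^sub>C x = (c * d) *\<^sub>C x"
    and scaleR_scaleC: "r *\<^sub>R x = complex_of_real r *\<^sub>C x"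

class complex_inner = complex_vector + real_inner +
  fixes cinner :: "'a \<Rightarrow> 'a \<Rightarrow> complex"
  assumes cinner_commute: "cinner x y = cnj (cinner y x)"
    and cinner_add_right: "cinner x (y + z) = cinner x y + cinner x z"
    and cinner_scaleC_right: "cinner x (c *\<^sub>C y) = c * cinner x y"
    and inner_Re_cinner: "inner x y = Re (cinner x y)"

class chilbert_space = complex_inner + complete_space

global_interpretation complex_vector: vector_space "scaleC :: complex \<Rightarrow> 'a \<Rightarrow> 'a::complex_vector"
  defines cspan = complex_vector.span
    and csubspace = complex_vector.subspace
proof
  fix c d :: complex and x y :: 'a
  show "c *\<^sub>C (x + y) = c *\<^sub>C x + c *\<^sub>C y" by (rule scaleC_add_right)
  show "(c + d) *\<^sub>C x = c *\<^sub>C x + d *\<^sub>C x" by (rule scaleC_add_left)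
  show "c *\<^sub>C d *\<^sub>C x = (c * d) *\<^sub>C x" by (rule scaleC_scaleC)
  show "1 *\<^sub>C x = x" using scaleR_scaleC[of 1 x] by simp
qed

text \<open>A second inner product on the same space is a function \<open>ip\<close>. If its norm is
  equivalent to the given one, the space is complete for it and has the same topology.\<close>

type_synonym 'a ip = "'a \<Rightarrow> 'a \<Rightarrow> complex"

definition ipnorm :: "'a::complex_vector ip \<Rightarrow> 'a \<Rightarrow> real"
  where "ipnorm ip v = sqrt (Re (ip v v))"

definition equivalent_ip :: "'a::chilbert_space ip \<Rightarrow> bool"
  where "equivalent_ip ip \<longleftrightarrow>
    (\<forall>x y. ip x y = cnj (ip y x)) \<and>
    (\<forall>x y z. ip x (y + z) = ip x y + ip x z) \<and>
    (\<forall>x y c. ip x (c *\<^sub>C y) = c * ip x y) \<and>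
    (\<exists>c>0. \<exists>C. \<forall>v. c * norm v \<le> ipnorm ip v \<and> ipnorm ip v \<le> C * norm v)"

definition orthonormal_on :: "'a::complex_vector ip \<Rightarrow> 'i set \<Rightarrow> ('i \<Rightarrow> 'a) \<Rightarrow> bool"
  where "orthonormal_on ip I w \<longleftrightarrow> (\<forall>i\<in>I. \<forall>j\<in>I. ip (w i) (w j) = (if i = j then 1 else 0))"

text \<open>An unbounded operator is given by its domain \<open>D\<close> and a function \<open>A\<close> whose
  values outside \<open>D\<close> are irrelevant; its inverse is \<open>inv_into D A\<close>.\<close>

definition densely_defined_linear :: "'a::chilbert_space set \<Rightarrow> ('a \<Rightarrow> 'a) \<Rightarrow> bool"
  where "densely_defined_linear D A \<longleftrightarrow>
    csubspace D \<and> closure D = UNIV \<and>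
    (\<forall>u\<in>D. \<forall>v\<in>D. A (u + v) = A u + A v) \<and> (\<forall>u\<in>D. \<forall>c. A (c *\<^sub>C u) = c *\<^sub>C A u)"

text \<open>The left-hand side of the equivalence says that \<open>v\<close> is in the domain of the adjoint,
  with value \<open>w\<close> there.\<close>

definition selfadjoint :: "'a::chilbert_space ip \<Rightarrow> 'a set \<Rightarrow> ('a \<Rightarrow> 'a) \<Rightarrow> bool"
  where "selfadjoint ip D A \<longleftrightarrow> densely_defined_linear D A \<and>
    (\<forall>v w. (\<forall>u\<in>D. ip (A u) v = ip u w) \<longleftrightarrow> v \<in> D \<and> w = A v)"

definition positive_definite :: "'a::chilbert_space ip \<Rightarrow> 'a set \<Rightarrow> ('a \<Rightarrow> 'a) \<Rightarrow> bool"
  where "positive_definite ip D A \<longleftrightarrow>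
    (\<exists>\<alpha>>0. \<forall>u\<in>D. Re (ip (A u) u) \<ge> \<alpha> * (ipnorm ip u)\<^sup>2)"

definition compact_operator :: "'a::chilbert_space ip \<Rightarrow> ('a \<Rightarrow> 'a) \<Rightarrow> bool"
  where "compact_operator ip K \<longleftrightarrow> compact (closure (K ` {v. ipnorm ip v \<le> 1}))"

definition eigenspace :: "'a::chilbert_space set \<Rightarrow> ('a \<Rightarrow> 'a) \<Rightarrow> complex \<Rightarrow> 'a set"
  where "eigenspace D A z = {v \<in> D. A v = z *\<^sub>C v}"

definition op_spectrum :: "'a::chilbert_space set \<Rightarrow> ('a \<Rightarrow> 'a) \<Rightarrow> complex set"
  where "op_spectrum D A = {z. \<not> (bij_betw (\<lambda>u. A u - z *\<^sub>C u) D UNIV \<and>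
    (\<exists>C. \<forall>u\<in>D. norm u \<le> C * norm (A u - z *\<^sub>C u)))}"

definition ess_spectrum :: "'a::chilbert_space set \<Rightarrow> ('a \<Rightarrow> 'a) \<Rightarrow> complex set"
  where "ess_spectrum D A = op_spectrum D A -
    {z. z isolated_in op_spectrum D A \<and> eigenspace D A z \<noteq> {0} \<and>
        (\<exists>B. finite B \<and> eigenspace D A z = cspan B)}"

text \<open>The infimum over the empty set is \<open>\<infinity>\<close>, so this is the least point of the essential
  spectrum of a selfadjoint operator that is bounded below, and \<open>\<infinity>\<close> if that spectrum is empty.\<close>

definition ess_inf :: "'a::chilbert_space set \<Rightarrow> ('a \<Rightarrow> 'a) \<Rightarrow> ereal"
  where "ess_inf D A = (INF z\<in>ess_spectrum D A. ereal (Re z))"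

text \<open>The pairs \<open>(\<nu> k, w k)\<close>, \<open>k \<in> I\<close>, list the eigenvalues below \<open>b\<close> in increasing
  order, each as often as its multiplicity, with orthonormal eigenvectors. The last conjunct
  says that nothing is missing from the list.\<close>

definition lists_eigenpairs_below ::
    "ereal \<Rightarrow> 'a::chilbert_space ip \<Rightarrow> 'a set \<Rightarrow> ('a \<Rightarrow> 'a) \<Rightarrow> nat set \<Rightarrow> (nat \<Rightarrow> real) \<Rightarrow> (nat \<Rightarrow> 'a) \<Rightarrow> bool"
  where "lists_eigenpairs_below b ip D A I \<nu> w \<longleftrightarrow>
    mono_on I \<nu> \<and> orthonormal_on ip I w \<and>
    (\<forall>k\<in>I. ereal (\<nu> k) < b \<and> w k \<in> eigenspace D A (complex_of_real (\<nu> k))) \<and>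
    (\<forall>r::real. ereal r < b \<longrightarrow>
       eigenspace D A (complex_of_real r) = cspan (w ` {k\<in>I. \<nu> k = r}))"

text \<open>Functional calculus of a selfadjoint operator through its spectral measure \<open>E\<close>
  (a projection-valued measure on the Borel sets of the real line).\<close>

definition projection_valued_measure :: "'a::chilbert_space ip \<Rightarrow> (real set \<Rightarrow> 'a \<Rightarrow> 'a) \<Rightarrow> bool"
  where "projection_valued_measure ip E \<longleftrightarrow>
    (\<forall>S\<in>sets borel. Vector_Spaces.linear (*\<^sub>C) (*\<^sub>C) (E S) \<and>
       (\<forall>u. E S (E S u) = E S u) \<and> (\<forall>u v. ip (E S u) v = ip u (E S v))) \<and>
    (\<forall>u. E UNIV u = u) \<and>
    (\<forall>F u. range F \<subseteq> sets borel \<longrightarrow> disjoint_family F \<longrightarrow>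
       (\<lambda>i::nat. E (F i) u) sums E (\<Union>i. F i) u)"

definition scalar_measure :: "'a::chilbert_space ip \<Rightarrow> (real set \<Rightarrow> 'a \<Rightarrow> 'a) \<Rightarrow> 'a \<Rightarrow> real measure"
  where "scalar_measure ip E u =
    measure_of UNIV (sets borel) (\<lambda>S. ennreal (Re (ip (E S u) u)))"

definition calculus_dom :: "'a::chilbert_space ip \<Rightarrow> (real set \<Rightarrow> 'a \<Rightarrow> 'a) \<Rightarrow> (real \<Rightarrow> real) \<Rightarrow> 'a set"
  where "calculus_dom ip E f = {u. integrable (scalar_measure ip E u) (\<lambda>x. (f x)\<^sup>2)}"

text \<open>The integral of \<open>f\<close> against the complex measure \<open>S \<mapsto> ip (E S u) v\<close>, written by
  polarization as a combination of integrals against positive measures.\<close>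

definition spectral_integral ::
    "'a::chilbert_space ip \<Rightarrow> (real set \<Rightarrow> 'a \<Rightarrow> 'a) \<Rightarrow> (real \<Rightarrow> real) \<Rightarrow> 'a \<Rightarrow> 'a \<Rightarrow> complex"
  where "spectral_integral ip E f u v =
    (\<Sum>k<4::nat. (- \<i>) ^ k *
       complex_of_real (integral\<^sup>L (scalar_measure ip E (u + (\<i> ^ k) *\<^sub>C v)) f)) / 4"

definition calculus_op ::
    "'a::chilbert_space ip \<Rightarrow> (real set \<Rightarrow> 'a \<Rightarrow> 'a) \<Rightarrow> (real \<Rightarrow> real) \<Rightarrow> 'a \<Rightarrow> 'a"
  where "calculus_op ip E f u =
    (THE w. \<forall>v\<in>calculus_dom ip E f. ip w v = spectral_integral ip E f u v)"

definition is_spectral_measure ::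
    "'a::chilbert_space ip \<Rightarrow> 'a set \<Rightarrow> ('a \<Rightarrow> 'a) \<Rightarrow> (real set \<Rightarrow> 'a \<Rightarrow> 'a) \<Rightarrow> bool"
  where "is_spectral_measure ip D A E \<longleftrightarrow> projection_valued_measure ip E \<and>
    D = calculus_dom ip E (\<lambda>x. x) \<and> (\<forall>u\<in>D. A u = calculus_op ip E (\<lambda>x. x) u)"

text \<open>By the spectral theorem a selfadjoint operator has a spectral measure, and it is unique
  on Borel sets; the choice only concerns the irrelevant values on other sets.\<close>

definition spectral_measure ::
    "'a::chilbert_space ip \<Rightarrow> 'a set \<Rightarrow> ('a \<Rightarrow> 'a) \<Rightarrow> real set \<Rightarrow> 'a \<Rightarrow> 'a"
  where "spectral_measure ip D A = (SOME E. is_spectral_measure ip D A E)"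

text \<open>Real powers of a positive definite selfadjoint operator. Its spectral measure lives
  on a half-line \<open>{\<alpha>..}\<close> with \<open>\<alpha> > 0\<close>, so the values of \<open>powr\<close> at other points play no role.\<close>

definition power_dom :: "'a::chilbert_space ip \<Rightarrow> 'a set \<Rightarrow> ('a \<Rightarrow> 'a) \<Rightarrow> real \<Rightarrow> 'a set"
  where "power_dom ip D A s = calculus_dom ip (spectral_measure ip D A) (\<lambda>x. x powr s)"

definition op_power :: "'a::chilbert_space ip \<Rightarrow> 'a set \<Rightarrow> ('a \<Rightarrow> 'a) \<Rightarrow> real \<Rightarrow> 'a \<Rightarrow> 'a"
  where "op_power ip D A s = calculus_op ip (spectral_measure ip D A) (\<lambda>x. x powr s)"

text \<open>Inner product and norm of \<open>\<H>\<^sub>s\<close>. For \<open>s < 0\<close> they are only needed on elements of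
  the original space, not on its completion.\<close>

definition scale_ip :: "'a::chilbert_space set \<Rightarrow> ('a \<Rightarrow> 'a) \<Rightarrow> real \<Rightarrow> 'a ip"
  where "scale_ip D A s u v = cinner (op_power cinner D A s u) (op_power cinner D A s v)"

definition scale_norm :: "'a::chilbert_space set \<Rightarrow> ('a \<Rightarrow> 'a) \<Rightarrow> real \<Rightarrow> 'a \<Rightarrow> real"
  where "scale_norm D A s u = norm (op_power cinner D A s u)"

definition continuously_included ::
    "'a set \<Rightarrow> ('a \<Rightarrow> real) \<Rightarrow> 'a set \<Rightarrow> ('a \<Rightarrow> real) \<Rightarrow> bool"
  where "continuously_included V1 norm1 V0 norm0 \<longleftrightarrow>
    V1 \<subseteq> V0 \<and> (\<exists>C. \<forall>v\<in>V1. norm0 v \<le> C * norm1 v)"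

text \<open>Rayleigh--Ritz approximations in \<open>\<H>\<^sub>\<tau>\<close> with trial vectors \<open>q 1, \<dots>, q n\<close>. The
  normalization makes the \<open>n\<close> vectors \<open>U i\<close> linearly independent, so the \<open>L i\<close> are all
  the eigenvalues of the matrix problem, with multiplicity.\<close>

definition ritz_pairs ::
    "'a::chilbert_space set \<Rightarrow> ('a \<Rightarrow> 'a) \<Rightarrow> real \<Rightarrow> (nat \<Rightarrow> 'a) \<Rightarrow> nat \<Rightarrow> (nat \<Rightarrow> real) \<Rightarrow> (nat \<Rightarrow> 'a) \<Rightarrow> bool"
  where "ritz_pairs D A \<tau> q n L U \<longleftrightarrow>
    mono_on {1..n} L \<and>
    (\<forall>i\<in>{1..n}. \<exists>x :: nat \<Rightarrow> complex.
       U i = (\<Sum>k=1..n. x k *\<^sub>C q k) \<and>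
       (\<forall>m\<in>{1..n}. (\<Sum>k=1..n. scale_ip D A \<tau> (q m) (q k) * x k) =
          complex_of_real (L i) * (\<Sum>k=1..n. scale_ip D A \<tau> (inv_into D A (q m)) (q k) * x k))) \<and>
    (\<forall>i\<in>{1..n}. \<forall>j\<in>{1..n}.
       scale_ip D A (\<tau> - 1/2) (U i) (U j) = (if i = j then 1 else 0) \<and>
       scale_ip D A \<tau> (U i) (U j) = (if i = j then complex_of_real (L i) else 0))"

end

theory Submission
  imports Defs "HOL-Probability.Probability"
begin

text \<open>
  The powers of \<open>A\<close> and \<open>M\<close> are taken with respect to a chosen spectral measure, so a spectral theorem
  is needed. For a positive contraction \<open>T\<close> the Bernstein polynomials of \<open>T\<close> yield discrete measures
  on \<open>[0,1]\<close>, and by Helly's theorem they have a limit with moments \<open>\<langle>T\<^sup>m v, v\<rangle>\<close>; the spectral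
  projections are limits of polynomials in \<open>T\<close>. A positive definite operator is the inverse of such
  a \<open>T\<close>, up to scaling.

  Heinz's inequality turns \<open>D(M\<^sup>1\<^sup>/\<^sup>2) \<subseteq> D(A\<^sup>1\<^sup>/\<^sup>2)\<close> into a bound of the \<open>\<H>\<^sub>\<tau>\<close>-norm by that of
  \<open>D(M\<^sup>\<tau>)\<close>, so the truncated expansion of \<open>u j\<close> in the \<open>q k\<close> has error \<open>o(\<mu>\<^sub>n\<^sub>+\<^sub>1 powr (\<tau> - \<sigma>))\<close>. The
  minimax principle gives \<open>lam j \<le> L n j\<close>, and Galerkin orthogonality makes the excess quadratic in
  this error. The components of \<open>U n j\<close> along eigenvectors with smaller eigenvalues are controlled by
  Galerkin orthogonality as well, those above the eigenvalue by the spectral gap and the excess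
  \<open>L n j - lam j\<close>. Hence projecting \<open>U n j\<close> to the eigenspace gives the required eigenvector, even if
  that eigenspace contains eigenvectors outside \<open>D(M\<^sup>\<sigma>)\<close>.
\<close>

section \<open>Equivalent inner products\<close>

text \<open>Since \<open>spectral_measure\<close> is a \<open>SOME\<close>, nothing can be said
  about powers before a spectral measure is exhibited; afterwards they are reached only through
  \<open>is_spectral_measure\<close>. Bernstein polynomials enter because their values at an
  operator between 0 and 1 are visibly positive: squares split off. The little o comes from the
  tails of the convergent series of \<open>\<mu> k powr (2 * \<sigma>)\<close> times the squared
  coefficients of \<open>u j\<close>. The excess is quadratic in the error because mass products
  with eigenvectors are multiples of energy products, in which Galerkin orthogonality replaces the
  eigenvector by its error. For the eigenvectors, the two normalizations say that the scalar measure
  of \<open>U n j\<close> integrates \<open>x powr (2 * \<tau> - 1)\<close> to 1 and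
  \<open>x powr (2 * \<tau>)\<close> to \<open>L n j\<close>. So \<open>L n j - lam j\<close> is the
  integral of \<open>(x - lam j) * x powr (2 * \<tau> - 1)\<close>: its positive part controls the
  energy beyond the spectral gap, and its negative part involves only the finitely many
  \<open>u i\<close> with a smaller eigenvalue, all of which precede \<open>u j\<close>.\<close>

lemma equivalent_ip_cinner: "equivalent_ip (cinner :: 'a::chilbert_space ip)"
  unfolding equivalent_ip_def
proof (intro conjI allI)
  have "norm v = ipnorm cinner v" for v :: 'a
    by (simp add: ipnorm_def norm_eq_sqrt_inner inner_Re_cinner)
  then show "\<exists>c>0. \<exists>C. \<forall>v::'a. c * norm v \<le> ipnorm cinner v \<and> ipnorm cinner v \<le> C * norm v"
    by (intro exI[of _ 1] conjI) auto
qed (auto simp: cinner_add_right cinner_scaleC_right cinner_commute[symmetric])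

lemma scaleC_simps [simp]:
  fixes x :: "'a::complex_vector"
  shows "complex_of_real r *\<^sub>C x = r *\<^sub>R x" "c *\<^sub>C d *\<^sub>C x = (c * d) *\<^sub>C x"
    "1 *\<^sub>C x = x" "(-1) *\<^sub>C x = - x"
  by (simp_all add: scaleR_scaleC scaleC_scaleC)

definition clinear :: "('a::complex_vector \<Rightarrow> 'a) \<Rightarrow> bool" where
  "clinear T \<longleftrightarrow> (\<forall>x y. T (x + y) = T x + T y) \<and> (\<forall>c x. T (c *\<^sub>C x) = c *\<^sub>C T x)"

lemma clinear_iff_linear: "clinear T \<longleftrightarrow> Vector_Spaces.linear (*\<^sub>C) (*\<^sub>C) T"
  by (simp add: clinear_def Vector_Spaces.linear_iff complex_vector.vector_space_axioms)

lemma
  assumes "clinear T"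
  shows clinear_add: "T (x + y) = T x + T y"
    and clinear_scaleC: "T (c *\<^sub>C x) = c *\<^sub>C T x"
    and clinear_zero: "T 0 = 0"
    and clinear_minus: "T (- x) = - T x"
    and clinear_diff: "T (x - y) = T x - T y"
    and clinear_scaleR: "T (r *\<^sub>R x) = r *\<^sub>R T x"
    and clinear_sum: "T (sum g I) = (\<Sum>i\<in>I. T (g i))"
proof -
  interpret Vector_Spaces.linear "(*\<^sub>C)" "(*\<^sub>C)" T
    using assms by (simp add: clinear_iff_linear)
  show "T (x + y) = T x + T y" "T (c *\<^sub>C x) = c *\<^sub>C T x" "T 0 = 0" "T (- x) = - T x"
    "T (x - y) = T x - T y" "T (r *\<^sub>R x) = r *\<^sub>R T x" "T (sum g I) = (\<Sum>i\<in>I. T (g i))"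
    by (rule add scale zero neg diff sum
        | simp add: scaleR_scaleC scale del: scaleC_simps)+
qed

lemma csubspace_add: "csubspace V \<Longrightarrow> x \<in> V \<Longrightarrow> y \<in> V \<Longrightarrow> x + y \<in> V"
  and csubspace_diff: "csubspace V \<Longrightarrow> x \<in> V \<Longrightarrow> y \<in> V \<Longrightarrow> x - y \<in> V"
  and csubspace_scaleC: "csubspace V \<Longrightarrow> x \<in> V \<Longrightarrow> c *\<^sub>C x \<in> V"
  and csubspace_0: "csubspace V \<Longrightarrow> 0 \<in> V"
  and csubspace_sum: "csubspace V \<Longrightarrow> (\<And>i. i \<in> I \<Longrightarrow> g i \<in> V) \<Longrightarrow> sum g I \<in> V"
  by (auto intro: complex_vector.subspace_add complex_vector.subspace_diff
      complex_vector.subspace_scale complex_vector.subspace_0 complex_vector.subspace_sum)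

lemma csubspace_scaleR:
  fixes x :: "'a::complex_vector"
  shows "csubspace V \<Longrightarrow> x \<in> V \<Longrightarrow> r *\<^sub>R x \<in> V"
  by (simp add: scaleR_scaleC csubspace_scaleC del: scaleC_simps)

lemma scaleR_scaleC_commute: "r *\<^sub>R (c *\<^sub>C x) = c *\<^sub>C (r *\<^sub>R x)"
  by (simp add: scaleR_scaleC mult.commute del: scaleC_simps(1))

lemma sum_less_4: "(\<Sum>k<4::nat. f k) = f 0 + f 1 + f 2 + f 3"
  for f :: "nat \<Rightarrow> complex"
  by (simp add: numeral_eq_Suc)

lemma ii_pow3: "\<i> ^ 3 = - \<i>" "(- \<i>) ^ 3 = \<i>"
  by (simp_all add: power3_eq_cube)

text \<open>Shaped after \<open>spectral_integral\<close>. The factor \<open>(- \<i>) ^ k\<close>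
  makes the coefficient of \<open>B u v\<close> equal to 1 for every \<open>k\<close>, while the
  coefficients of the other three terms sum to 0.\<close>

lemma polarization:
  fixes B :: "'a::complex_vector \<Rightarrow> 'a \<Rightarrow> complex"
  assumes B: "\<And>x. Q x = B x x"
    and "\<And>x y z. B (x + y) z = B x z + B y z" "\<And>x y z. B x (y + z) = B x y + B x z"
    and "\<And>c x y. B (c *\<^sub>C x) y = cnj c * B x y" "\<And>c x y. B x (c *\<^sub>C y) = c * B x y"
  shows "(\<Sum>k<4::nat. (- \<i>) ^ k * Q (u + (\<i> ^ k) *\<^sub>C v)) / 4 = B u v"
proof -
  have m: "B (- x) y = - B x y" "B x (- y) = - B x y" for x y
    using assms(4)[of "-1" x y] assms(5)[of x "-1" y] by simp_all
  have d: "B (x - y) z = B x z - B y z" "B z (x - y) = B z x - B z y" for x y z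
    using assms(2)[of x "- y" z] assms(3)[of z x "- y"] by (simp_all add: m)
  show ?thesis
    unfolding sum_less_4 ii_pow3 by (simp add: assms m d algebra_simps)
qed

text \<open>The geometry is developed for an arbitrary equivalent inner product because it is
  applied both to \<open>cinner\<close> and to \<open>G\<close>. Limits and closures remain those of
  the type.\<close>

locale hilbert_ip =
  fixes ip :: "'a::chilbert_space ip"
  assumes equivalent: "equivalent_ip ip"
begin

abbreviation "nrm \<equiv> ipnorm ip"

lemma ip_commute: "ip x y = cnj (ip y x)"
  using equivalent unfolding equivalent_ip_def by blast

lemma ip_add_right: "ip x (y + z) = ip x y + ip x z"
  using equivalent unfolding equivalent_ip_def by blast

lemma ip_scaleC_right: "ip x (c *\<^sub>C y) = c * ip x y"
  using equivalent unfolding equivalent_ip_def by blast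

lemma ip_add_left: "ip (x + y) z = ip x z + ip y z"
  using ip_commute[of "x + y" z] ip_commute[of x z] ip_commute[of y z] by (simp add: ip_add_right)

lemma ip_scaleC_left: "ip (c *\<^sub>C x) y = cnj c * ip x y"
  using ip_commute[of "c *\<^sub>C x" y] ip_commute[of x y] by (simp add: ip_scaleC_right)

lemma Re_ip_commute: "Re (ip x y) = Re (ip y x)"
  by (subst ip_commute) simp

lemma norm_equivalence:
  obtains c C where "c > 0" "C > 0" "\<And>v. c * norm v \<le> nrm v" "\<And>v. nrm v \<le> C * norm v"
proof -
  from equivalent obtain c C where c: "c > 0" and *: "\<And>v. c * norm v \<le> nrm v \<and> nrm v \<le> C * norm v"
    unfolding equivalent_ip_def by blast
  have "nrm v \<le> max C 1 * norm v" for v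
    by (rule order_trans[OF conjunct2[OF *]]) (simp add: mult_right_mono)
  then show thesis using that[of c "max C 1"] c * by auto
qed

lemma nrm_nonneg [simp]: "0 \<le> nrm v"
proof -
  obtain c where "c > 0" "c * norm v \<le> nrm v" using norm_equivalence by metis
  then show ?thesis by (meson mult_nonneg_nonneg less_imp_le norm_ge_zero order_trans)
qed

lemma Re_ip_nonneg: "0 \<le> Re (ip v v)"
proof (rule ccontr)
  assume "\<not> 0 \<le> Re (ip v v)"
  then have "nrm v < 0" by (simp add: ipnorm_def)
  then show False using nrm_nonneg[of v] by linarith
qed

lemma nrm_sq: "(nrm v)\<^sup>2 = Re (ip v v)"
  by (simp add: ipnorm_def Re_ip_nonneg)

lemma ip_self: "ip v v = complex_of_real ((nrm v)\<^sup>2)"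
proof -
  have "Im (ip v v) = 0" using arg_cong[OF ip_commute[of v v], of Im] by simp
  then show ?thesis by (simp add: complex_eq_iff nrm_sq)
qed

lemma nrm_eq_0 [simp]: "nrm v = 0 \<longleftrightarrow> v = 0"
proof
  obtain c where "c > 0" "c * norm v \<le> nrm v" using norm_equivalence by metis
  then show "nrm v = 0 \<Longrightarrow> v = 0"
    by (metis mult_le_0_iff norm_le_zero_iff not_le)
  obtain C where "nrm v \<le> C * norm v" using norm_equivalence by metis
  then show "v = 0 \<Longrightarrow> nrm v = 0" using nrm_nonneg[of v] by (metis antisym mult_zero_right norm_zero)
qed

lemma nrm_zero [simp]: "nrm 0 = 0"
  by simp

lemma ip_zero [simp]: "ip 0 x = 0" "ip x 0 = 0"
  using ip_add_left[of 0 0 x] ip_add_right[of x 0 0] by simp_all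

lemma ip_minus [simp]: "ip (- x) y = - ip x y" "ip x (- y) = - ip x y"
  using ip_scaleC_left[of "-1" x y] ip_scaleC_right[of x "-1" y] by simp_all

lemma ip_diff_left: "ip (x - y) z = ip x z - ip y z"
  and ip_diff_right: "ip z (x - y) = ip z x - ip z y"
  using ip_add_left[of x "- y" z] ip_add_right[of z x "- y"] by simp_all

lemma ip_scaleR: "ip (r *\<^sub>R x) y = of_real r * ip x y" "ip x (r *\<^sub>R y) = of_real r * ip x y"
  using ip_scaleC_left[of "of_real r" x y] ip_scaleC_right[of x "of_real r" y] by simp_all

lemma nrm_sq_diff: "(nrm (x - y))\<^sup>2 = (nrm x)\<^sup>2 - 2 * Re (ip x y) + (nrm y)\<^sup>2"
  using Re_ip_commute[of x y] by (simp add: nrm_sq ip_diff_left ip_diff_right)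

lemma nrm_sq_add: "(nrm (x + y))\<^sup>2 = (nrm x)\<^sup>2 + 2 * Re (ip x y) + (nrm y)\<^sup>2"
  using Re_ip_commute[of x y] by (simp add: nrm_sq ip_add_left ip_add_right)

lemma nrm_scaleC: "nrm (c *\<^sub>C x) = cmod c * nrm x"
proof (rule power2_eq_imp_eq)
  have "ip (c *\<^sub>C x) (c *\<^sub>C x) = complex_of_real ((cmod c)\<^sup>2) * ip x x"
    unfolding ip_scaleC_left ip_scaleC_right complex_norm_square by (simp add: ac_simps)
  then show "(nrm (c *\<^sub>C x))\<^sup>2 = (cmod c * nrm x)\<^sup>2"
    by (simp add: nrm_sq power_mult_distrib del: of_real_power)
qed simp_all

lemma nrm_scaleR: "nrm (r *\<^sub>R x) = \<bar>r\<bar> * nrm x"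
  using nrm_scaleC[of "of_real r" x] by simp

lemma Cauchy_Schwarz: "cmod (ip x y) \<le> nrm x * nrm y"
proof (cases "x = 0")
  case False
  define t where "t = ip x y / of_real ((nrm x)\<^sup>2)"
  have n: "(nrm x)\<^sup>2 > 0" using False by simp
  have "0 \<le> (nrm (y - t *\<^sub>C x))\<^sup>2" by simp
  also have "\<dots> = (nrm y)\<^sup>2 - 2 * Re (t * ip y x) + (cmod t)\<^sup>2 * (nrm x)\<^sup>2"
    by (simp add: nrm_sq_diff nrm_scaleC power_mult_distrib ip_scaleC_right)
  also have "t * ip y x = of_real ((cmod (ip x y))\<^sup>2 / (nrm x)\<^sup>2)"
    unfolding t_def ip_commute[of y x] by (simp add: complex_norm_square[symmetric])
  also have "(cmod t)\<^sup>2 * (nrm x)\<^sup>2 = (cmod (ip x y))\<^sup>2 / (nrm x)\<^sup>2"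
  proof -
    have "cmod t = cmod (ip x y) / (nrm x)\<^sup>2"
      unfolding t_def norm_divide norm_of_real by simp
    then show ?thesis using n by (simp add: power2_eq_square)
  qed
  finally have "(cmod (ip x y))\<^sup>2 / (nrm x)\<^sup>2 \<le> (nrm y)\<^sup>2" by simp
  then have "(cmod (ip x y))\<^sup>2 \<le> (nrm x * nrm y)\<^sup>2"
    using n by (simp add: field_simps)
  then show ?thesis by (rule power2_le_imp_le) simp
qed simp

lemma nrm_triangle: "nrm (x + y) \<le> nrm x + nrm y"
proof (rule power2_le_imp_le)
  have "Re (ip x y) \<le> nrm x * nrm y"
    by (rule order_trans[OF complex_Re_le_cmod Cauchy_Schwarz])
  then show "(nrm (x + y))\<^sup>2 \<le> (nrm x + nrm y)\<^sup>2" by (simp add: nrm_sq_add power2_sum)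
qed simp

lemma nrm_minus [simp]: "nrm (- x) = nrm x"
  using nrm_scaleC[of "-1" x] by simp

lemma nrm_minus_commute: "nrm (x - y) = nrm (y - x)"
  using nrm_minus[of "x - y"] by simp

lemma nrm_triangle3: "nrm (x - z) \<le> nrm (x - y) + nrm (y - z)"
  using nrm_triangle[of "x - y" "y - z"] by simp

lemma parallelogram: "(nrm (x + y))\<^sup>2 + (nrm (x - y))\<^sup>2 = 2 * (nrm x)\<^sup>2 + 2 * (nrm y)\<^sup>2"
  by (simp add: nrm_sq_add nrm_sq_diff)

lemma nrm_sq_add_le: "(nrm (x + y))\<^sup>2 \<le> 2 * (nrm x)\<^sup>2 + 2 * (nrm y)\<^sup>2"
  using parallelogram[of x y] zero_le_power2[of "nrm (x - y)"] by linarith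

text \<open>Over the reals antilinearity is invisible, so the theory of bounded bilinear maps
  supplies limits and sums for \<open>ip\<close>.\<close>

sublocale ip: bounded_bilinear ip
proof
  obtain C where C: "C > 0" "\<And>v. nrm v \<le> C * norm v" using norm_equivalence by metis
  have "norm (ip a b) \<le> norm a * norm b * (C * C)" for a b
  proof -
    have "norm (ip a b) \<le> nrm a * nrm b" by (rule Cauchy_Schwarz)
    also have "\<dots> \<le> (C * norm a) * (C * norm b)" by (intro mult_mono C) (simp_all add: C less_imp_le)
    finally show ?thesis by (simp add: ac_simps)
  qed
  then show "\<exists>K. \<forall>a b. norm (ip a b) \<le> norm a * norm b * K" by blast
qed (simp_all add: ip_add_left ip_add_right ip_scaleR scaleR_conv_of_real)

lemma tendsto_nrm: assumes "(X \<longlongrightarrow> x) F" shows "((\<lambda>n. nrm (X n)) \<longlongrightarrow> nrm x) F"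
  unfolding ipnorm_def by (intro tendsto_intros ip.tendsto assms)

lemma tendsto_iff_nrm: "(X \<longlongrightarrow> x) F \<longleftrightarrow> ((\<lambda>n. nrm (X n - x)) \<longlongrightarrow> 0) F"
proof
  assume "(X \<longlongrightarrow> x) F"
  then have "((\<lambda>n. X n - x) \<longlongrightarrow> 0) F" by (simp add: LIM_zero_iff)
  from tendsto_nrm[OF this] show "((\<lambda>n. nrm (X n - x)) \<longlongrightarrow> 0) F" by simp
next
  assume *: "((\<lambda>n. nrm (X n - x)) \<longlongrightarrow> 0) F"
  obtain c where c: "c > 0" "\<And>v. c * norm v \<le> nrm v" using norm_equivalence by metis
  have "((\<lambda>n. inverse c * nrm (X n - x)) \<longlongrightarrow> inverse c * 0) F" by (intro tendsto_intros *)
  then have "((\<lambda>n. inverse c * nrm (X n - x)) \<longlongrightarrow> 0) F" by simp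
  then have "((\<lambda>n. X n - x) \<longlongrightarrow> 0) F"
    by (rule Lim_null_comparison[rotated]) (use c in \<open>auto simp: field_simps intro!: always_eventually\<close>)
  then show "(X \<longlongrightarrow> x) F" by (simp add: LIM_zero_iff)
qed

lemma convergent_nrm_Cauchy:
  fixes X :: "nat \<Rightarrow> 'a"
  assumes "\<And>e. e > 0 \<Longrightarrow> \<exists>M. \<forall>m\<ge>M. \<forall>n\<ge>M. nrm (X m - X n) < e"
  obtains x where "X \<longlonglongrightarrow> x"
proof -
  obtain c where c: "c > 0" "\<And>v. c * norm v \<le> nrm v" using norm_equivalence by metis
  have "Cauchy X"
  proof (rule metric_CauchyI)
    fix e :: real assume "e > 0"
    then obtain M where M: "\<And>m n. m \<ge> M \<Longrightarrow> n \<ge> M \<Longrightarrow> nrm (X m - X n) < c * e"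
      using assms[of "c * e"] c by auto
    show "\<exists>M. \<forall>m\<ge>M. \<forall>n\<ge>M. dist (X m) (X n) < e"
    proof (intro exI allI impI)
      fix m n assume "m \<ge> M" "n \<ge> M"
      then have "c * norm (X m - X n) < c * e" using M c(2) by (meson order.strict_trans1)
      then show "dist (X m) (X n) < e" using c(1) by (simp add: dist_norm)
    qed
  qed
  then show thesis using that by (auto simp: Cauchy_convergent_iff convergent_def)
qed

lemma ip_eqI: assumes "\<And>v. ip v x = ip v y" shows "x = y"
proof -
  have "ip (x - y) (x - y) = 0" by (simp add: ip_diff_right assms)
  then have "nrm (x - y) = 0" by (simp add: ipnorm_def)
  then show ?thesis by simp
qed

lemma ip_eqI_left: assumes "\<And>v. ip x v = ip y v" shows "x = y"
  by (rule ip_eqI) (metis assms ip_commute)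

text \<open>The projection theorem, in the form that shows a closed range to be everything. A
  sequence in \<open>W\<close> minimizing the distance to a point outside is Cauchy by the
  parallelogram law, and the point minus its nearest point in \<open>W\<close> is orthogonal to
  \<open>W\<close>.\<close>

lemma exists_orthogonal:
  assumes W: "csubspace W" "closed W" "W \<noteq> UNIV"
  obtains v where "v \<noteq> 0" "\<And>w. w \<in> W \<Longrightarrow> ip w v = 0"
proof -
  obtain x where x: "x \<notin> W" using W(3) by blast
  define d where "d = (INF w\<in>W. (nrm (x - w))\<^sup>2)"
  have W0: "0 \<in> W" using W(1) by (rule csubspace_0)
  have bdd: "bdd_below ((\<lambda>w. (nrm (x - w))\<^sup>2) ` W)" by (rule bdd_belowI[of _ 0]) auto
  have d_le: "d \<le> (nrm (x - w))\<^sup>2" if "w \<in> W" for w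
    unfolding d_def by (rule cINF_lower[OF bdd that])
  have "\<exists>w\<in>W. (nrm (x - w))\<^sup>2 < d + 1 / Suc n" for n
  proof -
    have "(INF w\<in>W. (nrm (x - w))\<^sup>2) < d + 1 / Suc n" by (simp add: d_def)
    then show ?thesis using cINF_less_iff[OF _ bdd] W0 by blast
  qed
  then obtain w where w: "\<And>n. w n \<in> W" "\<And>n. (nrm (x - w n))\<^sup>2 < d + 1 / Suc n" by metis
  have wd: "(nrm (w m - w n))\<^sup>2 < 2 / Suc m + 2 / Suc n" for m n
  proof -
    have "(1/2) *\<^sub>R (w m + w n) \<in> W" by (intro csubspace_scaleR csubspace_add W(1) w)
    then have "d \<le> (nrm (x - (1/2) *\<^sub>R (w m + w n)))\<^sup>2" by (rule d_le)
    also have "x - (1/2) *\<^sub>R (w m + w n) = (1/2) *\<^sub>R ((x - w m) + (x - w n))"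
      by (simp add: scaleR_right_diff_distrib scaleR_right_distrib) (metis field_sum_of_halves scaleR_left.add scaleR_one)
    also have "(nrm \<dots>)\<^sup>2 = (nrm ((x - w m) + (x - w n)))\<^sup>2 / 4"
      by (simp only: nrm_scaleR power_mult_distrib) (simp add: power2_eq_square)
    finally have "4 * d \<le> (nrm ((x - w m) + (x - w n)))\<^sup>2" by simp
    moreover have "w m - w n = (x - w n) - (x - w m)" by simp
    ultimately show ?thesis
      using parallelogram[of "x - w n" "x - w m"] w(2)[of m] w(2)[of n]
      by (simp add: add.commute)
  qed
  obtain z where z: "w \<longlonglongrightarrow> z"
  proof (rule convergent_nrm_Cauchy)
    fix e :: real assume e: "e > 0"
    obtain M where M: "4 / Suc M < e\<^sup>2"
    proof -
      obtain M where "inverse (real (Suc M)) < e\<^sup>2 / 4" using reals_Archimedean e by (metis divide_pos_pos zero_less_numeral zero_less_power)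
      then show thesis using that[of M] by (simp add: field_simps)
    qed
    show "\<exists>M. \<forall>m\<ge>M. \<forall>n\<ge>M. nrm (w m - w n) < e"
    proof (intro exI allI impI)
      fix m n assume "M \<le> m" "M \<le> n"
      then have "2 / Suc m \<le> 2 / Suc M" "2 / Suc n \<le> 2 / Suc M" by (simp_all add: field_simps)
      then have "(nrm (w m - w n))\<^sup>2 < e\<^sup>2" using wd[of m n] M by linarith
      then show "nrm (w m - w n) < e" using e by (simp add: power2_less_imp_less)
    qed
  qed
  have zW: "z \<in> W" using W(2) z w(1) closed_sequentially by blast
  have "(\<lambda>n. (nrm (x - w n))\<^sup>2) \<longlonglongrightarrow> (nrm (x - z))\<^sup>2"
    by (intro tendsto_intros tendsto_nrm z)
  moreover have "(\<lambda>n. d + 1 / Suc n) \<longlonglongrightarrow> d + 0"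
    by (intro tendsto_intros) (use LIMSEQ_inverse_real_of_nat in \<open>simp add: inverse_eq_divide\<close>)
  ultimately have zd: "(nrm (x - z))\<^sup>2 \<le> d"
    using w(2) by (intro tendsto_le[of sequentially]) (auto intro!: always_eventually less_imp_le)
  show thesis
  proof (rule that[of "x - z"])
    show "x - z \<noteq> 0" using x zW by auto
    fix y assume y: "y \<in> W"
    show "ip y (x - z) = 0"
    proof (cases "y = 0")
      case False
      define t where "t = ip y (x - z) / of_real ((nrm y)\<^sup>2)"
      have n: "(nrm y)\<^sup>2 > 0" using False by simp
      have "z + t *\<^sub>C y \<in> W" by (intro csubspace_add csubspace_scaleC W zW y)
      then have "(nrm (x - z))\<^sup>2 \<le> (nrm ((x - z) - t *\<^sub>C y))\<^sup>2"
        using order_trans[OF zd d_le] by (metis diff_diff_eq)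
      also have "\<dots> = (nrm (x - z))\<^sup>2 - 2 * Re (t * ip (x - z) y) + (cmod t)\<^sup>2 * (nrm y)\<^sup>2"
        by (simp add: nrm_sq_diff[of "x - z"] nrm_scaleC power_mult_distrib ip_scaleC_right)
      also have "t * ip (x - z) y = of_real ((cmod (ip y (x - z)))\<^sup>2 / (nrm y)\<^sup>2)"
        unfolding t_def ip_commute[of "x - z" y] by (simp add: complex_norm_square[symmetric])
      also have "(cmod t)\<^sup>2 * (nrm y)\<^sup>2 = (cmod (ip y (x - z)))\<^sup>2 / (nrm y)\<^sup>2"
      proof -
    have "cmod t = cmod (ip y (x - z)) / (nrm y)\<^sup>2"
      unfolding t_def norm_divide norm_of_real by simp
    then show ?thesis using n by (simp add: power2_eq_square)
  qed
      finally have "(cmod (ip y (x - z)))\<^sup>2 / (nrm y)\<^sup>2 \<le> 0" by simp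
      then show ?thesis using n by (simp add: divide_le_0_iff)
    qed simp
  qed
qed

end

section \<open>The spectral measure of a positive contraction\<close>

definition op_poly :: "('a::complex_vector \<Rightarrow> 'a) \<Rightarrow> real poly \<Rightarrow> 'a \<Rightarrow> 'a" where
  "op_poly T p = fold_coeffs (\<lambda>a f v. a *\<^sub>R v + T (f v)) p (\<lambda>v. 0)"

definition bernstein_poly :: "nat \<Rightarrow> nat \<Rightarrow> real poly" where
  "bernstein_poly n k = smult (real (n choose k)) ([:0, 1:] ^ k * [:1, -1:] ^ (n - k))"

lemma smult_sum_right: "smult c (sum f I) = (\<Sum>i\<in>I. smult c (f i))"
  by (induction I rule: infinite_finite_induct) (simp_all add: smult_add_right)

lemma borel_measurable_poly [measurable]: "poly (p :: real poly) \<in> borel_measurable borel"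
  by (intro borel_measurable_continuous_onI continuous_intros)

text \<open>Bernstein polynomials have exact factorial moments, as a polynomial identity. Together with the
  next lemma this gives the moments of the measures below in the limit.\<close>

lemma sum_choose_bernstein_poly:
  assumes "m \<le> n"
  shows "(\<Sum>k\<le>n. smult (real (k choose m) / real (n choose m)) (bernstein_poly n k)) = [:0, 1:] ^ m"
proof -
  let ?X = "[:0, 1:] :: real poly" and ?Y = "[:1, -1:] :: real poly"
  have one: "?X + ?Y = 1" by (simp add: one_pCons)
  let ?g = "\<lambda>k. smult (real (n choose k) * real (k choose m)) (?X ^ k * ?Y ^ (n - k))"
  have "smult (real (n choose m)) (?X ^ m)
      = smult (real (n choose m)) (?X ^ m * (?X + ?Y) ^ (n - m))"
    by (simp only: one power_one mult.right_neutral)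
  also have "\<dots> = (\<Sum>j\<le>n - m. smult (real (n choose m) * real ((n - m) choose j)) (?X ^ (m + j) * ?Y ^ (n - m - j)))"
    unfolding binomial_ring
    by (simp add: sum_distrib_left smult_sum_right power_add of_nat_poly ac_simps)
  also have "\<dots> = (\<Sum>j\<le>n - m. ?g (m + j))"
  proof (rule sum.cong[OF refl])
    fix j assume "j \<in> {..n - m}"
    then have "(n choose (m + j)) * ((m + j) choose m) = (n choose m) * ((n - m) choose j)"
      using choose_mult[of m "m + j" n] assms by simp
    then have "real (n choose (m + j)) * real ((m + j) choose m) = real (n choose m) * real ((n - m) choose j)"
      by (metis of_nat_mult)
    then show "smult (real (n choose m) * real ((n - m) choose j)) (?X ^ (m + j) * ?Y ^ (n - m - j)) = ?g (m + j)"
      by (simp add: diff_diff_eq)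
  qed
  also have "\<dots> = (\<Sum>k\<in>{m..n}. ?g k)"
    by (rule sum.reindex_bij_witness[of _ "\<lambda>k. k - m" "\<lambda>j. m + j"]) (use assms in auto)
  also have "\<dots> = (\<Sum>k\<le>n. ?g k)"
    by (rule sum.mono_neutral_left) auto
  finally have "smult (real (n choose m)) (?X ^ m) = (\<Sum>k\<le>n. ?g k)" .
  then have "smult (1 / real (n choose m)) (smult (real (n choose m)) (?X ^ m))
      = smult (1 / real (n choose m)) (\<Sum>k\<le>n. ?g k)" by (rule arg_cong)
  moreover have "real (n choose m) \<noteq> 0" using assms by simp
  ultimately have "?X ^ m = smult (1 / real (n choose m)) (\<Sum>k\<le>n. ?g k)"
    by (simp del: of_nat_eq_0_iff)
  then show ?thesis
    by (simp add: bernstein_poly_def smult_sum_right ac_simps)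
qed

text \<open>Both sides are products of \<open>m\<close> factors of modulus at most 1, so their
  difference is at most the sum of the differences of the factors. The hypothesis
  \<open>2 * m \<le> n\<close> keeps \<open>n - i\<close> above \<open>n / 2\<close> and also bounds
  the negative factors, those with \<open>k < i\<close>.\<close>

lemma choose_ratio_approx:
  assumes "2 * m \<le> n" "0 < n" "k \<le> n"
  shows "\<bar>real (k choose m) / real (n choose m) - (real k / real n) ^ m\<bar> \<le> 2 * (real m)\<^sup>2 / real n"
proof -
  let ?z = "\<lambda>i. (real k - real i) / (real n - real i)" and ?w = "\<lambda>i. real k / real n"
  have "real (k choose m) / real (n choose m) = (\<Prod>i = 0..<m. ?z i)"
    unfolding binomial_gbinomial gbinomial_prod_rev by (simp add: prod_dividef)
  then have "\<bar>real (k choose m) / real (n choose m) - (real k / real n) ^ m\<bar>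
      = \<bar>(\<Prod>i = 0..<m. ?z i) - (\<Prod>i = 0..<m. ?w i)\<bar>" by simp
  also have "\<dots> \<le> (\<Sum>i = 0..<m. norm (?z i - ?w i))"
    unfolding real_norm_def[symmetric]
  proof (rule norm_prod_diff)
    fix i assume i: "i \<in> {0..<m}"
    then have "\<bar>real k - real i\<bar> \<le> real n - real i" "real n - real i > 0" using assms by auto
    then show "norm (?z i) \<le> 1" by simp
    show "norm (?w i) \<le> 1" using assms by simp
  qed
  also have "\<dots> \<le> (\<Sum>i = 0..<m. 2 * real m / real n)"
  proof (rule sum_mono)
    fix i assume i: "i \<in> {0..<m}"
    then have pos: "real n - real i > 0" "2 * (real n - real i) \<ge> real n" using assms by auto
    have "?z i - ?w i = - (real i * (real n - real k) / ((real n - real i) * real n))"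
      using pos assms by (simp add: field_simps)
    then have "norm (?z i - ?w i) = real i * (real n - real k) / ((real n - real i) * real n)"
      using pos assms by (simp add: abs_mult)
    also have "\<dots> \<le> real m * real n / ((real n / 2) * real n)"
      using pos assms i by (intro frac_le mult_mono mult_right_mono) auto
    also have "\<dots> = 2 * real m / real n" using assms by simp
    finally show "norm (?z i - ?w i) \<le> 2 * real m / real n" .
  qed
  also have "\<dots> = 2 * (real m)\<^sup>2 / real n" by (simp add: power2_eq_square)
  finally show ?thesis .
qed

lemma (in prob_space) expectation_sq_le:
  fixes X :: "'a \<Rightarrow> real"
  assumes "integrable M X" "integrable M (\<lambda>x. (X x)\<^sup>2)"
  shows "(expectation X)\<^sup>2 \<le> expectation (\<lambda>x. (X x)\<^sup>2)"
  using variance_positive[of X] by (simp add: variance_eq[OF assms])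

lemma integral_poly_moments:
  fixes p :: "real poly"
  assumes "\<And>m. c * (\<integral>x. x ^ m \<partial>M) = s m" "\<And>m. integrable M (\<lambda>x. x ^ m)"
  shows "c * (\<integral>x. poly p x \<partial>M) = (\<Sum>i\<le>degree p. coeff p i * s i)"
proof -
  have "(\<integral>x. poly p x \<partial>M) = (\<integral>x. (\<Sum>i\<le>degree p. coeff p i * x ^ i) \<partial>M)"
    by (rule Bochner_Integration.integral_cong[OF refl]) (simp add: poly_altdef)
  then show ?thesis
    unfolding assms(1)[symmetric] by (simp add: assms(2) sum_distrib_left ac_simps)
qed

section \<open>Positive contractions: polynomials and moment measures\<close>

locale positive_contraction = hilbert_ip ip for ip :: "'a::chilbert_space ip" +
  fixes T :: "'a \<Rightarrow> 'a"
  assumes lin: "clinear T"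
    and sym: "ip (T x) y = ip x (T y)"
    and pos: "0 \<le> Re (ip (T x) x)"
    and le_1: "Re (ip (T x) x) \<le> (nrm x)\<^sup>2"
begin

text \<open>This is \<open>T\<^sup>2 \<le> T\<close> in the sense of forms. Positivity is tested on
  \<open>x - T x\<close>, and \<open>le_1\<close> at \<open>T x\<close> absorbs the cubic
  term.\<close>

lemma nrm_T_sq_le: "(nrm (T x))\<^sup>2 \<le> Re (ip (T x) x)"
proof -
  have "0 \<le> Re (ip (T (x - T x)) (x - T x))" by (rule pos)
  also have "\<dots> = Re (ip (T x) x) - 2 * (nrm (T x))\<^sup>2 + Re (ip (T (T x)) (T x))"
    unfolding nrm_sq clinear_diff[OF lin] ip_diff_left ip_diff_right using sym[of "T x" x] by simp
  also have "Re (ip (T (T x)) (T x)) \<le> (nrm (T x))\<^sup>2" by (rule le_1)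
  finally show ?thesis by simp
qed

lemma nrm_T_le: "nrm (T x) \<le> nrm x"
  by (rule power2_le_imp_le[OF order_trans[OF nrm_T_sq_le le_1]]) simp

lemma tendsto_T: assumes "(X \<longlongrightarrow> x) F" shows "((\<lambda>n. T (X n)) \<longlongrightarrow> T x) F"
proof -
  have "((\<lambda>n. nrm (X n - x)) \<longlongrightarrow> 0) F" using assms by (simp add: tendsto_iff_nrm)
  then have "((\<lambda>n. nrm (T (X n) - T x)) \<longlongrightarrow> 0) F"
    by (rule Lim_null_comparison[rotated])
       (auto intro!: always_eventually nrm_T_le simp: clinear_diff[OF lin, symmetric])
  then show ?thesis by (simp add: tendsto_iff_nrm)
qed

abbreviation "pT \<equiv> op_poly T"

lemma pT_0 [simp]: "pT 0 = (\<lambda>v. 0)" by (simp add: op_poly_def)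

lemma pT_pCons: "pT (pCons a p) v = a *\<^sub>R v + T (pT p v)"
  by (cases "p = 0 \<and> a = 0") (auto simp: op_poly_def clinear_zero[OF lin])

lemma pT_add: "pT (p + q) v = pT p v + pT q v"
  by (induction p q rule: poly_induct2)
     (simp_all add: pT_pCons clinear_add[OF lin] scaleR_left_distrib)

lemma pT_smult: "pT (smult c p) v = c *\<^sub>R pT p v"
  by (induction p) (simp_all add: pT_pCons clinear_scaleR[OF lin] scaleR_right_distrib)

lemma pT_diff: "pT (p - q) v = pT p v - pT q v"
  using pT_add[of "p - q" q v] by simp

lemma pT_sum: "pT (sum p I) v = (\<Sum>i\<in>I. pT (p i) v)"
  by (induction I rule: infinite_finite_induct) (simp_all add: pT_add)

lemma pT_mult: "pT (p * q) v = pT p (pT q v)"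
  by (induction p) (simp_all add: pT_pCons pT_add pT_smult)

lemma pT_1 [simp]: "pT 1 v = v"
  by (simp add: one_pCons pT_pCons clinear_zero[OF lin])

lemma pT_X: "pT [:0, 1:] v = T v"
  by (simp add: pT_pCons clinear_zero[OF lin])

lemma pT_X_power: "pT ([:0, 1:] ^ m) v = (T ^^ m) v"
  by (induction m) (simp_all only: power_Suc pT_mult pT_X power_0 pT_1 funpow.simps o_apply id_apply)

lemma pT_T: "pT p (T v) = T (pT p v)"
  using pT_mult[of p "[:0, 1:]" v] pT_mult[of "[:0, 1:]" p v] by (simp only: pT_X mult.commute)

lemma pT_monom: "pT (monom a m) v = a *\<^sub>R (T ^^ m) v"
  by (simp add: monom_altdef pT_smult pT_X_power)

lemma pT_altdef: "pT p v = (\<Sum>i\<le>degree p. coeff p i *\<^sub>R (T ^^ i) v)"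
  by (subst poly_as_sum_of_monoms[symmetric]) (simp only: pT_sum pT_monom)

lemma pT_lin: "clinear (pT p)"
proof (induction p)
  case (pCons a p)
  then show ?case
    using lin
    by (auto simp: clinear_def pT_pCons scaleR_right_distrib scaleR_scaleC_commute scaleC_add_right)
qed (simp add: clinear_def)

lemma pT_sym: "ip (pT p x) y = ip x (pT p y)"
  by (induction p arbitrary: x y)
     (simp_all add: pT_pCons ip_add_left ip_add_right ip_scaleR sym pT_T)

text \<open>Half of each even power moves to the other side of the inner product by symmetry. What
  remains in the middle is 1, \<open>T\<close>, \<open>1 - T\<close> or
  \<open>T - T\<^sup>2\<close>, and these are positive by positive definiteness of the norm,
  \<open>pos\<close>, \<open>le_1\<close> and \<open>nrm_T_sq_le\<close>.\<close>

lemma bernstein_pos: "0 \<le> Re (ip (pT (bernstein_poly n k) v) v)"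
proof -
  have *: "0 \<le> Re (ip (pT ([:0, 1:] ^ a * [:1, -1:] ^ b) v) v)" for a b
  proof -
    let ?X = "[:0, 1:] :: real poly" and ?Y = "[:1, -1:] :: real poly"
    define r w where "r = ?X ^ (a mod 2) * ?Y ^ (b mod 2)" and "w = ?X ^ (a div 2) * ?Y ^ (b div 2)"
    have split: "x ^ n = x ^ (n mod 2) * (x ^ (n div 2) * x ^ (n div 2))" for x :: "real poly" and n
      by (metis mod_div_mult_eq mult_2_right power_add)
    have "?X ^ a * ?Y ^ b = w * (r * w)"
      unfolding r_def w_def by (subst split[of _ a], subst split[of _ b]) (simp only: ac_simps)
    then have eq: "Re (ip (pT (?X ^ a * ?Y ^ b) v) v) = Re (ip (pT r (pT w v)) (pT w v))"
      by (simp only: pT_mult pT_sym)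
    have XY: "pT (?X * ?Y) z = T z - T (T z)" "pT ?Y z = z - T z" for z
      by (simp_all only: pT_mult) (simp_all add: pT_pCons clinear_zero[OF lin] clinear_diff[OF lin] clinear_minus[OF lin])
    have "r = 1 \<or> r = ?X \<or> r = ?Y \<or> r = ?X * ?Y"
      unfolding r_def by (cases "even a"; cases "even b") (simp_all add: odd_iff_mod_2_eq_one even_iff_mod_2_eq_zero)
    then show ?thesis
      unfolding eq
      using pos le_1 nrm_T_sq_le[of "pT w v"]
      by (elim disjE) (simp_all only: XY, auto simp: pT_X Re_ip_nonneg ip_diff_left nrm_sq sym)
  qed
  show ?thesis unfolding bernstein_poly_def pT_smult ip_scaleR using *[of k "n - k"] by simp
qed

lemma sum_bernstein: "(\<Sum>k\<le>n. Re (ip (pT (bernstein_poly n k) v) v)) = (nrm v)\<^sup>2"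
proof -
  have "(\<Sum>k\<le>n. bernstein_poly n k) = 1"
    using sum_choose_bernstein_poly[of 0 n] by simp
  from arg_cong[OF this, of "\<lambda>p. pT p v"] show ?thesis
    by (simp add: pT_sum nrm_sq ip.sum_left[symmetric] Re_sum[symmetric] del: Re_sum)
qed

text \<open>The measure on the grid of the points \<open>k / n\<close> against which
  \<open>f\<close> integrates to the quadratic form at \<open>v\<close> of the \<open>n\<close>-th
  Bernstein polynomial of \<open>f\<close>, evaluated at \<open>T\<close>.\<close>

definition bernstein_measure :: "'a \<Rightarrow> nat \<Rightarrow> real measure" where
  "bernstein_measure v n = distr (point_measure {..n} (\<lambda>k. ennreal (Re (ip (pT (bernstein_poly n k) v) v)))) borel (\<lambda>k. real k / real n)"

lemma integral_bernstein_measure: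
  assumes [measurable]: "f \<in> borel_measurable borel"
  shows "(\<integral>x. f x \<partial>bernstein_measure v n) = (\<Sum>k\<le>n. Re (ip (pT (bernstein_poly n k) v) v) * f (real k / real n))"
  unfolding bernstein_measure_def
  by (subst integral_distr) (auto simp: lebesgue_integral_point_measure_finite bernstein_pos)

lemma real_distribution_bernstein_measure:
  assumes "nrm v = 1"
  shows "real_distribution (bernstein_measure v n)"
proof -
  let ?P = "point_measure {..n} (\<lambda>k. ennreal (Re (ip (pT (bernstein_poly n k) v) v)))"
  interpret prob_space ?P
  proof
    have "emeasure ?P {..n} = 1"
      by (simp add: emeasure_point_measure_finite sum_ennreal bernstein_pos sum_bernstein assms)
    then show "emeasure ?P (space ?P) = 1" by (simp add: space_point_measure)
  qed
  show ?thesis unfolding bernstein_measure_def by (rule real_distribution_distr) simp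
qed

text \<open>The clamp \<open>max 0 (min 1 x)\<close> changes nothing on the grid, which lies in
  [0,1], and turns the power into a bounded continuous function, as weak convergence
  requires.\<close>

lemma bernstein_moments:
  assumes v: "nrm v = 1"
  shows "(\<lambda>n. \<integral>x. (max 0 (min 1 x)) ^ m \<partial>bernstein_measure v n) \<longlonglongrightarrow> Re (ip ((T ^^ m) v) v)"
proof -
  let ?b = "\<lambda>n k. Re (ip (pT (bernstein_poly n k) v) v)"
  let ?I = "\<lambda>n. \<integral>x. (max 0 (min 1 x)) ^ m \<partial>bernstein_measure v n"
  have "\<bar>?I n - Re (ip ((T ^^ m) v) v)\<bar> \<le> 2 * (real m)\<^sup>2 / real n" if n: "n \<ge> 2 * m + 1" for n
  proof -
    have "Re (ip ((T ^^ m) v) v) = (\<Sum>k\<le>n. real (k choose m) / real (n choose m) * ?b n k)"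
      unfolding pT_X_power[symmetric] using n
      by (subst sum_choose_bernstein_poly[symmetric, of m n])
         (auto simp: pT_sum pT_smult ip.sum_left ip_scaleR simp del: of_real_divide)
    moreover have "?I n = (\<Sum>k\<le>n. ?b n k * (real k / real n) ^ m)"
      by (subst integral_bernstein_measure) (auto intro!: sum.cong simp: max_def min_def divide_simps)
    ultimately have "\<bar>?I n - Re (ip ((T ^^ m) v) v)\<bar>
        = \<bar>\<Sum>k\<le>n. ?b n k * (real (k choose m) / real (n choose m) - (real k / real n) ^ m)\<bar>"
      by (subst abs_minus_commute) (simp add: sum_subtractf[symmetric] algebra_simps)
    also have "\<dots> \<le> (\<Sum>k\<le>n. ?b n k * (2 * (real m)\<^sup>2 / real n))"
      by (rule order_trans[OF sum_abs sum_mono])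
         (use n in \<open>simp only: abs_mult abs_of_nonneg[OF bernstein_pos], intro mult_left_mono bernstein_pos choose_ratio_approx, auto\<close>)
    also have "\<dots> = 2 * (real m)\<^sup>2 / real n"
      unfolding sum_distrib_right[symmetric] sum_bernstein v by simp
    finally show ?thesis .
  qed
  then have "\<forall>\<^sub>F n in sequentially. norm (?I n - Re (ip ((T ^^ m) v) v)) \<le> 2 * (real m)\<^sup>2 / real n"
    unfolding real_norm_def eventually_sequentially by blast
  moreover have "(\<lambda>n. 2 * (real m)\<^sup>2 / real n) \<longlonglongrightarrow> 0" by real_asymp
  ultimately have "(\<lambda>n. ?I n - Re (ip ((T ^^ m) v) v)) \<longlonglongrightarrow> 0" by (rule Lim_null_comparison)
  then show ?thesis by (simp add: LIM_zero_iff)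
qed

text \<open>The total mass is kept outside as the factor \<open>(nrm v)\<^sup>2\<close>. Thus the
  measure is a probability distribution, to which tightness and Helly's theorem apply, and
  \<open>v = 0\<close> is covered as well.\<close>

definition moment_measure :: "'a \<Rightarrow> real measure \<Rightarrow> bool" where
  "moment_measure v M \<longleftrightarrow> real_distribution M \<and> (AE x in M. 0 \<le> x \<and> x \<le> 1) \<and>
    (\<forall>m. (nrm v)\<^sup>2 * (\<integral>x. x ^ m \<partial>M) = Re (ip ((T ^^ m) v) v))"

lemma exists_moment_measure_unit:
  assumes v: "nrm v = 1"
  shows "\<exists>M. moment_measure v M"
proof -
  have int_eq: "(\<integral>x. f x \<partial>bernstein_measure v n) = (\<integral>x. g x \<partial>bernstein_measure v n)"
    if "\<And>x. 0 \<le> x \<Longrightarrow> x \<le> 1 \<Longrightarrow> f x = g x" "f \<in> borel_measurable borel" "g \<in> borel_measurable borel"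
    for f g :: "real \<Rightarrow> real" and n
    unfolding integral_bernstein_measure[OF that(2)] integral_bernstein_measure[OF that(3)]
    by (intro sum.cong refl arg_cong2[where f="(*)"] that(1)) (auto simp: divide_simps)
  \<comment> \<open>Tightness is stated with intervals open on the left, and the left end -1 keeps
    the grid point 0 inside.\<close>
  have "measure (bernstein_measure v n) {-1<..1} = 1" for n
  proof -
    interpret real_distribution "bernstein_measure v n"
      using v by (rule real_distribution_bernstein_measure)
    have "measure (bernstein_measure v n) {-1<..1} = (\<integral>x. indicator {-1<..1} x \<partial>bernstein_measure v n)" by simp
    also have "\<dots> = (\<integral>x. 1 \<partial>bernstein_measure v n)" by (rule int_eq) auto
    finally show ?thesis using prob_space by simp
  qed
  then have "tight (bernstein_measure v)"
    unfolding tight_def using real_distribution_bernstein_measure[OF v]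
    by (intro conjI allI impI exI[of _ "-1"] exI[of _ 1]) auto
  from tight_imp_convergent_subsubsequence[OF this strict_mono_id]
  obtain r M where r: "strict_mono r" and M: "real_distribution M"
    and w: "weak_conv_m (bernstein_measure v \<circ> r) M" by auto
  interpret real_distribution M by (rule M)
  have conv: "(\<lambda>n. \<integral>x. f x \<partial>bernstein_measure v (r n)) \<longlonglongrightarrow> (\<integral>x. f x \<partial>M)"
    if "\<And>x. isCont f x" "\<And>x. norm (f x) \<le> B" for f :: "real \<Rightarrow> real" and B
    using weak_conv_imp_integral_bdd_continuous_conv[OF _ M w that] real_distribution_bernstein_measure[OF v]
    by simp
  let ?c = "\<lambda>x::real. max 0 (min 1 x)"
  have cont_c: "isCont ?c x" for x by (intro continuous_intros)
  \<comment> \<open>A bounded continuous function that vanishes exactly on [0,1]. Its integrals pass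
    to the weak limit, which therefore lives on [0,1].\<close>
  have "(\<lambda>n. \<integral>x. min 1 \<bar>x - ?c x\<bar> \<partial>bernstein_measure v (r n)) \<longlonglongrightarrow> (\<integral>x. min 1 \<bar>x - ?c x\<bar> \<partial>M)"
    by (rule conv[of _ 1]) (auto intro!: continuous_intros)
  moreover have "(\<integral>x. min 1 \<bar>x - ?c x\<bar> \<partial>bernstein_measure v n) = (\<integral>x. 0 \<partial>bernstein_measure v n)" for n
    by (rule int_eq) auto
  ultimately have "(\<integral>x. min 1 \<bar>x - ?c x\<bar> \<partial>M) = 0" by (simp add: LIMSEQ_const_iff)
  then have "AE x in M. min 1 \<bar>x - ?c x\<bar> = 0"
    by (subst (asm) integral_nonneg_eq_0_iff_AE) (auto intro!: integrable_const_bound[of _ 1])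
  then have AE: "AE x in M. 0 \<le> x \<and> x \<le> 1" by eventually_elim (auto simp: min_def max_def split: if_splits)
  have "(\<integral>x. x ^ m \<partial>M) = Re (ip ((T ^^ m) v) v)" for m
  proof -
    have "(\<integral>x. x ^ m \<partial>M) = (\<integral>x. ?c x ^ m \<partial>M)"
      by (rule integral_cong_AE) (use AE in \<open>auto simp: max_def min_def\<close>)
    moreover have "(\<lambda>n. \<integral>x. ?c x ^ m \<partial>bernstein_measure v (r n)) \<longlonglongrightarrow> (\<integral>x. ?c x ^ m \<partial>M)"
      by (rule conv[of _ 1]) (auto intro!: continuous_intros power_le_one)
    moreover have "(\<lambda>n. \<integral>x. ?c x ^ m \<partial>bernstein_measure v (r n)) \<longlonglongrightarrow> Re (ip ((T ^^ m) v) v)"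
      using LIMSEQ_subseq_LIMSEQ[OF bernstein_moments[OF v] r] by (simp add: o_def)
    ultimately show ?thesis using LIMSEQ_unique by metis
  qed
  then show ?thesis unfolding moment_measure_def using M AE v by auto
qed

lemma T_pow_scaleR: "(T ^^ m) (c *\<^sub>R v) = c *\<^sub>R (T ^^ m) v"
  by (induction m) (simp_all add: clinear_scaleR[OF lin])

lemma exists_moment_measure: "\<exists>M. moment_measure v M"
proof (cases "v = 0")
  case True
  have "(T ^^ m) 0 = 0" for m by (induction m) (simp_all add: clinear_zero[OF lin])
  moreover have "real_distribution (return borel 0)"
    by (simp add: real_distribution_def real_distribution_axioms_def prob_space_return)
  ultimately have "moment_measure v (return borel 0)"
    unfolding moment_measure_def by (auto simp: True AE_return)
  then show ?thesis by blast
next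
  case False
  define w where "w = (1 / nrm v) *\<^sub>R v"
  have n: "nrm v \<noteq> 0" using False by simp
  have v: "v = nrm v *\<^sub>R w" using n by (simp add: w_def)
  have "nrm w = 1" using n by (simp add: w_def nrm_scaleR)
  then obtain M where M: "moment_measure w M" using exists_moment_measure_unit by blast
  have "Re (ip ((T ^^ m) v) v) = (nrm v)\<^sup>2 * Re (ip ((T ^^ m) w) w)" for m
    by (subst v, subst (2) v) (simp add: T_pow_scaleR ip_scaleR power2_eq_square)
  then have "moment_measure v M"
    using M \<open>nrm w = 1\<close> unfolding moment_measure_def by simp
  then show ?thesis by blast
qed

definition \<nu> :: "'a \<Rightarrow> real measure" where "\<nu> v = (SOME M. moment_measure v M)"

lemma moment_measure_\<nu>: "moment_measure v (\<nu> v)"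
  unfolding \<nu>_def by (rule someI_ex[OF exists_moment_measure])

lemma real_distribution_\<nu>: "real_distribution (\<nu> v)"
  and AE_\<nu>: "AE x in \<nu> v. 0 \<le> x \<and> x \<le> 1"
  using moment_measure_\<nu>[of v] by (auto simp: moment_measure_def)

lemma prob_space_\<nu>: "prob_space (\<nu> v)"
  using real_distribution_\<nu>[of v] by (simp add: real_distribution_def)

lemma sets_\<nu> [measurable_cong, simp]: "sets (\<nu> v) = sets borel"
  by (rule real_distribution.events_eq_borel[OF real_distribution_\<nu>])

lemma space_\<nu> [simp]: "space (\<nu> v) = UNIV"
  by (rule real_distribution.space_eq_univ[OF real_distribution_\<nu>])

lemma integrable_\<nu>:
  fixes f :: "real \<Rightarrow> real"
  assumes "f \<in> borel_measurable borel" "\<And>x. 0 \<le> x \<Longrightarrow> x \<le> 1 \<Longrightarrow> \<bar>f x\<bar> \<le> B"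
  shows "integrable (\<nu> v) f"
proof -
  interpret prob_space "\<nu> v" by (rule prob_space_\<nu>)
  show ?thesis
    by (rule integrable_const_bound[of _ B]) (use AE_\<nu>[of v] assms in auto)
qed

lemma integral_\<nu>_le:
  fixes f :: "real \<Rightarrow> real"
  assumes "f \<in> borel_measurable borel" "\<And>x. 0 \<le> x \<Longrightarrow> x \<le> 1 \<Longrightarrow> \<bar>f x\<bar> \<le> B"
  shows "(\<integral>x. f x \<partial>\<nu> v) \<le> B"
proof -
  interpret prob_space "\<nu> v" by (rule prob_space_\<nu>)
  have "(\<integral>x. f x \<partial>\<nu> v) \<le> (\<integral>x. B \<partial>\<nu> v)"
  proof (intro integral_mono_AE integrable_\<nu>[OF assms] integrable_const)
    show "AE x in \<nu> v. f x \<le> B" using AE_\<nu>[of v] by eventually_elim (use assms(2) abs_le_D1 in blast)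
  qed
  then show ?thesis using prob_space by simp
qed

lemma poly_bounded:
  obtains B where "B \<ge> 0" "\<And>x. 0 \<le> x \<Longrightarrow> x \<le> 1 \<Longrightarrow> \<bar>poly p x\<bar> \<le> (B::real)"
proof -
  have "compact (poly p ` {0..1})" by (intro compact_continuous_image continuous_intros) auto
  then obtain B where "\<forall>y\<in>poly p ` {0..1}. norm y \<le> B" using compact_imp_bounded bounded_iff by metis
  then have "\<bar>poly p x\<bar> \<le> max B 0" if "0 \<le> x" "x \<le> 1" for x
    using that by (intro max.coboundedI1) auto
  then show thesis using that[of "max B 0"] by simp
qed

lemma integrable_\<nu>_poly [simp]: "integrable (\<nu> v) (\<lambda>x. poly p x)"
  by (rule poly_bounded[of p]) (rule integrable_\<nu>, auto)

lemma integral_\<nu>_poly: "(nrm v)\<^sup>2 * (\<integral>x. poly p x \<partial>\<nu> v) = Re (ip (pT p v) v)"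
proof -
  have "integrable (\<nu> v) (\<lambda>x. x ^ m)" for m
    using integrable_\<nu>_poly[of v "monom 1 m"] by (simp add: poly_monom)
  then show ?thesis
    using moment_measure_\<nu>[of v]
    by (subst integral_poly_moments[where s = "\<lambda>m. Re (ip ((T ^^ m) v) v)"])
       (auto simp: moment_measure_def pT_altdef ip.sum_left ip_scaleR)
qed

lemma nrm_pT_sq: "(nrm (pT p v))\<^sup>2 = (nrm v)\<^sup>2 * (\<integral>x. (poly p x)\<^sup>2 \<partial>\<nu> v)"
  using integral_\<nu>_poly[of v "p * p"] by (simp add: nrm_sq pT_mult pT_sym power2_eq_square[of "poly p _"])

end

text \<open>Polarization, hence special to complex scalars. It reduces operator identities between
  spectral projections to identities between the numbers \<open>measure (\<nu> v) S\<close>.\<close>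

lemma (in hilbert_ip) ip_self_zero_imp_zero:
  assumes lin: "clinear B" and zero: "\<And>v. ip (B v) v = 0"
  shows "B v = 0"
proof (rule ip_eqI_left)
  fix w
  have "(\<Sum>k<4::nat. (- \<i>) ^ k * ip (B (v + (\<i> ^ k) *\<^sub>C w)) (v + (\<i> ^ k) *\<^sub>C w)) / 4 = ip (B v) w"
    by (rule polarization[where B = "\<lambda>x y. ip (B x) y"])
       (simp_all add: clinear_add[OF lin] clinear_scaleC[OF lin] ip_add_left ip_add_right ip_scaleC_left ip_scaleC_right)
  then show "ip (B v) w = ip 0 w" by (simp add: zero)
qed

lemma sq_diff_le: "(a - b)\<^sup>2 \<le> 2 * (a - c)\<^sup>2 + 2 * (b - c)\<^sup>2" for a b c :: real
  using zero_le_power2[of "(a - c) + (b - c)"] by (simp add: power2_eq_square algebra_simps)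

lemma tendsto_0_sq_bound:
  fixes a :: "nat \<Rightarrow> real"
  assumes "\<And>n. (a n)\<^sup>2 \<le> b n" "b \<longlonglongrightarrow> 0"
  shows "a \<longlonglongrightarrow> 0"
proof -
  have "(\<lambda>n. (a n)\<^sup>2) \<longlonglongrightarrow> 0"
    by (rule Lim_null_comparison[OF _ assms(2)]) (use assms(1) in auto)
  from tendsto_real_sqrt[OF this] show ?thesis by (simp add: tendsto_rabs_zero_iff)
qed

lemma integral_sq_diff_le:
  fixes f g h :: "'b \<Rightarrow> real"
  assumes "integrable M (\<lambda>x. (f x - h x)\<^sup>2)" "integrable M (\<lambda>x. (g x - h x)\<^sup>2)" "integrable M (\<lambda>x. (f x - g x)\<^sup>2)"
  shows "(\<integral>x. (f x - g x)\<^sup>2 \<partial>M) \<le> 2 * (\<integral>x. (f x - h x)\<^sup>2 \<partial>M) + 2 * (\<integral>x. (g x - h x)\<^sup>2 \<partial>M)"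
proof -
  have "(\<integral>x. (f x - g x)\<^sup>2 \<partial>M) \<le> (\<integral>x. 2 * (f x - h x)\<^sup>2 + 2 * (g x - h x)\<^sup>2 \<partial>M)"
    by (rule integral_mono) (use assms sq_diff_le in auto)
  then show ?thesis using assms by simp
qed

section \<open>Approximation of bounded Borel functions by polynomials in mean square\<close>

context positive_contraction
begin

text \<open>Bounded on [0,1] only, where each \<open>\<nu> v\<close> lives, so that polynomials
  qualify.\<close>

definition bdd_meas :: "(real \<Rightarrow> real) \<Rightarrow> bool" where
  "bdd_meas f \<longleftrightarrow> f \<in> borel_measurable borel \<and> (\<exists>B. \<forall>x. 0 \<le> x \<longrightarrow> x \<le> 1 \<longrightarrow> \<bar>f x\<bar> \<le> B)"

lemma bdd_meas_add: assumes "bdd_meas f" "bdd_meas g" shows "bdd_meas (\<lambda>x. f x + g x)"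
proof -
  obtain A B where "\<And>x. 0 \<le> x \<Longrightarrow> x \<le> 1 \<Longrightarrow> \<bar>f x\<bar> \<le> A" "\<And>x. 0 \<le> x \<Longrightarrow> x \<le> 1 \<Longrightarrow> \<bar>g x\<bar> \<le> B"
    using assms unfolding bdd_meas_def by metis
  then have "\<bar>f x + g x\<bar> \<le> A + B" if "0 \<le> x" "x \<le> 1" for x
    using that by (smt (verit))
  then show ?thesis using assms unfolding bdd_meas_def by auto
qed

lemma bdd_meas_mult: assumes "bdd_meas f" "bdd_meas g" shows "bdd_meas (\<lambda>x. f x * g x)"
proof -
  obtain A B where "\<And>x. 0 \<le> x \<Longrightarrow> x \<le> 1 \<Longrightarrow> \<bar>f x\<bar> \<le> A" "\<And>x. 0 \<le> x \<Longrightarrow> x \<le> 1 \<Longrightarrow> \<bar>g x\<bar> \<le> B"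
    using assms unfolding bdd_meas_def by metis
  then have "\<bar>f x * g x\<bar> \<le> A * B" if "0 \<le> x" "x \<le> 1" for x
    using that by (simp add: abs_mult mult_mono')
  then show ?thesis using assms unfolding bdd_meas_def by auto
qed

lemma bdd_meas_const: "bdd_meas (\<lambda>x. c)" unfolding bdd_meas_def by auto
lemma bdd_meas_diff: "bdd_meas f \<Longrightarrow> bdd_meas g \<Longrightarrow> bdd_meas (\<lambda>x. f x - g x)"
  using bdd_meas_add[of f "\<lambda>x. (-1) * g x"] bdd_meas_mult[OF bdd_meas_const[of "-1"]] by simp
lemma bdd_meas_power2: "bdd_meas f \<Longrightarrow> bdd_meas (\<lambda>x. (f x)\<^sup>2)"
  using bdd_meas_mult[of f f] by (simp add: power2_eq_square)
lemma bdd_meas_poly [simp]: "bdd_meas (\<lambda>x. poly p x)"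
  unfolding bdd_meas_def by (rule poly_bounded[of p]) auto
lemma bdd_meas_indicator: "S \<in> sets borel \<Longrightarrow> bdd_meas (indicator S)"
  unfolding bdd_meas_def by (auto intro!: exI[of _ 1] simp: indicator_def)
lemma integrable_bdd_meas: "bdd_meas f \<Longrightarrow> integrable (\<nu> v) f"
  unfolding bdd_meas_def using integrable_\<nu> by blast

lemmas bdd_meas_intros = bdd_meas_add bdd_meas_mult bdd_meas_diff bdd_meas_power2 bdd_meas_indicator

text \<open>One polynomial has to serve a finite set of vectors at once: linearity of the
  projections is proved by comparing limits at \<open>x\<close>, \<open>y\<close> and
  \<open>x + y\<close> along a common sequence.\<close>

definition approximable :: "(real \<Rightarrow> real) \<Rightarrow> bool" where
  "approximable f \<longleftrightarrow> bdd_meas f \<and> (\<forall>V e. finite V \<longrightarrow> 0 < e \<longrightarrow>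
    (\<exists>p. \<forall>v\<in>V. (\<integral>x. (f x - poly p x)\<^sup>2 \<partial>\<nu> v) < e))"

lemma approximableD:
  assumes "approximable f" "finite V" "0 < e"
  shows "\<exists>p. \<forall>v\<in>V. (\<integral>x. (f x - poly p x)\<^sup>2 \<partial>\<nu> v) < e"
  using assms by (auto simp: approximable_def)

lemma approximable_diff:
  assumes f: "approximable f" and g: "approximable g"
  shows "approximable (\<lambda>x. f x - g x)"
  unfolding approximable_def
proof (intro conjI allI impI)
  have b: "bdd_meas f" "bdd_meas g" using assms by (auto simp: approximable_def)
  then show "bdd_meas (\<lambda>x. f x - g x)" by (intro bdd_meas_diff)
  fix V :: "'a set" and e :: real assume V: "finite V" and e: "e > 0"
  obtain p where p: "\<And>v. v \<in> V \<Longrightarrow> (\<integral>x. (f x - poly p x)\<^sup>2 \<partial>\<nu> v) < e / 4"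
    using approximableD[OF f V, of "e / 4"] e by auto
  obtain q where q: "\<And>v. v \<in> V \<Longrightarrow> (\<integral>x. (g x - poly q x)\<^sup>2 \<partial>\<nu> v) < e / 4"
    using approximableD[OF g V, of "e / 4"] e by auto
  have "(\<integral>x. (f x - g x - poly (p - q) x)\<^sup>2 \<partial>\<nu> v) < e" if "v \<in> V" for v
  proof -
    have i: "integrable (\<nu> v) (\<lambda>x. (f x - poly p x)\<^sup>2)" "integrable (\<nu> v) (\<lambda>x. (g x - poly q x)\<^sup>2)"
      "integrable (\<nu> v) (\<lambda>x. (f x - g x - poly (p - q) x)\<^sup>2)"
      by (intro integrable_bdd_meas bdd_meas_intros b bdd_meas_poly)+
    have "(\<integral>x. (f x - g x - poly (p - q) x)\<^sup>2 \<partial>\<nu> v)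
        \<le> (\<integral>x. 2 * (f x - poly p x)\<^sup>2 + 2 * (g x - poly q x)\<^sup>2 \<partial>\<nu> v)"
    proof (rule integral_mono)
      fix x
      show "(f x - g x - poly (p - q) x)\<^sup>2 \<le> 2 * (f x - poly p x)\<^sup>2 + 2 * (g x - poly q x)\<^sup>2"
        using sq_diff_le[of "f x - poly p x" "g x - poly q x" 0] by (simp add: algebra_simps)
    qed (use i in auto)
    also have "\<dots> = 2 * (\<integral>x. (f x - poly p x)\<^sup>2 \<partial>\<nu> v) + 2 * (\<integral>x. (g x - poly q x)\<^sup>2 \<partial>\<nu> v)"
      using i by simp
    finally show ?thesis using p[OF that] q[OF that] by linarith
  qed
  then show "\<exists>p. \<forall>v\<in>V. (\<integral>x. (f x - g x - poly p x)\<^sup>2 \<partial>\<nu> v) < e" by blast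
qed

lemma approximable_poly: "approximable (\<lambda>x. poly p x)"
  unfolding approximable_def by (auto intro!: exI[of _ p])

lemma approximable_const: "approximable (\<lambda>x. c)"
  using approximable_poly[of "[:c:]"] by simp

lemma approximable_add: "approximable f \<Longrightarrow> approximable g \<Longrightarrow> approximable (\<lambda>x. f x + g x)"
  using approximable_diff[OF _ approximable_diff[OF approximable_const[of 0]], of f g] by simp

lemma approximable_lim:
  assumes f: "\<And>n. approximable (F n)" and lim: "\<And>x. (\<lambda>n. F n x) \<longlonglongrightarrow> f x" and B: "\<And>n x. \<bar>F n x\<bar> \<le> B"
  shows "approximable f"
  unfolding approximable_def
proof (intro conjI allI impI)
  have b: "bdd_meas (F n)" for n using f by (simp add: approximable_def)
  then have [measurable]: "F n \<in> borel_measurable borel" for n by (simp add: bdd_meas_def)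
  have [measurable]: "f \<in> borel_measurable borel" by (rule borel_measurable_LIMSEQ_real[OF lim]) simp
  have fB: "\<bar>f x\<bar> \<le> B" for x
    by (rule LIMSEQ_le_const2[OF tendsto_rabs[OF lim]]) (use B in auto)
  then show bf: "bdd_meas f" unfolding bdd_meas_def by auto
  fix V :: "'a set" and e :: real assume V: "finite V" and e: "e > 0"
  have "(\<lambda>n. \<integral>x. (f x - F n x)\<^sup>2 \<partial>\<nu> v) \<longlonglongrightarrow> 0" for v
  proof -
    interpret prob_space "\<nu> v" by (rule prob_space_\<nu>)
    have "(\<lambda>n. \<integral>x. (f x - F n x)\<^sup>2 \<partial>\<nu> v) \<longlonglongrightarrow> (\<integral>x. 0 \<partial>\<nu> v)"
    proof (rule integral_dominated_convergence[where w = "\<lambda>x. (2 * B)\<^sup>2"])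
      show "AE x in \<nu> v. (\<lambda>n. (f x - F n x)\<^sup>2) \<longlonglongrightarrow> 0"
      proof (intro AE_I2)
        fix x
        have "(\<lambda>n. (f x - F n x)\<^sup>2) \<longlonglongrightarrow> (f x - f x)\<^sup>2" by (intro tendsto_intros lim)
        then show "(\<lambda>n. (f x - F n x)\<^sup>2) \<longlonglongrightarrow> 0" by simp
      qed
      have "\<bar>f x - F n x\<bar> \<le> \<bar>2 * B\<bar>" for x n using fB[of x] B[of n x] by linarith
      then show "AE x in \<nu> v. norm ((f x - F n x)\<^sup>2) \<le> (2 * B)\<^sup>2" for n
        by (intro AE_I2) (simp only: abs_le_square_iff real_norm_def abs_power2)
    qed auto
    then show ?thesis by simp
  qed
  then have "\<forall>\<^sub>F n in sequentially. (\<integral>x. (f x - F n x)\<^sup>2 \<partial>\<nu> v) < e / 4" for v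
    using e by (intro order_tendstoD) auto
  then have "\<forall>\<^sub>F n in sequentially. \<forall>v\<in>V. (\<integral>x. (f x - F n x)\<^sup>2 \<partial>\<nu> v) < e / 4"
    using V by (simp add: eventually_ball_finite)
  then obtain n where n: "\<And>v. v \<in> V \<Longrightarrow> (\<integral>x. (f x - F n x)\<^sup>2 \<partial>\<nu> v) < e / 4"
    using eventually_happens'[OF sequentially_bot] by blast
  obtain p where p: "\<And>v. v \<in> V \<Longrightarrow> (\<integral>x. (F n x - poly p x)\<^sup>2 \<partial>\<nu> v) < e / 4"
    using approximableD[OF f V, of "e / 4" n] e by auto
  have "(\<integral>x. (f x - poly p x)\<^sup>2 \<partial>\<nu> v) < e" if "v \<in> V" for v
  proof -
    have "(\<integral>x. (f x - poly p x)\<^sup>2 \<partial>\<nu> v) \<le> 2 * (\<integral>x. (f x - F n x)\<^sup>2 \<partial>\<nu> v) + 2 * (\<integral>x. (poly p x - F n x)\<^sup>2 \<partial>\<nu> v)"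
      by (intro integral_sq_diff_le integrable_bdd_meas bdd_meas_intros b bf bdd_meas_poly)
    then show ?thesis using p[OF that] n[OF that] by (simp add: power2_commute[of "poly p _"])
  qed
  then show "\<exists>p. \<forall>v\<in>V. (\<integral>x. (f x - poly p x)\<^sup>2 \<partial>\<nu> v) < e" by blast
qed

lemma approximable_continuous:
  assumes f: "continuous_on UNIV f"
  shows "approximable f"
  unfolding approximable_def
proof (intro conjI allI impI)
  have fm [measurable]: "f \<in> borel_measurable borel" using f by (rule borel_measurable_continuous_onI)
  have "compact (f ` {0..1})" by (intro compact_continuous_image continuous_on_subset[OF f]) auto
  then obtain B where "\<forall>y\<in>f ` {0..1}. norm y \<le> B" using compact_imp_bounded bounded_iff by metis
  then show bf: "bdd_meas f" using fm unfolding bdd_meas_def by (intro conjI exI[of _ B]) auto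
  fix V :: "'a set" and e :: real assume V: "finite V" and e: "e > 0"
  define d where "d = sqrt (e / 2)"
  have d: "d > 0" "d\<^sup>2 = e / 2" using e by (auto simp: d_def)
  obtain g where g: "real_polynomial_function g" "\<And>x. x \<in> {0..1::real} \<Longrightarrow> \<bar>f x - g x\<bar> < d"
    using Stone_Weierstrass_real_polynomial_function[of "{0..1}" f d] d continuous_on_subset[OF f] by auto
  then obtain a n where an: "g = (\<lambda>x. \<Sum>i\<le>n. a i * x ^ i)"
    using real_polynomial_function_iff_sum by metis
  define p where "p = (\<Sum>i\<le>n. monom (a i) i)"
  have gp: "g x = poly p x" for x by (simp add: an p_def poly_sum poly_monom)
  have "(\<integral>x. (f x - poly p x)\<^sup>2 \<partial>\<nu> v) \<le> d\<^sup>2" for v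
  proof (rule integral_\<nu>_le)
    fix x :: real assume "0 \<le> x" "x \<le> 1"
    then have "\<bar>f x - poly p x\<bar> < d" using g(2)[of x] by (simp add: gp)
    then show "\<bar>(f x - poly p x)\<^sup>2\<bar> \<le> d\<^sup>2" using d(1) by (simp add: abs_le_square_iff[symmetric])
  qed measurable
  then have "\<forall>v\<in>V. (\<integral>x. (f x - poly p x)\<^sup>2 \<partial>\<nu> v) < e" 
    using d e by (intro ballI) (rule order.strict_trans1, assumption, simp)
  then show "\<exists>p. \<forall>v\<in>V. (\<integral>x. (f x - poly p x)\<^sup>2 \<partial>\<nu> v) < e" by blast
qed

lemma approximable_atMost: "approximable (indicator {..a})"
proof (rule approximable_lim)
  \<comment> \<open>For \<open>n > 0\<close>, the ramp that falls from 1 at \<open>a\<close> to 0 at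
    \<open>a + 1 / n\<close>.\<close>
  let ?F = "\<lambda>n x. max 0 (min 1 (1 - real n * (x - a)))"
  show "approximable (?F n)" for n by (rule approximable_continuous) (intro continuous_intros)
  show "\<bar>?F n x\<bar> \<le> 1" for n x by auto
  show "(\<lambda>n. ?F n x) \<longlonglongrightarrow> indicator {..a} x" for x
  proof (cases "x \<le> a")
    case True
    then have "real n * (x - a) \<le> 0" for n by (simp add: mult_nonneg_nonpos)
    then have "?F n x = 1" for n using \<open>\<And>n. real n * (x - a) \<le> 0\<close>[of n] by linarith
    then show ?thesis using True by simp
  next
    case False
    then have "\<forall>\<^sub>F n in sequentially. 1 - real n * (x - a) \<le> 0"
      by real_asymp
    then have "\<forall>\<^sub>F n in sequentially. ?F n x = 0" by eventually_elim auto
    then show ?thesis using False by (auto intro: tendsto_eventually)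
  qed
qed

text \<open>Dynkin's induction from the half-lines: differences handle complements, and bounded
  pointwise limits handle countable disjoint unions.\<close>

lemma approximable_indicator:
  assumes "S \<in> sets borel"
  shows "approximable (indicator S)"
proof -
  have "Int_stable (range (\<lambda>a::real. {..a}))"
    by (auto simp: Int_stable_def)
  moreover have "range (\<lambda>a::real. {..a}) \<subseteq> Pow UNIV" by simp
  moreover have "S \<in> sigma_sets UNIV (range (\<lambda>a::real. {..a}))"
    using assms by (simp add: borel_eq_atMost)
  ultimately show ?thesis
  proof (induction rule: sigma_sets_induct_disjoint)
    case (compl A)
    have "indicator (UNIV - A) = (\<lambda>x. 1 - indicator A x :: real)"
      by (auto simp: indicator_def)
    then show ?case using approximable_diff[OF approximable_const compl(2)] by simp
  next
    case (union A)
    have sum: "approximable (\<lambda>x. \<Sum>i<n. indicator (A i) x)" for n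
      by (induction n) (auto intro!: approximable_const approximable_add union(3))
    have eq: "(\<lambda>x. \<Sum>i<n. indicator (A i) x) = (indicator (\<Union>i<n. A i) :: real \<Rightarrow> real)" for n
    proof
      have "disjoint_family_on A {..<n}" using union(1) by (auto simp: disjoint_family_on_def)
      then show "(\<Sum>i<n. indicator (A i) x) = (indicator (\<Union>i<n. A i) x :: real)" for x
        by (simp add: indicator_UN_disjoint)
    qed
    show ?case
    proof (rule approximable_lim)
      show "approximable (indicator (\<Union>i<n. A i))" for n using sum[of n] unfolding eq .
      show "(\<lambda>n. indicator (\<Union>i<n. A i) x :: real) \<longlonglongrightarrow> indicator (\<Union>i. A i) x" for x
        by (rule LIMSEQ_indicator_UN)
      show "\<bar>indicator (\<Union>i<n. A i) x :: real\<bar> \<le> 1" for n x by (simp add: indicator_def)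
    qed
  next
    case empty
    then show ?case using approximable_const[of 0] by (simp add: indicator_def[abs_def])
  next
    case (basic A)
    then show ?case using approximable_atMost by auto
  qed
qed

section \<open>The spectral projections of a positive contraction\<close>

definition approx_seq :: "real set \<Rightarrow> 'a \<Rightarrow> (nat \<Rightarrow> real poly) \<Rightarrow> bool" where
  "approx_seq S v p \<longleftrightarrow> (\<lambda>n. \<integral>x. (indicator S x - poly (p n) x)\<^sup>2 \<partial>\<nu> v) \<longlonglongrightarrow> 0"

lemma approx_seq_exists:
  assumes "S \<in> sets borel" "finite V"
  obtains p where "\<And>v. v \<in> V \<Longrightarrow> approx_seq S v p"
proof -
  have "\<exists>p. \<forall>v\<in>V. (\<integral>x. (indicator S x - poly p x)\<^sup>2 \<partial>\<nu> v) < inverse (Suc n)" for n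
    by (rule approximableD[OF approximable_indicator[OF assms(1)] assms(2)]) simp
  then obtain p where p: "\<And>n v. v \<in> V \<Longrightarrow> (\<integral>x. (indicator S x - poly (p n) x)\<^sup>2 \<partial>\<nu> v) < inverse (Suc n)"
    by metis
  have "approx_seq S v p" if "v \<in> V" for v
    unfolding approx_seq_def
    by (rule Lim_null_comparison[OF _ LIMSEQ_inverse_real_of_nat])
       (use p[OF that] in \<open>auto intro!: always_eventually less_imp_le\<close>)
  then show thesis using that by blast
qed

lemma nrm_pT_diff_le:
  assumes S: "S \<in> sets borel"
  shows "(nrm (pT p v - pT q v))\<^sup>2 \<le> (nrm v)\<^sup>2 * (2 * (\<integral>x. (indicator S x - poly p x)\<^sup>2 \<partial>\<nu> v)
    + 2 * (\<integral>x. (indicator S x - poly q x)\<^sup>2 \<partial>\<nu> v))"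
proof -
  have "(\<integral>x. (poly p x - poly q x)\<^sup>2 \<partial>\<nu> v)
      \<le> 2 * (\<integral>x. (poly p x - indicator S x)\<^sup>2 \<partial>\<nu> v) + 2 * (\<integral>x. (poly q x - indicator S x)\<^sup>2 \<partial>\<nu> v)"
    by (intro integral_sq_diff_le integrable_bdd_meas bdd_meas_intros S bdd_meas_poly)
  then show ?thesis
    unfolding pT_diff[symmetric] nrm_pT_sq poly_diff power2_commute[of "indicator S _"]
    by (rule mult_left_mono) simp
qed

text \<open>By \<open>nrm_pT_sq\<close> the map sending a polynomial \<open>p\<close> to \<open>p(T) v\<close> is a multiple of an isometry on
  \<open>L\<^sup>2(\<nu> v)\<close>, so \<open>p(T) v\<close> converges when \<open>p\<close> tends to the indicator of \<open>S\<close> there.\<close>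

definition proj :: "real set \<Rightarrow> 'a \<Rightarrow> 'a" where
  "proj S v = (THE w. \<forall>p. approx_seq S v p \<longrightarrow> (\<lambda>n. pT (p n) v) \<longlonglongrightarrow> w)"

lemma proj_lim:
  assumes S: "S \<in> sets borel" and p: "approx_seq S v p"
  shows "(\<lambda>n. pT (p n) v) \<longlonglongrightarrow> proj S v"
proof -
  obtain w where w: "(\<lambda>n. pT (p n) v) \<longlonglongrightarrow> w"
  proof (rule convergent_nrm_Cauchy[of "\<lambda>n. pT (p n) v"])
    fix e :: real assume e: "e > 0"
    let ?I = "\<lambda>n. \<integral>x. (indicator S x - poly (p n) x)\<^sup>2 \<partial>\<nu> v"
    have "(\<lambda>n. (nrm v)\<^sup>2 * (4 * ?I n)) \<longlonglongrightarrow> (nrm v)\<^sup>2 * (4 * 0)"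
      using p unfolding approx_seq_def by (intro tendsto_intros)
    then have "\<forall>\<^sub>F n in sequentially. (nrm v)\<^sup>2 * (4 * ?I n) < e\<^sup>2"
      using e by (intro order_tendstoD) auto
    then obtain M where M: "\<And>n. n \<ge> M \<Longrightarrow> (nrm v)\<^sup>2 * (4 * ?I n) < e\<^sup>2"
      unfolding eventually_sequentially by blast
    show "\<exists>M. \<forall>m\<ge>M. \<forall>n\<ge>M. nrm (pT (p m) v - pT (p n) v) < e"
    proof (intro exI allI impI)
      fix m n assume "m \<ge> M" "n \<ge> M"
      then have "(nrm (pT (p m) v - pT (p n) v))\<^sup>2 < e\<^sup>2"
        using nrm_pT_diff_le[OF S, of "p m" v "p n"] M[of m] M[of n] by (simp add: algebra_simps)
      then show "nrm (pT (p m) v - pT (p n) v) < e" using e by (simp add: power2_less_imp_less)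
    qed
  qed
  have all: "(\<lambda>n. pT (q n) v) \<longlonglongrightarrow> w" if q: "approx_seq S v q" for q
  proof -
    let ?I = "\<lambda>p n. \<integral>x. (indicator S x - poly (p n) x)\<^sup>2 \<partial>\<nu> v"
    have "(\<lambda>n. (nrm v)\<^sup>2 * (2 * ?I p n + 2 * ?I q n)) \<longlonglongrightarrow> (nrm v)\<^sup>2 * (2 * 0 + 2 * 0)"
      using p q unfolding approx_seq_def by (intro tendsto_intros)
    then have "(\<lambda>n. nrm (pT (p n) v - pT (q n) v)) \<longlonglongrightarrow> 0"
      unfolding mult_zero_right add_0_left
      by (rule tendsto_0_sq_bound[rotated]) (rule nrm_pT_diff_le[OF S])
    then have "(\<lambda>n. nrm ((pT (p n) v - pT (q n) v) - 0)) \<longlonglongrightarrow> 0" by (simp only: diff_0_right)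
    then have "(\<lambda>n. pT (p n) v - pT (q n) v) \<longlonglongrightarrow> 0" by (simp only: tendsto_iff_nrm)
    from tendsto_diff[OF w this] show ?thesis by simp
  qed
  have "proj S v = w"
    unfolding proj_def
  proof (rule the_equality)
    show "\<forall>p. approx_seq S v p \<longrightarrow> (\<lambda>n. pT (p n) v) \<longlonglongrightarrow> w" using all by blast
    fix z assume "\<forall>p. approx_seq S v p \<longrightarrow> (\<lambda>n. pT (p n) v) \<longlonglongrightarrow> z"
    then have "(\<lambda>n. pT (p n) v) \<longlonglongrightarrow> z" using p by blast
    then show "z = w" using w by (rule LIMSEQ_unique)
  qed
  then show ?thesis using w by simp
qed

lemma proj_lim2:
  assumes S: "S \<in> sets borel" and "finite V"
  shows "\<exists>p. \<forall>v\<in>V. approx_seq S v p \<and> (\<lambda>n. pT (p n) v) \<longlonglongrightarrow> proj S v"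
proof -
  obtain p where "\<And>v. v \<in> V \<Longrightarrow> approx_seq S v p"
    using approx_seq_exists[OF assms] by blast
  then show ?thesis using proj_lim[OF S] by blast
qed

text \<open>The passage from projections to measures: a limit in \<open>integral_\<nu>_poly\<close>
  for the products \<open>p n * g\<close>. Since \<open>g\<close> is bounded on [0,1],
  \<open>expectation_sq_le\<close> turns mean square convergence of \<open>p n\<close> into
  convergence of these integrals.\<close>

lemma ip_pT_proj:
  assumes S: "S \<in> sets borel"
  shows "Re (ip (pT g v) (proj S v)) = (nrm v)\<^sup>2 * (\<integral>x. indicator S x * poly g x \<partial>\<nu> v)"
proof -
  interpret prob_space "\<nu> v" by (rule prob_space_\<nu>)
  obtain p where p: "approx_seq S v p" "(\<lambda>n. pT (p n) v) \<longlonglongrightarrow> proj S v"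
    using proj_lim2[OF S, of "{v}"] by auto
  obtain B where B: "\<And>x. 0 \<le> x \<Longrightarrow> x \<le> 1 \<Longrightarrow> \<bar>poly g x\<bar> \<le> B" "B \<ge> 0" using poly_bounded by metis
  let ?h = "\<lambda>n x. poly g x * (indicator S x - poly (p n) x)"
  let ?I = "\<lambda>n. \<integral>x. (indicator S x - poly (p n) x)\<^sup>2 \<partial>\<nu> v"
  have i: "integrable (\<nu> v) (?h n)" "integrable (\<nu> v) (\<lambda>x. (?h n x)\<^sup>2)" "integrable (\<nu> v) (\<lambda>x. (indicator S x - poly (p n) x)\<^sup>2)"
    "integrable (\<nu> v) (\<lambda>x. indicator S x * poly g x)" "integrable (\<nu> v) (\<lambda>x. poly g x * poly (p n) x)" for n
    by (intro integrable_bdd_meas bdd_meas_intros S bdd_meas_poly)+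
  have "(\<integral>x. ?h n x \<partial>\<nu> v)\<^sup>2 \<le> B\<^sup>2 * ?I n" for n
  proof -
    have "(\<integral>x. ?h n x \<partial>\<nu> v)\<^sup>2 \<le> (\<integral>x. (?h n x)\<^sup>2 \<partial>\<nu> v)" by (rule expectation_sq_le[OF i(1,2)])
    also have "\<dots> \<le> (\<integral>x. B\<^sup>2 * (indicator S x - poly (p n) x)\<^sup>2 \<partial>\<nu> v)"
    proof (rule integral_mono_AE)
      show "AE x in \<nu> v. (?h n x)\<^sup>2 \<le> B\<^sup>2 * (indicator S x - poly (p n) x)\<^sup>2"
        using AE_\<nu>[of v]
      proof eventually_elim
        case (elim x)
        have "(poly g x)\<^sup>2 \<le> B\<^sup>2" using B elim by (simp add: abs_le_square_iff[symmetric])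
        then show ?case by (simp add: power_mult_distrib mult_right_mono)
      qed
    qed (use i in auto)
    finally show ?thesis using i by simp
  qed
  moreover have "(\<lambda>n. B\<^sup>2 * ?I n) \<longlonglongrightarrow> B\<^sup>2 * 0"
    using p(1) unfolding approx_seq_def by (intro tendsto_intros)
  ultimately have h0: "(\<lambda>n. \<integral>x. ?h n x \<partial>\<nu> v) \<longlonglongrightarrow> 0"
    unfolding mult_zero_right by (rule tendsto_0_sq_bound)
  have "(\<integral>x. poly (g * p n) x \<partial>\<nu> v) = (\<integral>x. indicator S x * poly g x \<partial>\<nu> v) - (\<integral>x. ?h n x \<partial>\<nu> v)" for n
    by (subst Bochner_Integration.integral_diff[symmetric, OF i(4,1)])
       (intro Bochner_Integration.integral_cong, auto simp: algebra_simps)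
  then have "Re (ip (pT g v) (pT (p n) v))
      = (nrm v)\<^sup>2 * ((\<integral>x. indicator S x * poly g x \<partial>\<nu> v) - (\<integral>x. ?h n x \<partial>\<nu> v))" for n
    using integral_\<nu>_poly[of v "p n * g"] by (simp add: pT_mult pT_sym mult.commute[of "poly (p n) _"] del: poly_mult, simp add: mult.commute)
  moreover have "(\<lambda>n. (nrm v)\<^sup>2 * ((\<integral>x. indicator S x * poly g x \<partial>\<nu> v) - (\<integral>x. ?h n x \<partial>\<nu> v)))
     \<longlonglongrightarrow> (nrm v)\<^sup>2 * ((\<integral>x. indicator S x * poly g x \<partial>\<nu> v) - 0)"
    by (intro tendsto_intros h0)
  moreover have lim: "(\<lambda>n. Re (ip (pT g v) (pT (p n) v))) \<longlonglongrightarrow> Re (ip (pT g v) (proj S v))"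
    by (intro tendsto_Re ip.tendsto tendsto_const p)
  ultimately have "(\<lambda>n. Re (ip (pT g v) (pT (p n) v)))
      \<longlonglongrightarrow> (nrm v)\<^sup>2 * ((\<integral>x. indicator S x * poly g x \<partial>\<nu> v) - 0)"
    by (simp only:)
  from LIMSEQ_unique[OF lim this] show ?thesis by (simp only: diff_0_right)
qed

lemma proj_lin: assumes S: "S \<in> sets borel" shows "clinear (proj S)"
  unfolding clinear_def
proof (intro conjI allI)
  fix x y
  obtain p where p: "(\<lambda>n. pT (p n) (x)) \<longlonglongrightarrow> proj S (x)" "(\<lambda>n. pT (p n) (y)) \<longlonglongrightarrow> proj S (y)" "(\<lambda>n. pT (p n) (x + y)) \<longlonglongrightarrow> proj S (x + y)"
    using proj_lim2[OF S, of "{x, y, x + y}"] by auto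
  have "(\<lambda>n. pT (p n) x + pT (p n) y) \<longlonglongrightarrow> proj S x + proj S y"
    by (intro tendsto_intros p)
  then show "proj S (x + y) = proj S x + proj S y"
    using p LIMSEQ_unique by (auto simp: clinear_add[OF pT_lin])
next
  fix c x
  obtain p where p: "(\<lambda>n. pT (p n) (x)) \<longlonglongrightarrow> proj S (x)" "(\<lambda>n. pT (p n) (c *\<^sub>C x)) \<longlonglongrightarrow> proj S (c *\<^sub>C x)"
    using proj_lim2[OF S, of "{x, c *\<^sub>C x}"] by auto
  show "proj S (c *\<^sub>C x) = c *\<^sub>C proj S x"
  proof (rule ip_eqI)
    fix w
    have "(\<lambda>n. c * ip w (pT (p n) x)) \<longlonglongrightarrow> c * ip w (proj S x)"
      by (intro tendsto_intros ip.tendsto p)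
    moreover have "(\<lambda>n. ip w (pT (p n) (c *\<^sub>C x))) \<longlonglongrightarrow> ip w (proj S (c *\<^sub>C x))"
      by (intro ip.tendsto tendsto_const p)
    ultimately show "ip w (proj S (c *\<^sub>C x)) = ip w (c *\<^sub>C proj S x)"
      using LIMSEQ_unique by (auto simp: clinear_scaleC[OF pT_lin] ip_scaleC_right)
  qed
qed

lemma proj_sym: assumes S: "S \<in> sets borel" shows "ip (proj S x) y = ip x (proj S y)"
proof -
  obtain p where p: "(\<lambda>n. pT (p n) (x)) \<longlonglongrightarrow> proj S (x)" "(\<lambda>n. pT (p n) (y)) \<longlonglongrightarrow> proj S (y)"
    using proj_lim2[OF S, of "{x, y}"] by auto
  have "(\<lambda>n. ip (pT (p n) x) y) \<longlonglongrightarrow> ip (proj S x) y" "(\<lambda>n. ip x (pT (p n) y)) \<longlonglongrightarrow> ip x (proj S y)"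
    by (intro ip.tendsto tendsto_const p)+
  then show ?thesis using LIMSEQ_unique by (simp add: pT_sym)
qed

lemma proj_T: assumes S: "S \<in> sets borel" shows "proj S (T x) = T (proj S x)"
proof -
  obtain p where p: "(\<lambda>n. pT (p n) (x)) \<longlonglongrightarrow> proj S (x)" "(\<lambda>n. pT (p n) (T x)) \<longlonglongrightarrow> proj S (T x)"
    using proj_lim2[OF S, of "{x, T x}"] by auto
  have "(\<lambda>n. T (pT (p n) x)) \<longlonglongrightarrow> T (proj S x)" by (intro tendsto_T p)
  then show ?thesis using p LIMSEQ_unique by (auto simp: pT_T)
qed

lemma ip_proj_self: assumes S: "S \<in> sets borel"
  shows "ip (proj S v) v = of_real ((nrm v)\<^sup>2 * measure (\<nu> v) S)"
proof -
  have "Im (ip (proj S v) v) = 0"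
    using arg_cong[OF ip_commute[of "proj S v" v], of Im] by (simp add: proj_sym[OF S])
  moreover have "Re (ip (proj S v) v) = (nrm v)\<^sup>2 * measure (\<nu> v) S"
  proof -
    have "(\<integral>x. indicator S x * poly 1 x \<partial>\<nu> v) = (\<integral>x. indicator S x \<partial>\<nu> v)" by simp
    then show ?thesis
      using ip_pT_proj[OF S, of 1 v]
      by (simp only: proj_sym[OF S] pT_1 Bochner_Integration.integral_indicator space_\<nu> Int_UNIV_right)
  qed
  ultimately show ?thesis by (intro complex_eqI) auto
qed

text \<open>The inner products of \<open>pT (p n) v\<close> with \<open>proj S v\<close> tend to the
  left side by definition of the projection and to the right side by \<open>ip_pT_proj\<close>.
  Compared with \<open>ip_proj_self\<close>, this says that the projection and its square have the
  same quadratic form, whence idempotence.\<close>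

lemma nrm_proj_sq: assumes S: "S \<in> sets borel"
  shows "(nrm (proj S v))\<^sup>2 = (nrm v)\<^sup>2 * measure (\<nu> v) S"
proof -
  interpret prob_space "\<nu> v" by (rule prob_space_\<nu>)
  obtain p where p: "approx_seq S v p" "(\<lambda>n. pT (p n) v) \<longlonglongrightarrow> proj S v"
    using proj_lim2[OF S, of "{v}"] by auto
  have lim1: "(\<lambda>n. Re (ip (pT (p n) v) (proj S v))) \<longlonglongrightarrow> Re (ip (proj S v) (proj S v))"
    by (intro tendsto_Re ip.tendsto tendsto_const p)
  have lim2: "(\<lambda>n. Re (ip (pT (p n) v) (proj S v))) \<longlonglongrightarrow> (nrm v)\<^sup>2 * measure (\<nu> v) S"
    unfolding ip_pT_proj[OF S]
  proof (intro tendsto_mult tendsto_const)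
    have i: "integrable (\<nu> v) (\<lambda>x. indicator S x * (indicator S x - poly (p n) x))"
      "integrable (\<nu> v) (\<lambda>x. (indicator S x * (indicator S x - poly (p n) x))\<^sup>2)"
      "integrable (\<nu> v) (\<lambda>x. (indicator S x - poly (p n) x)\<^sup>2)"
      "integrable (\<nu> v) (indicator S :: real \<Rightarrow> real)"
      for n
      by (intro integrable_bdd_meas bdd_meas_intros S bdd_meas_poly)+
    have "(\<integral>x. indicator S x * (indicator S x - poly (p n) x) \<partial>\<nu> v)\<^sup>2 \<le> (\<integral>x. (indicator S x - poly (p n) x)\<^sup>2 \<partial>\<nu> v)" for n
      by (rule order_trans[OF expectation_sq_le[OF i(1,2)] integral_mono[OF i(2,3)]])
         (auto simp: indicator_def)
    then have "(\<lambda>n. \<integral>x. indicator S x * (indicator S x - poly (p n) x) \<partial>\<nu> v) \<longlonglongrightarrow> 0"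
      using p(1) unfolding approx_seq_def by (rule tendsto_0_sq_bound)
    from tendsto_diff[OF tendsto_const[of "measure (\<nu> v) S"] this]
    have "(\<lambda>n. measure (\<nu> v) S - (\<integral>x. indicator S x * (indicator S x - poly (p n) x) \<partial>\<nu> v)) \<longlonglongrightarrow> measure (\<nu> v) S"
      by simp
    moreover have "measure (\<nu> v) S - (\<integral>x. indicator S x * (indicator S x - poly (p n) x) \<partial>\<nu> v)
        = (\<integral>x. indicator S x * poly (p n) x \<partial>\<nu> v)" for n
    proof -
      have "measure (\<nu> v) S = (\<integral>x. indicator S x \<partial>\<nu> v)"
        by (simp only: Bochner_Integration.integral_indicator space_\<nu> Int_UNIV_right)
      then show ?thesis
        by (simp only: Bochner_Integration.integral_diff[symmetric, OF i(4,1)])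
           (intro Bochner_Integration.integral_cong, auto simp: indicator_def)
    qed
    ultimately show "(\<lambda>n. \<integral>x. indicator S x * poly (p n) x \<partial>\<nu> v) \<longlonglongrightarrow> measure (\<nu> v) S"
      by (simp only:)
  qed
  have "Re (ip (proj S v) (proj S v)) = (nrm v)\<^sup>2 * measure (\<nu> v) S"
    by (rule LIMSEQ_unique[OF lim1 lim2])
  then show ?thesis by (rule trans[OF nrm_sq])
qed

lemma proj_idem: assumes S: "S \<in> sets borel" shows "proj S (proj S v) = proj S v"
proof -
  have lin: "clinear (\<lambda>v. proj S (proj S v) - proj S v)"
    using proj_lin[OF S] by (auto simp: clinear_def complex_vector.scale_right_diff_distrib)
  have zero: "ip (proj S (proj S v) - proj S v) v = 0" for v
    using ip_self[of "proj S v"]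
    by (simp add: ip_diff_left proj_sym[OF S, of "proj S v"] nrm_proj_sq[OF S] ip_proj_self[OF S] del: of_real_power of_real_mult)
  from ip_self_zero_imp_zero[OF lin zero] have "proj S (proj S v) - proj S v = 0" .
  then show ?thesis by simp
qed

lemma proj_add_disjoint:
  assumes S: "S \<in> sets borel" and R: "R \<in> sets borel" and "S \<inter> R = {}"
  shows "proj (S \<union> R) v = proj S v + proj R v"
proof -
  have lin: "clinear (\<lambda>v. proj (S \<union> R) v - (proj S v + proj R v))"
    using proj_lin[OF S] proj_lin[OF R] proj_lin[of "S \<union> R"] S R
    by (auto simp: clinear_def complex_vector.scale_right_diff_distrib complex_vector.scale_right_distrib)
  have zero: "ip (proj (S \<union> R) v - (proj S v + proj R v)) v = 0" for v
  proof -
    interpret prob_space "\<nu> v" by (rule prob_space_\<nu>)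
    have "measure (\<nu> v) (S \<union> R) = measure (\<nu> v) S + measure (\<nu> v) R"
      using assms by (intro finite_measure_Union) auto
    then show ?thesis
      using S R by (simp add: ip_diff_left ip_add_left ip_proj_self algebra_simps)
  qed
  from ip_self_zero_imp_zero[OF lin zero] have "proj (S \<union> R) v - (proj S v + proj R v) = 0" .
  then show ?thesis by simp
qed

lemma proj_UNIV: "proj UNIV v = v"
proof -
  have lin: "clinear (\<lambda>v. proj UNIV v - v)"
    using proj_lin[of UNIV] by (auto simp: clinear_def complex_vector.scale_right_diff_distrib)
  have zero: "ip (proj UNIV v - v) v = 0" for v
    using prob_space.prob_space[OF prob_space_\<nu>[of v]]
    by (simp add: ip_diff_left ip_proj_self ip_self)
  from ip_self_zero_imp_zero[OF lin zero] have "proj UNIV v - v = 0" .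
  then show ?thesis by simp
qed

text \<open>Strong countable additivity comes down to continuity of one finite measure: the squared
  norm of the remainder is a multiple of the \<open>\<nu> u\<close>-measure of the remaining
  set.\<close>

lemma proj_sums:
  assumes F: "range F \<subseteq> sets borel" and d: "disjoint_family F"
  shows "(\<lambda>i::nat. proj (F i) u) sums proj (\<Union>i. F i) u"
proof -
  interpret prob_space "\<nu> u" by (rule prob_space_\<nu>)
  have Fm [measurable]: "F i \<in> sets borel" for i using F by auto
  have part: "(\<Sum>i<n. proj (F i) u) = proj (\<Union>i<n. F i) u" for n
  proof (induction n)
    case 0
    have "(nrm (proj {} u))\<^sup>2 = 0" by (simp add: nrm_proj_sq)
    then show ?case by simp
  next
    case (Suc n)
    have "F i \<inter> F n = {}" if "i < n" for i using disjoint_family_onD[OF d, of i n] that by simp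
    then have "(\<Union>i<n. F i) \<inter> F n = {}" by blast
    then show ?case
      using Suc proj_add_disjoint[of "\<Union>i<n. F i" "F n" u] by (simp add: lessThan_Suc Un_commute)
  qed
  have tail: "(nrm (proj (\<Union>i. F i) u - proj (\<Union>i<n. F i) u))\<^sup>2 = (nrm u)\<^sup>2 * (measure (\<nu> u) (\<Union>i. F i) - measure (\<nu> u) (\<Union>i<n. F i))" for n
  proof -
    let ?A = "\<Union>i<n. F i" and ?R = "(\<Union>i. F i) - (\<Union>i<n. F i)"
    have "proj (?A \<union> ?R) u = proj ?A u + proj ?R u"
      by (rule proj_add_disjoint) auto
    moreover have "?A \<union> ?R = (\<Union>i. F i)" by auto
    ultimately have "proj (\<Union>i. F i) u = proj ?A u + proj ?R u" by (simp only:)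
    then have "(nrm (proj (\<Union>i. F i) u - proj ?A u))\<^sup>2 = (nrm (proj ?R u))\<^sup>2" by simp
    also have "\<dots> = (nrm u)\<^sup>2 * measure (\<nu> u) ?R" by (rule nrm_proj_sq) simp
    also have "measure (\<nu> u) ?R = measure (\<nu> u) (\<Union>i. F i) - measure (\<nu> u) ?A"
      by (rule finite_measure_Diff) auto
    finally show ?thesis .
  qed
  have lim: "(\<lambda>n. (nrm u)\<^sup>2 * (measure (\<nu> u) (\<Union>i. F i) - measure (\<nu> u) (\<Union>i<n. F i))) \<longlonglongrightarrow> 0"
  proof -
    have "(\<lambda>n. measure (\<nu> u) (\<Union>i<n. F i)) \<longlonglongrightarrow> measure (\<nu> u) (\<Union>n. \<Union>i<n. F i)"
      by (rule finite_Lim_measure_incseq) (auto simp: incseq_def subset_iff intro: less_le_trans)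
    moreover have "(\<Union>n. \<Union>i<n. F i) = (\<Union>i. F i)" by auto
    ultimately have "(\<lambda>n. measure (\<nu> u) (\<Union>i<n. F i)) \<longlonglongrightarrow> measure (\<nu> u) (\<Union>i. F i)" by (simp only:)
    from tendsto_mult[OF tendsto_const tendsto_diff[OF tendsto_const this], of "(nrm u)\<^sup>2" "measure (\<nu> u) (\<Union>i. F i)"]
    show ?thesis by (simp only: diff_self mult_zero_right)
  qed
  from tendsto_0_sq_bound[OF eq_refl[OF tail] lim]
  have "(\<lambda>n. nrm (proj (\<Union>i. F i) u - proj (\<Union>i<n. F i) u)) \<longlonglongrightarrow> 0" .
  then have "(\<lambda>n. nrm (proj (\<Union>i<n. F i) u - proj (\<Union>i. F i) u)) \<longlonglongrightarrow> 0"
    by (subst nrm_minus_commute)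
  then show ?thesis unfolding sums_def part by (simp add: tendsto_iff_nrm)
qed

theorem projection_valued_measure_proj: "projection_valued_measure ip proj"
  unfolding projection_valued_measure_def
  using proj_lin proj_idem proj_sym proj_UNIV proj_sums by (auto simp: clinear_iff_linear)

text \<open>Here and in \<open>nrm_proj_T_sq\<close>, projections of \<open>T g\<close> are
  expressed through \<open>\<nu> g\<close>, with density \<open>x\<close> or
  \<open>x\<^sup>2\<close>. When \<open>T\<close> is the scaled inverse of an unbounded operator,
  \<open>T g\<close> runs through the domain of that operator.\<close>

lemma Re_ip_proj_T: assumes S: "S \<in> sets borel"
  shows "Re (ip (proj S (T g)) g) = (nrm g)\<^sup>2 * (\<integral>x. indicator S x * x \<partial>\<nu> g)"
  using ip_pT_proj[OF S, of "[:0,1:]" g] by (simp add: proj_sym[OF S] pT_X)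

lemma nrm_proj_T_sq: assumes S: "S \<in> sets borel"
  shows "(nrm (proj S (T g)))\<^sup>2 = (nrm g)\<^sup>2 * (\<integral>x. indicator S x * x\<^sup>2 \<partial>\<nu> g)"
proof -
  have "(nrm (proj S (T g)))\<^sup>2 = Re (ip (T (T g)) (proj S g))"
    unfolding nrm_sq using proj_sym[OF S, of "T g" "proj S (T g)"] proj_idem[OF S] proj_T[OF S] sym by simp
  then show ?thesis
    using ip_pT_proj[OF S, of "[:0,1:]*[:0,1:]" g]
    by (simp only: pT_mult pT_X poly_mult) (simp add: power2_eq_square)
qed

end

section \<open>Functional calculus of a projection-valued measure\<close>

locale pvm = hilbert_ip ip for ip :: "'a::chilbert_space ip" +
  fixes E :: "real set \<Rightarrow> 'a \<Rightarrow> 'a"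
  assumes pvm: "projection_valued_measure ip E"
begin

abbreviation "sm \<equiv> scalar_measure ip E"
abbreviation "cdom \<equiv> calculus_dom ip E"
abbreviation "cop \<equiv> calculus_op ip E"

lemma E_lin: "S \<in> sets borel \<Longrightarrow> clinear (E S)"
  and E_idem: "S \<in> sets borel \<Longrightarrow> E S (E S u) = E S u"
  and E_sym: "S \<in> sets borel \<Longrightarrow> ip (E S u) v = ip u (E S v)"
  and E_UNIV [simp]: "E UNIV u = u"
  and E_sums: "range F \<subseteq> sets borel \<Longrightarrow> disjoint_family F \<Longrightarrow> (\<lambda>i::nat. E (F i) u) sums E (\<Union>i. F i) u"
  using pvm unfolding projection_valued_measure_def clinear_iff_linear by blast+

lemma E_empty [simp]: "E {} u = 0"
proof -
  have "(\<lambda>i::nat. E {} u) sums E (\<Union>i::nat. {}) u"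
    by (rule E_sums) (auto simp: disjoint_family_on_def)
  then have "(\<lambda>i::nat. E {} u) \<longlonglongrightarrow> 0" by (blast intro: summable_LIMSEQ_zero sums_summable)
  then show ?thesis by (simp add: LIMSEQ_const_iff)
qed

lemma E_Un: assumes "S \<in> sets borel" "R \<in> sets borel" "S \<inter> R = {}"
  shows "E (S \<union> R) u = E S u + E R u"
proof -
  have "(\<lambda>i. E (binaryset S R i) u) sums E (\<Union>i. binaryset S R i) u"
  proof (rule E_sums)
    show "range (binaryset S R) \<subseteq> sets borel" using assms by (auto simp: range_binaryset_eq)
    show "disjoint_family (binaryset S R)"
      using assms(3) by (auto simp: disjoint_family_on_def binaryset_def)
  qed
  moreover have "(\<lambda>i. E (binaryset S R i) u) sums (E S u + E R u)"
    using binaryset_sums[of "\<lambda>S. E S u" S R] by simp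
  ultimately show ?thesis unfolding UN_binaryset_eq by (rule sums_unique2)
qed

lemma nrm_E_sq: "S \<in> sets borel \<Longrightarrow> (nrm (E S u))\<^sup>2 = Re (ip (E S u) u)"
  unfolding nrm_sq using E_sym[of S "E S u" u] E_idem[of S u] by simp

text \<open>Multiplicativity has to be derived from additivity. As \<open>E (S \<union> R)\<close>
  is a projection, its squared norm at \<open>E R u\<close> equals its quadratic form there; after
  cancellation, twice the squared norm of \<open>E S (E R u)\<close> is 0.\<close>

lemma E_disjoint: assumes S: "S \<in> sets borel" and R: "R \<in> sets borel" and d: "S \<inter> R = {}"
  shows "E S (E R u) = 0"
proof -
  let ?v = "E R u"
  have eq: "E (S \<union> R) ?v = E S ?v + ?v" using E_Un[OF assms] E_idem[OF R] by simp
  have "(nrm (E S ?v + ?v))\<^sup>2 = Re (ip (E S ?v + ?v) ?v)"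
    using nrm_E_sq[of "S \<union> R" ?v] S R by (simp add: eq)
  then have "(nrm (E S ?v))\<^sup>2 = 0"
    by (simp add: nrm_sq_add ip_add_left nrm_E_sq[OF S] nrm_sq[of ?v])
  then show ?thesis by simp
qed

lemma E_Int: assumes S: "S \<in> sets borel" and R: "R \<in> sets borel"
  shows "E S (E R u) = E (S \<inter> R) u"
proof -
  have m: "S \<inter> R \<in> sets borel" "R - S \<in> sets borel" "S - R \<in> sets borel" using S R by auto
  have d: "S \<inter> R \<inter> (R - S) = {}" "S \<inter> R \<inter> (S - R) = {}" "S \<inter> (R - S) = {}" "(S - R) \<inter> (S \<inter> R) = {}"
    "S \<inter> R \<union> (R - S) = R" "S \<inter> R \<union> (S - R) = S" by auto
  have "E R u = E (S \<inter> R) u + E (R - S) u"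
    using E_Un[OF m(1,2) d(1)] by (simp only: d)
  then have "E S (E R u) = E S (E (S \<inter> R) u)"
    using E_disjoint[OF S m(2) d(3)] by (simp add: clinear_add[OF E_lin[OF S]])
  also have "\<dots> = E (S \<inter> R) (E (S \<inter> R) u) + E (S - R) (E (S \<inter> R) u)"
    using E_Un[OF m(1,3) d(2)] by (simp only: d)
  also have "\<dots> = E (S \<inter> R) u"
    using E_disjoint[OF m(3,1) d(4)] E_idem[OF m(1)] by simp
  finally show ?thesis .
qed

lemma nrm_E_le: "S \<in> sets borel \<Longrightarrow> nrm (E S u) \<le> nrm u"
proof (rule power2_le_imp_le)
  assume S: "S \<in> sets borel"
  have "E (S \<union> (- S)) u = E S u + E (- S) u" by (rule E_Un) (use S in auto)
  then have "u = E S u + E (- S) u" by simp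
  from arg_cong[OF this, of "\<lambda>x. Re (ip x u)"]
  have "Re (ip u u) = (nrm (E S u))\<^sup>2 + (nrm (E (- S) u))\<^sup>2"
    using S by (simp add: ip_add_left nrm_E_sq)
  then show "(nrm (E S u))\<^sup>2 \<le> (nrm u)\<^sup>2" by (simp add: nrm_sq[of u])
qed simp

lemma sets_sm [measurable_cong, simp]: "sets (sm u) = sets borel"
  unfolding scalar_measure_def by (subst sets_measure_of) (auto simp: sets.sigma_sets_eq[of borel, simplified])

lemma space_sm [simp]: "space (sm u) = UNIV"
  unfolding scalar_measure_def by (subst space_measure_of) auto

lemma emeasure_sm:
  assumes S: "S \<in> sets borel"
  shows "emeasure (sm u) S = ennreal ((nrm (E S u))\<^sup>2)"
proof -
  have "emeasure (sm u) S = ennreal (Re (ip (E S u) u))"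
  proof (rule emeasure_measure_of[OF scalar_measure_def])
    show "sets borel \<subseteq> Pow (UNIV :: real set)" by simp
    show "S \<in> sets (sm u)" using S by simp
    show "positive (sets (sm u)) (\<lambda>S. ennreal (Re (ip (E S u) u)))" by (simp add: positive_def)
    show "countably_additive (sets (sm u)) (\<lambda>S. ennreal (Re (ip (E S u) u)))"
    proof (rule countably_additiveI)
      fix F :: "nat \<Rightarrow> real set" assume F: "range F \<subseteq> sets (sm u)" "disjoint_family F"
      then have Fm: "F i \<in> sets borel" for i by auto
      show "(\<Sum>i. ennreal (Re (ip (E (F i) u) u))) = ennreal (Re (ip (E (\<Union>i. F i) u) u))"
      proof (rule suminf_ennreal_eq)
        show "0 \<le> Re (ip (E (F i) u) u)" for i using nrm_E_sq[OF Fm, of i u] by (metis zero_le_power2)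
        have "(\<lambda>i. E (F i) u) sums E (\<Union>i. F i) u" using F by (intro E_sums) auto
        then have "(\<lambda>i. ip (E (F i) u) u) sums ip (E (\<Union>i. F i) u) u"
          by (rule bounded_linear.sums[OF ip.bounded_linear_left])
        then show "(\<lambda>i. Re (ip (E (F i) u) u)) sums Re (ip (E (\<Union>i. F i) u) u)" by (rule sums_Re)
      qed
    qed
  qed
  then show ?thesis using nrm_E_sq[OF S] by simp
qed

lemma measure_sm: "S \<in> sets borel \<Longrightarrow> measure (sm u) S = (nrm (E S u))\<^sup>2"
  by (simp add: measure_def emeasure_sm)

lemma finite_measure_sm: "finite_measure (sm u)"
  by (rule finite_measureI) (simp add: emeasure_sm[of UNIV])

lemma measure_sm_UNIV: "measure (sm u) UNIV = (nrm u)\<^sup>2"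
  by (simp add: measure_sm)

lemma integral_indicator_sm: "S \<in> sets borel \<Longrightarrow> (\<integral>x. indicator S x \<partial>sm u) = (nrm (E S u))\<^sup>2"
  by (simp only: Bochner_Integration.integral_indicator space_sm Int_UNIV_right measure_sm)

text \<open>A relation rather than a map, since a simple function is a combination of indicators in
  many ways. That the operator depends only on the function is contained in
  \<open>simp_op_nrm_diff\<close>.\<close>

inductive simp_op :: "(real \<Rightarrow> real) \<Rightarrow> ('a \<Rightarrow> 'a) \<Rightarrow> bool" where
  indicator: "S \<in> sets borel \<Longrightarrow> simp_op (indicator S) (E S)"
| add: "simp_op f F \<Longrightarrow> simp_op g G \<Longrightarrow> simp_op (\<lambda>x. f x + g x) (\<lambda>u. F u + G u)"
| scale: "simp_op f F \<Longrightarrow> simp_op (\<lambda>x. c * f x) (\<lambda>u. c *\<^sub>R F u)"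

lemma simp_op_diff: "simp_op f F \<Longrightarrow> simp_op g G \<Longrightarrow> simp_op (\<lambda>x. f x - g x) (\<lambda>u. F u - G u)"
  using simp_op.add[OF _ simp_op.scale[of g G "-1"], of f F] by simp

lemma simp_op_bounded: "simp_op f F \<Longrightarrow> f \<in> borel_measurable borel \<and> (\<exists>B. \<forall>x. \<bar>f x\<bar> \<le> B)"
proof (induction rule: simp_op.induct)
  case (indicator S)
  then show ?case by (auto intro!: exI[of _ 1] simp: indicator_def)
next
  case (add f F g G)
  then obtain A B where "\<And>x. \<bar>f x\<bar> \<le> A" "\<And>x. \<bar>g x\<bar> \<le> B" by metis
  then have "\<bar>f x + g x\<bar> \<le> A + B" for x by (meson abs_triangle_ineq add_mono order_trans)
  then show ?case using add by auto
next
  case (scale f F c)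
  then obtain A where "\<And>x. \<bar>f x\<bar> \<le> A" by metis
  then have "\<bar>c * f x\<bar> \<le> \<bar>c\<bar> * A" for x by (simp add: abs_mult mult_left_mono)
  then show ?case using scale by auto
qed

lemma simp_op_measurable: "simp_op f F \<Longrightarrow> f \<in> borel_measurable borel"
  using simp_op_bounded by blast

lemma integrable_bounded_sm:
  fixes f :: "real \<Rightarrow> real"
  assumes "f \<in> borel_measurable borel" "\<And>x. \<bar>f x\<bar> \<le> B"
  shows "integrable (sm u) f"
  by (rule finite_measure.integrable_const_bound[OF finite_measure_sm, of _ B]) (use assms in auto)

lemma integrable_simp_op_mult:
  assumes "simp_op f F" "simp_op g G"
  shows "integrable (sm u) (\<lambda>x. f x * g x)"
proof -
  obtain A B where "\<And>x. \<bar>f x\<bar> \<le> A" "\<And>x. \<bar>g x\<bar> \<le> B"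
    using simp_op_bounded[OF assms(1)] simp_op_bounded[OF assms(2)] by metis
  then have "\<bar>f x * g x\<bar> \<le> A * B" for x by (simp add: abs_mult mult_mono')
  then show ?thesis
    using simp_op_measurable[OF assms(1)] simp_op_measurable[OF assms(2)]
    by (intro integrable_bounded_sm) auto
qed

lemma simp_op_lin: "simp_op f F \<Longrightarrow> clinear F"
proof (induction rule: simp_op.induct)
  case (scale f F c)
  then show ?case by (auto simp: clinear_def scaleR_right_distrib scaleR_scaleC_commute)
qed (auto simp: clinear_def E_lin complex_vector.scale_right_distrib dest: clinear_add[OF E_lin] clinear_scaleC[OF E_lin])

lemma simp_op_sym: "simp_op f F \<Longrightarrow> ip (F u) v = ip u (F v)"
  by (induction rule: simp_op.induct) (auto simp: E_sym ip_add_left ip_add_right ip_scaleR)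

lemma simp_op_ip:
  assumes "simp_op f F" and g: "simp_op g G"
  shows "Re (ip (F u) (G u)) = (\<integral>x. f x * g x \<partial>sm u)"
  using assms(1)
proof (induction rule: simp_op.induct)
  case (indicator S)
  note S = this
  from g show ?case
  proof (induction rule: simp_op.induct)
    case (indicator R)
    have "Re (ip (E S u) (E R u)) = (nrm (E (S \<inter> R) u))\<^sup>2"
      using S indicator by (simp add: nrm_E_sq E_sym[of S u] E_sym[of "S \<inter> R" u] E_Int)
    also have "\<dots> = (\<integral>x. indicator (S \<inter> R) x \<partial>sm u)"
      using S indicator by (intro integral_indicator_sm[symmetric]) auto
    also have "(indicator (S \<inter> R) :: real \<Rightarrow> real) = (\<lambda>x. indicator S x * indicator R x)"
      by (auto simp: indicator_def)
    finally show ?case .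
  next
    case (add f F g G)
    have "integrable (sm u) (\<lambda>x. indicator S x * f x)" "integrable (sm u) (\<lambda>x. indicator S x * g x)"
      using add S by (auto intro!: integrable_simp_op_mult simp_op.intros)
    with add show ?case by (simp only: ip_add_right distrib_left Bochner_Integration.integral_add plus_complex.simps)
  next
    case (scale f F c)
    have "integrable (sm u) (\<lambda>x. indicator S x * f x)"
      using scale S by (auto intro!: integrable_simp_op_mult simp_op.intros)
    with scale show ?case by (simp add: ip_scaleR mult.left_commute[of _ c])
  qed
next
  case (add f F h H)
  have "integrable (sm u) (\<lambda>x. f x * g x)" "integrable (sm u) (\<lambda>x. h x * g x)"
    using add g by (auto intro!: integrable_simp_op_mult)
  with add show ?case by (simp only: ip_add_left distrib_right Bochner_Integration.integral_add plus_complex.simps)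
next
  case (scale f F c)
  have "integrable (sm u) (\<lambda>x. f x * g x)"
    using scale g by (auto intro!: integrable_simp_op_mult)
  with scale show ?case by (simp add: ip_scaleR mult.assoc)
qed

lemma simp_op_nrm: "simp_op f F \<Longrightarrow> (nrm (F u))\<^sup>2 = (\<integral>x. (f x)\<^sup>2 \<partial>sm u)"
  using simp_op_ip[of f F f F u] by (simp add: nrm_sq power2_eq_square[of "f _"])

lemma integrable_simp_op_sq: "simp_op f F \<Longrightarrow> integrable (sm u) (\<lambda>x. (f x)\<^sup>2)"
  using integrable_simp_op_mult[of f F f F u] by (simp add: power2_eq_square)

lemma simp_op_nrm_diff: "simp_op f F \<Longrightarrow> simp_op g G \<Longrightarrow> (nrm (F u - G u))\<^sup>2 = (\<integral>x. (f x - g x)\<^sup>2 \<partial>sm u)"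
  by (rule simp_op_nrm[OF simp_op_diff])

lemma simp_op_quadratic:
  assumes f: "simp_op f F"
  shows "ip (F u) u = of_real (\<integral>x. f x \<partial>sm u)"
proof (rule complex_eqI)
  show "Im (ip (F u) u) = Im (of_real (\<integral>x. f x \<partial>sm u))"
    using arg_cong[OF ip_commute[of "F u" u], of Im] by (simp add: simp_op_sym[OF f])
  show "Re (ip (F u) u) = Re (of_real (\<integral>x. f x \<partial>sm u))"
    using simp_op_ip[OF f simp_op.indicator[of UNIV], of u] by simp
qed

lemma simp_op_spectral_integral:
  assumes f: "simp_op f F"
  shows "ip (F u) v = spectral_integral ip E f u v"
  unfolding spectral_integral_def
  by (rule polarization[symmetric, where B = "\<lambda>x y. ip (F x) y"])
     (simp_all only: simp_op_quadratic[OF f] ip_add_left ip_add_right ip_scaleC_left ip_scaleC_right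
       clinear_add[OF simp_op_lin[OF f]] clinear_scaleC[OF simp_op_lin[OF f]])

lemma simp_op_zero: "simp_op (\<lambda>x. 0) (\<lambda>u. 0)"
  using simp_op.scale[OF simp_op.indicator[of UNIV], of 0] by simp

lemma simple_function_simp_op:
  assumes f: "simple_function borel (f :: real \<Rightarrow> real)"
  obtains F where "simp_op f F"
proof -
  have fin: "finite (range f)" using simple_functionD(1)[OF f] by simp
  have meas: "f -` {y} \<in> sets borel" for y using simple_functionD(2)[OF f, of "{y}"] by simp
  have "simp_op (\<lambda>x. \<Sum>y\<in>Y. y * indicator (f -` {y}) x) (\<lambda>u. \<Sum>y\<in>Y. y *\<^sub>R E (f -` {y}) u)"
    if "finite Y" for Y
    using that
  proof (induction Y rule: finite_induct)
    case (insert y Y)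
    have "simp_op (\<lambda>x. y * indicator (f -` {y}) x + (\<Sum>y\<in>Y. y * indicator (f -` {y}) x))
        (\<lambda>u. y *\<^sub>R E (f -` {y}) u + (\<Sum>y\<in>Y. y *\<^sub>R E (f -` {y}) u))"
      by (intro simp_op.intros meas insert.IH)
    then show ?case unfolding sum.insert[OF insert.hyps] .
  qed (simp add: simp_op_zero)
  from this[OF fin] have *: "simp_op (\<lambda>x. \<Sum>y\<in>range f. y * indicator (f -` {y}) x) (\<lambda>u. \<Sum>y\<in>range f. y *\<^sub>R E (f -` {y}) u)" .
  have "(\<Sum>y\<in>range f. y * indicator (f -` {y}) x) = f x" for x
    using fin by (subst sum.remove[of _ "f x"]) (auto simp: indicator_def intro!: sum.neutral)
  then show thesis using that * by simp
qed

text \<open>The bound by \<open>2 * \<bar>f x\<bar>\<close> provides dominating functions for all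
  vectors in the domain simultaneously. One sequence thus serves every vector, and linearity and
  symmetry survive the limit.\<close>

definition approx_ops :: "(real \<Rightarrow> real) \<Rightarrow> (nat \<Rightarrow> real \<Rightarrow> real) \<Rightarrow> (nat \<Rightarrow> 'a \<Rightarrow> 'a) \<Rightarrow> bool" where
  "approx_ops f fn Fn \<longleftrightarrow> f \<in> borel_measurable borel \<and> (\<forall>n. simp_op (fn n) (Fn n)) \<and>
    (\<forall>x. (\<lambda>n. fn n x) \<longlonglongrightarrow> f x) \<and> (\<forall>n x. \<bar>fn n x\<bar> \<le> 2 * \<bar>f x\<bar>)"

lemma approx_opsD:
  assumes "approx_ops f fn Fn"
  shows "f \<in> borel_measurable borel" "simp_op (fn n) (Fn n)" "(\<lambda>n. fn n x) \<longlonglongrightarrow> f x" "\<bar>fn n x\<bar> \<le> 2 * \<bar>f x\<bar>"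
    "fn n \<in> borel_measurable borel"
  using assms simp_op_measurable unfolding approx_ops_def by blast+

lemma approx_ops_exists:
  assumes f: "f \<in> borel_measurable borel"
  obtains fn Fn where "approx_ops f fn Fn"
proof -
  obtain fn where fn: "\<And>i. simple_function borel (fn i)" "\<And>x. (\<lambda>i. fn i x) \<longlonglongrightarrow> f x"
    "\<And>i x. \<bar>fn i x\<bar> \<le> 2 * \<bar>f x\<bar>"
    using borel_measurable_implies_sequence_metric[OF f, of 0] by auto
  have "\<exists>F. simp_op (fn i) F" for i using simple_function_simp_op[OF fn(1)] by blast
  then obtain Fn where "\<And>i. simp_op (fn i) (Fn i)" by metis
  then show thesis using that fn f unfolding approx_ops_def by blast
qed

lemma cdom_iff: "u \<in> cdom f \<longleftrightarrow> integrable (sm u) (\<lambda>x. (f x)\<^sup>2)"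
  by (simp add: calculus_dom_def)

lemma approx_ops_L2:
  assumes a: "approx_ops f fn Fn" and u: "u \<in> cdom f"
  shows "(\<lambda>n. \<integral>x. (fn n x - f x)\<^sup>2 \<partial>sm u) \<longlonglongrightarrow> 0" "integrable (sm u) (\<lambda>x. (fn n x - f x)\<^sup>2)"
    "(\<lambda>n. \<integral>x. (fn n x)\<^sup>2 \<partial>sm u) \<longlonglongrightarrow> (\<integral>x. (f x)\<^sup>2 \<partial>sm u)" "integrable (sm u) (\<lambda>x. (fn n x)\<^sup>2)"
    "integrable (sm u) f" "(\<lambda>n. \<integral>x. fn n x \<partial>sm u) \<longlonglongrightarrow> (\<integral>x. f x \<partial>sm u)"
proof -
  note [measurable] = approx_opsD(1,5)[OF a]
  have int: "integrable (sm u) (\<lambda>x. (f x)\<^sup>2)" using u by (simp add: cdom_iff)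
  have b: "\<bar>fn n x - f x\<bar> \<le> \<bar>3 * f x\<bar>" "\<bar>fn n x\<bar> \<le> \<bar>2 * f x\<bar>" for n x
    using approx_opsD(4)[OF a, of n x] by linarith+
  have b1: "(fn n x - f x)\<^sup>2 \<le> 9 * (f x)\<^sup>2" for n x
    using iffD1[OF abs_le_square_iff b(1)] by (simp add: power_mult_distrib)
  have b2: "(fn n x)\<^sup>2 \<le> 4 * (f x)\<^sup>2" for n x
    using iffD1[OF abs_le_square_iff b(2)] by (simp add: power_mult_distrib)
  have l1: "(\<lambda>n. (fn n x - f x)\<^sup>2) \<longlonglongrightarrow> 0" for x
  proof -
    have "(\<lambda>n. (fn n x - f x)\<^sup>2) \<longlonglongrightarrow> (f x - f x)\<^sup>2" by (intro tendsto_intros approx_opsD(3)[OF a])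
    then show ?thesis by simp
  qed
  have l2: "(\<lambda>n. (fn n x)\<^sup>2) \<longlonglongrightarrow> (f x)\<^sup>2" for x
    by (intro tendsto_power approx_opsD(3)[OF a])
  show "(\<lambda>n. \<integral>x. (fn n x - f x)\<^sup>2 \<partial>sm u) \<longlonglongrightarrow> 0"
    using integral_dominated_convergence[where w = "\<lambda>x. 9 * (f x)\<^sup>2" and f = "\<lambda>x. 0" and s = "\<lambda>n x. (fn n x - f x)\<^sup>2" and M = "sm u"] int l1 b1
    by simp
  show "(\<lambda>n. \<integral>x. (fn n x)\<^sup>2 \<partial>sm u) \<longlonglongrightarrow> (\<integral>x. (f x)\<^sup>2 \<partial>sm u)"
    by (rule integral_dominated_convergence[where w = "\<lambda>x. 4 * (f x)\<^sup>2"]) (use int l2 b2 in auto)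
  show "integrable (sm u) (\<lambda>x. (fn n x - f x)\<^sup>2)"
    by (rule Bochner_Integration.integrable_bound[of _ "\<lambda>x. 9 * (f x)\<^sup>2"]) (use int b1 in auto)
  show "integrable (sm u) (\<lambda>x. (fn n x)\<^sup>2)"
    by (rule Bochner_Integration.integrable_bound[of _ "\<lambda>x. 4 * (f x)\<^sup>2"]) (use int b2 in auto)
  \<comment> \<open>The measure is finite, so \<open>1 + (f x)\<^sup>2\<close> is an integrable
    majorant of \<open>f\<close> itself.\<close>
  have c: "integrable (sm u) (\<lambda>x. 1 + (f x)\<^sup>2)"
    by (rule Bochner_Integration.integrable_add[OF finite_measure.integrable_const[OF finite_measure_sm] int])
  have b3: "\<bar>f x\<bar> \<le> 1 + (f x)\<^sup>2" for x
  proof (cases "\<bar>f x\<bar> \<le> 1")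
    case False
    then have "\<bar>f x\<bar> * 1 \<le> \<bar>f x\<bar> * \<bar>f x\<bar>" by (intro mult_left_mono) auto
    then show ?thesis by (simp add: power2_eq_square)
  qed (simp add: add_increasing2)
  show "integrable (sm u) f"
    by (rule Bochner_Integration.integrable_bound[OF c]) (use b3 in auto)
  show "(\<lambda>n. \<integral>x. fn n x \<partial>sm u) \<longlonglongrightarrow> (\<integral>x. f x \<partial>sm u)"
  proof (rule integral_dominated_convergence[where w = "\<lambda>x. 2 * (1 + (f x)\<^sup>2)"])
    show "integrable (sm u) (\<lambda>x. 2 * (1 + (f x)\<^sup>2))" by (intro integrable_mult_right c)
    show "AE x in sm u. norm (fn n x) \<le> 2 * (1 + (f x)\<^sup>2)" for n
      using order_trans[OF approx_opsD(4)[OF a] mult_left_mono[OF b3]] by auto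
  qed (use approx_opsD(3)[OF a] in auto)
qed

lemma integrable_cdom:
  assumes "f \<in> borel_measurable borel" "u \<in> cdom f"
  shows "integrable (sm u) f"
  using approx_ops_exists[OF assms(1)] approx_ops_L2(5) assms(2) by metis

text \<open>Fatou's lemma. It replaces integrability against a measure that depends quadratically on
  \<open>u\<close> by boundedness of linear images of \<open>u\<close>; that the domain is a
  subspace then becomes evident.\<close>

lemma cdom_bounded_seq:
  assumes a: "approx_ops f fn Fn" and B: "\<And>n. (nrm (Fn n u))\<^sup>2 \<le> B"
  shows "u \<in> cdom f"
  unfolding cdom_iff integrable_iff_bounded
proof
  note [measurable] = approx_opsD(1,5)[OF a]
  show "(\<lambda>x. (f x)\<^sup>2) \<in> borel_measurable (sm u)" by measurable
  have "(\<integral>\<^sup>+x. norm ((f x)\<^sup>2) \<partial>sm u) = (\<integral>\<^sup>+x. liminf (\<lambda>n. ennreal ((fn n x)\<^sup>2)) \<partial>sm u)"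
  proof (rule nn_integral_cong)
    fix x
    have "(\<lambda>n. ennreal ((fn n x)\<^sup>2)) \<longlonglongrightarrow> ennreal ((f x)\<^sup>2)"
      by (intro tendsto_ennrealI tendsto_power approx_opsD(3)[OF a])
    from lim_imp_Liminf[OF sequentially_bot this]
    show "ennreal (norm ((f x)\<^sup>2)) = liminf (\<lambda>n. ennreal ((fn n x)\<^sup>2))" by simp
  qed
  also have "\<dots> \<le> liminf (\<lambda>n. \<integral>\<^sup>+x. ennreal ((fn n x)\<^sup>2) \<partial>sm u)"
    by (rule nn_integral_liminf) measurable
  also have "\<dots> \<le> ennreal B"
  proof (rule Liminf_le)
    have "(\<integral>\<^sup>+x. ennreal ((fn n x)\<^sup>2) \<partial>sm u) = ennreal ((nrm (Fn n u))\<^sup>2)" for n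
      using integrable_simp_op_sq[OF approx_opsD(2)[OF a]]
      by (simp add: simp_op_nrm[OF approx_opsD(2)[OF a]] nn_integral_eq_integral)
    then show "\<forall>\<^sub>F n in sequentially. (\<integral>\<^sup>+x. ennreal ((fn n x)\<^sup>2) \<partial>sm u) \<le> ennreal B"
      using B by (intro always_eventually allI) (simp add: ennreal_leI)
  qed simp
  also have "\<dots> < \<infinity>" by simp
  finally show "(\<integral>\<^sup>+x. norm ((f x)\<^sup>2) \<partial>sm u) < \<infinity>" .
qed

lemma nrm_approx_bounded:
  assumes a: "approx_ops f fn Fn" and u: "u \<in> cdom f"
  obtains B where "\<And>n. (nrm (Fn n u))\<^sup>2 \<le> B"
proof -
  have "Bseq (\<lambda>n. (nrm (Fn n u))\<^sup>2)"
    unfolding simp_op_nrm[OF approx_opsD(2)[OF a]]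
    using approx_ops_L2(3)[OF a u] by (intro convergent_imp_Bseq) (auto simp: convergent_def)
  then show thesis using that unfolding Bseq_def by auto
qed

lemma cdom_csubspace:
  assumes f: "f \<in> borel_measurable borel"
  shows "csubspace (cdom f)"
proof (rule complex_vector.subspaceI)
  obtain fn Fn where a: "approx_ops f fn Fn" using approx_ops_exists[OF f] .
  note lin = simp_op_lin[OF approx_opsD(2)[OF a]]
  show "0 \<in> cdom f"
    by (rule cdom_bounded_seq[OF a, of _ 0]) (simp add: clinear_zero[OF lin])
  fix u v c assume u: "u \<in> cdom f"
  obtain B where B: "\<And>n. (nrm (Fn n u))\<^sup>2 \<le> B" by (rule nrm_approx_bounded[OF a u]) blast
  show "c *\<^sub>C u \<in> cdom f"
    by (rule cdom_bounded_seq[OF a, of _ "(cmod c)\<^sup>2 * B"])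
       (auto simp: clinear_scaleC[OF lin] nrm_scaleC power_mult_distrib intro!: mult_left_mono B)
  assume v: "v \<in> cdom f"
  obtain C where C: "\<And>n. (nrm (Fn n v))\<^sup>2 \<le> C" by (rule nrm_approx_bounded[OF a v]) blast
  show "u + v \<in> cdom f"
  proof (rule cdom_bounded_seq[OF a, of _ "2 * B + 2 * C"])
    fix n show "(nrm (Fn n (u + v)))\<^sup>2 \<le> 2 * B + 2 * C"
      using nrm_sq_add_le[of "Fn n u" "Fn n v"] B[of n] C[of n] by (simp add: clinear_add[OF lin])
  qed
qed

lemma scalar_measure_E:
  assumes S: "S \<in> sets borel"
  shows "sm (E S u) = density (sm u) (\<lambda>x. ennreal (indicator S x))"
proof (rule measure_eqI)
  fix R assume "R \<in> sets (sm (E S u))"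
  then have R: "R \<in> sets borel" by simp
  have "(\<integral>\<^sup>+x. ennreal (indicator S x) * indicator R x \<partial>sm u) = (\<integral>\<^sup>+x. indicator (R \<inter> S) x \<partial>sm u)"
    by (intro nn_integral_cong) (auto simp: indicator_def)
  then show "emeasure (sm (E S u)) R = emeasure (density (sm u) (\<lambda>x. ennreal (indicator S x))) R"
    using S R by (subst emeasure_density) (auto simp: emeasure_sm E_Int)
qed simp

lemma integrable_sm_E:
  fixes f :: "real \<Rightarrow> real"
  assumes S: "S \<in> sets borel" and f: "f \<in> borel_measurable borel"
  shows "integrable (sm (E S u)) f \<longleftrightarrow> integrable (sm u) (\<lambda>x. indicator S x * f x)"
  unfolding scalar_measure_E[OF S] using S f by (subst integrable_density) auto

lemma integral_sm_E:
  fixes f :: "real \<Rightarrow> real"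
  assumes S: "S \<in> sets borel" and f: "f \<in> borel_measurable borel"
  shows "(\<integral>x. f x \<partial>sm (E S u)) = (\<integral>x. indicator S x * f x \<partial>sm u)"
  unfolding scalar_measure_E[OF S] using S f by (subst integral_density) auto

lemma AE_sm_E: assumes S: "S \<in> sets borel" shows "AE x in sm (E S u). x \<in> S"
  unfolding scalar_measure_E[OF S] using S by (subst AE_density) (auto simp: indicator_def)

lemma AE_sm_iff: assumes S: "S \<in> sets borel" shows "(AE x in sm u. x \<in> S) \<longleftrightarrow> E (- S) u = 0"
proof -
  have "(AE x in sm u. x \<in> S) \<longleftrightarrow> emeasure (sm u) (- S) = 0"
    using S by (subst AE_iff_measurable[of "- S"]) auto
  also have "\<dots> \<longleftrightarrow> E (- S) u = 0" using S by (simp add: emeasure_sm)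
  finally show ?thesis .
qed

lemma E_mem_cdom:
  assumes S: "S \<in> sets borel" and f: "f \<in> borel_measurable borel" and u: "u \<in> cdom f"
  shows "E S u \<in> cdom f"
proof -
  note [measurable] = f S
  have "integrable (sm u) (\<lambda>x. (f x)\<^sup>2)" using u by (simp add: cdom_iff)
  then show ?thesis
    unfolding cdom_iff
    by (subst integrable_sm_E[OF S], measurable)
       (rule Bochner_Integration.integrable_bound, auto simp: indicator_def)
qed

lemma E_mem_cdom_bounded:
  assumes S: "S \<in> sets borel" and f: "f \<in> borel_measurable borel" and B: "\<And>x. x \<in> S \<Longrightarrow> \<bar>f x\<bar> \<le> B"
  shows "E S u \<in> cdom f"
  unfolding cdom_iff
proof (rule finite_measure.integrable_const_bound[OF finite_measure_sm, of _ "B\<^sup>2"])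
  show "AE x in sm (E S u). norm ((f x)\<^sup>2) \<le> B\<^sup>2"
    using AE_sm_E[OF S, of u]
  proof eventually_elim
    case (elim x)
    then have "\<bar>f x\<bar> \<le> \<bar>B\<bar>" using B[of x] by linarith
    then show ?case by (simp add: abs_le_square_iff)
  qed
qed (use f in simp)

text \<open>Cutting off where \<open>f\<close> is large. The resulting density of the domain makes
  the vector described in \<open>calculus_op\<close> unique, see \<open>cdom_eqI\<close>.\<close>

lemma cdom_dense_seq:
  assumes f: "f \<in> borel_measurable borel"
  obtains S where "\<And>n::nat. S n \<in> sets borel" "\<And>n u. E (S n) u \<in> cdom f" "\<And>u. (\<lambda>n. E (S n) u) \<longlonglongrightarrow> u"
proof -
  define S where "S n = {x. \<bar>f x\<bar> \<le> real n}" for n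
  note [measurable] = f
  have "{x \<in> space borel. \<bar>f x\<bar> \<le> real n} \<in> sets borel" for n by measurable
  then have S [measurable]: "S n \<in> sets borel" for n by (simp add: S_def)
  have "E (S n) u \<in> cdom f" for n u
    by (rule E_mem_cdom_bounded[OF S f, of n "real n"]) (simp add: S_def)
  moreover have "(\<lambda>n. E (S n) u) \<longlonglongrightarrow> u" for u
  proof -
    interpret finite_measure "sm u" by (rule finite_measure_sm)
    have "(\<lambda>n. measure (sm u) (S n)) \<longlonglongrightarrow> measure (sm u) (\<Union>n. S n)"
      by (rule finite_Lim_measure_incseq) (auto simp: incseq_def S_def)
    moreover have "(\<Union>n. S n) = UNIV"
    proof -
      have "\<exists>n. x \<in> S n" for x unfolding S_def using real_arch_simple[of "\<bar>f x\<bar>"] by auto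
      then show ?thesis by auto
    qed
    ultimately have "(\<lambda>n. measure (sm u) (S n)) \<longlonglongrightarrow> (nrm u)\<^sup>2" by (simp only: measure_sm_UNIV)
    from tendsto_diff[OF tendsto_const[of "(nrm u)\<^sup>2"] this]
    have lim: "(\<lambda>n. (nrm u)\<^sup>2 - measure (sm u) (S n)) \<longlonglongrightarrow> 0" by simp
    have "(nrm (E (S n) u - u))\<^sup>2 = (nrm u)\<^sup>2 - measure (sm u) (S n)" for n
      using nrm_E_sq[OF S, of n u] by (simp add: nrm_sq_diff measure_sm)
    from tendsto_0_sq_bound[OF eq_refl[OF this] lim] show ?thesis by (simp add: tendsto_iff_nrm)
  qed
  ultimately show thesis using that S by blast
qed

lemma cdom_eqI:
  assumes f: "f \<in> borel_measurable borel" and eq: "\<And>v. v \<in> cdom f \<Longrightarrow> ip w v = ip w' v"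
  shows "w = w'"
proof -
  obtain S where S: "\<And>n::nat. S n \<in> sets borel" "\<And>n u. E (S n) u \<in> cdom f" "\<And>u. (\<lambda>n. E (S n) u) \<longlonglongrightarrow> u"
    using cdom_dense_seq[OF f] by blast
  show ?thesis
  proof (rule ip_eqI_left)
    fix v
    have "(\<lambda>n. ip w (E (S n) v)) \<longlonglongrightarrow> ip w v" "(\<lambda>n. ip w' (E (S n) v)) \<longlonglongrightarrow> ip w' v"
      by (intro ip.tendsto tendsto_const S)+
    moreover have "ip w (E (S n) v) = ip w' (E (S n) v)" for n by (rule eq[OF S(2)])
    ultimately show "ip w v = ip w' v" using LIMSEQ_unique by simp
  qed
qed

text \<open>The working description of \<open>calculus_op\<close> as a strong limit of simple
  operators. The sequence is Cauchy by \<open>simp_op_nrm_diff\<close>, its limit satisfies the weak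
  identity by dominated convergence, and \<open>cdom_eqI\<close> identifies it with the value of the
  definite description.\<close>

lemma cop_tendsto:
  assumes a: "approx_ops f fn Fn" and u: "u \<in> cdom f"
  shows "(\<lambda>n. Fn n u) \<longlonglongrightarrow> cop f u"
    and "\<And>v. v \<in> cdom f \<Longrightarrow> ip (cop f u) v = spectral_integral ip E f u v"
proof -
  note sub = cdom_csubspace[OF approx_opsD(1)[OF a]]
  obtain w where w: "(\<lambda>n. Fn n u) \<longlonglongrightarrow> w"
  proof (rule convergent_nrm_Cauchy[of "\<lambda>n. Fn n u"])
    fix e :: real assume e: "e > 0"
    let ?I = "\<lambda>n. \<integral>x. (fn n x - f x)\<^sup>2 \<partial>sm u"
    have "\<forall>\<^sub>F n in sequentially. ?I n < e\<^sup>2 / 4"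
      using approx_ops_L2(1)[OF a u] e by (intro order_tendstoD) auto
    then obtain M where M: "\<And>n. n \<ge> M \<Longrightarrow> ?I n < e\<^sup>2 / 4"
      unfolding eventually_sequentially by blast
    show "\<exists>M. \<forall>m\<ge>M. \<forall>n\<ge>M. nrm (Fn m u - Fn n u) < e"
    proof (intro exI allI impI)
      fix m n assume mn: "m \<ge> M" "n \<ge> M"
      note i = approx_ops_L2(2)[OF a u]
      have "(nrm (Fn m u - Fn n u))\<^sup>2 = (\<integral>x. (fn m x - fn n x)\<^sup>2 \<partial>sm u)"
        by (rule simp_op_nrm_diff[OF approx_opsD(2)[OF a] approx_opsD(2)[OF a]])
      also have "\<dots> \<le> 2 * ?I m + 2 * ?I n"
        by (intro integral_sq_diff_le i integrable_simp_op_sq[OF simp_op_diff[OF approx_opsD(2)[OF a] approx_opsD(2)[OF a]]])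
      also have "\<dots> < e\<^sup>2" using M[OF mn(1)] M[OF mn(2)] by linarith
      finally show "nrm (Fn m u - Fn n u) < e" using e by (simp add: power2_less_imp_less)
    qed
  qed
  have wv: "ip w v = spectral_integral ip E f u v" if v: "v \<in> cdom f" for v
  proof -
    have "(\<lambda>n. spectral_integral ip E (fn n) u v) \<longlonglongrightarrow> spectral_integral ip E f u v"
      unfolding spectral_integral_def
      by (intro tendsto_intros approx_ops_L2(6)[OF a] csubspace_add csubspace_scaleC sub u v) simp
    moreover have "(\<lambda>n. ip (Fn n u) v) \<longlonglongrightarrow> ip w v" by (intro ip.tendsto tendsto_const w)
    ultimately show ?thesis
      unfolding simp_op_spectral_integral[OF approx_opsD(2)[OF a]] by (rule LIMSEQ_unique[rotated])
  qed
  have "cop f u = w"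
    unfolding calculus_op_def
  proof (rule the_equality)
    show "\<forall>v\<in>cdom f. ip w v = spectral_integral ip E f u v" using wv by blast
    fix z assume z: "\<forall>v\<in>cdom f. ip z v = spectral_integral ip E f u v"
    show "z = w" by (rule cdom_eqI[OF approx_opsD(1)[OF a]]) (use wv z in auto)
  qed
  then show "(\<lambda>n. Fn n u) \<longlonglongrightarrow> cop f u" "\<And>v. v \<in> cdom f \<Longrightarrow> ip (cop f u) v = spectral_integral ip E f u v"
    using w wv by auto
qed

context
  fixes f :: "real \<Rightarrow> real" assumes f: "f \<in> borel_measurable borel"
begin

lemma cop_add: assumes "u \<in> cdom f" "v \<in> cdom f" shows "cop f (u + v) = cop f u + cop f v"
proof -
  obtain fn Fn where a: "approx_ops f fn Fn" using approx_ops_exists[OF f] .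
  have "(\<lambda>n. Fn n u + Fn n v) \<longlonglongrightarrow> cop f u + cop f v"
    by (intro tendsto_intros cop_tendsto(1)[OF a] assms)
  moreover have "(\<lambda>n. Fn n (u + v)) \<longlonglongrightarrow> cop f (u + v)"
    by (intro cop_tendsto(1)[OF a] csubspace_add[OF cdom_csubspace[OF f]] assms)
  ultimately show ?thesis
    unfolding clinear_add[OF simp_op_lin[OF approx_opsD(2)[OF a]]] by (rule LIMSEQ_unique[rotated])
qed

lemma cop_scaleC: assumes "u \<in> cdom f" shows "cop f (c *\<^sub>C u) = c *\<^sub>C cop f u"
proof -
  obtain fn Fn where a: "approx_ops f fn Fn" using approx_ops_exists[OF f] .
  show ?thesis
  proof (rule ip_eqI)
    fix w
    have "(\<lambda>n. c * ip w (Fn n u)) \<longlonglongrightarrow> c * ip w (cop f u)"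
      by (intro tendsto_intros ip.tendsto cop_tendsto(1)[OF a] assms)
    moreover have "(\<lambda>n. ip w (Fn n (c *\<^sub>C u))) \<longlonglongrightarrow> ip w (cop f (c *\<^sub>C u))"
      by (intro ip.tendsto tendsto_const cop_tendsto(1)[OF a] csubspace_scaleC[OF cdom_csubspace[OF f]] assms)
    ultimately show "ip w (cop f (c *\<^sub>C u)) = ip w (c *\<^sub>C cop f u)"
      unfolding clinear_scaleC[OF simp_op_lin[OF approx_opsD(2)[OF a]]] ip_scaleC_right
      by (rule LIMSEQ_unique[rotated])
  qed
qed

lemma cop_diff: assumes "u \<in> cdom f" "v \<in> cdom f" shows "cop f (u - v) = cop f u - cop f v"
  using cop_add[of u "(-1) *\<^sub>C v"] cop_scaleC[OF assms(2), of "-1"] assms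
    csubspace_scaleC[OF cdom_csubspace[OF f] assms(2), of "-1"] by simp

lemma cop_zero: "cop f 0 = 0"
  using cop_diff[of 0 0] csubspace_0[OF cdom_csubspace[OF f]] by simp

lemma cop_sum:
  assumes "\<And>i. i \<in> I \<Longrightarrow> v i \<in> cdom f"
  shows "cop f (\<Sum>i\<in>I. v i) = (\<Sum>i\<in>I. cop f (v i))"
  using assms
  by (induction I rule: infinite_finite_induct)
     (simp_all add: cop_zero cop_add csubspace_sum[OF cdom_csubspace[OF f]])

lemma nrm_cop: assumes "u \<in> cdom f" shows "(nrm (cop f u))\<^sup>2 = (\<integral>x. (f x)\<^sup>2 \<partial>sm u)"
proof -
  obtain fn Fn where a: "approx_ops f fn Fn" using approx_ops_exists[OF f] .
  have "(\<lambda>n. (nrm (Fn n u))\<^sup>2) \<longlonglongrightarrow> (nrm (cop f u))\<^sup>2"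
    by (intro tendsto_power tendsto_nrm cop_tendsto(1)[OF a] assms)
  then show ?thesis
    using approx_ops_L2(3)[OF a assms]
    unfolding simp_op_nrm[OF approx_opsD(2)[OF a]] by (rule LIMSEQ_unique)
qed

lemma cop_sym: assumes "u \<in> cdom f" "v \<in> cdom f" shows "ip (cop f u) v = ip u (cop f v)"
proof -
  obtain fn Fn where a: "approx_ops f fn Fn" using approx_ops_exists[OF f] .
  have "(\<lambda>n. ip (Fn n u) v) \<longlonglongrightarrow> ip (cop f u) v" "(\<lambda>n. ip u (Fn n v)) \<longlonglongrightarrow> ip u (cop f v)"
    by (intro ip.tendsto tendsto_const cop_tendsto(1)[OF a] assms)+
  then show ?thesis
    unfolding simp_op_sym[OF approx_opsD(2)[OF a]] by (rule LIMSEQ_unique)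
qed

lemma Re_ip_cop: assumes "u \<in> cdom f" shows "Re (ip (cop f u) u) = (\<integral>x. f x \<partial>sm u)"
proof -
  obtain fn Fn where a: "approx_ops f fn Fn" using approx_ops_exists[OF f] .
  have "(\<lambda>n. Re (ip (Fn n u) u)) \<longlonglongrightarrow> Re (ip (cop f u) u)"
    by (intro tendsto_Re ip.tendsto tendsto_const cop_tendsto(1)[OF a] assms)
  then have "(\<lambda>n. \<integral>x. fn n x \<partial>sm u) \<longlonglongrightarrow> Re (ip (cop f u) u)"
    unfolding simp_op_quadratic[OF approx_opsD(2)[OF a]] by (simp only: Re_complex_of_real)
  then show ?thesis using approx_ops_L2(6)[OF a assms] by (rule LIMSEQ_unique)
qed

text \<open>With the identity for \<open>f\<close>, the left side measures how far \<open>u\<close>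
  is from being an eigenvector for \<open>c\<close>, the right side how far its scalar measure is
  from a point mass at \<open>c\<close>.\<close>

lemma nrm_cop_minus:
  assumes u: "u \<in> cdom f"
  shows "(nrm (cop f u - c *\<^sub>R u))\<^sup>2 = (\<integral>x. (f x - c)\<^sup>2 \<partial>sm u)"
    and "integrable (sm u) (\<lambda>x. (f x - c)\<^sup>2)"
proof -
  interpret finite_measure "sm u" by (rule finite_measure_sm)
  have i: "integrable (sm u) (\<lambda>x. (f x)\<^sup>2)" "integrable (sm u) f"
    using u integrable_cdom[OF f u] by (auto simp: cdom_iff)
  have eq: "(f x - c)\<^sup>2 = (f x)\<^sup>2 - 2 * c * f x + c\<^sup>2" for x by (simp add: power2_eq_square algebra_simps)
  show "integrable (sm u) (\<lambda>x. (f x - c)\<^sup>2)" unfolding eq using i by simp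
  have "(\<integral>x. (f x - c)\<^sup>2 \<partial>sm u) = (\<integral>x. (f x)\<^sup>2 \<partial>sm u) - 2 * c * (\<integral>x. f x \<partial>sm u) + c\<^sup>2 * (nrm u)\<^sup>2"
    unfolding eq using i by (simp add: measure_sm_UNIV)
  then show "(nrm (cop f u - c *\<^sub>R u))\<^sup>2 = (\<integral>x. (f x - c)\<^sup>2 \<partial>sm u)"
    by (simp add: nrm_sq_diff nrm_cop[OF u] Re_ip_cop[OF u] ip_scaleR nrm_scaleR power_mult_distrib)
qed

lemma cop_point:
  assumes w: "E {r} w = w"
  shows "w \<in> cdom f" "cop f w = f r *\<^sub>R w"
proof -
  show c: "w \<in> cdom f"
    using E_mem_cdom_bounded[of "{r}" f "\<bar>f r\<bar>" w] f w by simp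
  have AE: "AE x in sm w. x \<in> {r}" using AE_sm_E[of "{r}" w] unfolding w by simp
  have "(\<integral>x. (f x - f r)\<^sup>2 \<partial>sm w) = (\<integral>x. 0 \<partial>sm w)"
  proof (rule integral_cong_AE)
    show "AE x in sm w. (f x - f r)\<^sup>2 = 0" using AE by eventually_elim simp
  qed (use f in auto)
  then have "(nrm (cop f w - f r *\<^sub>R w))\<^sup>2 = 0" unfolding nrm_cop_minus(1)[OF c] by simp
  then show "cop f w = f r *\<^sub>R w" by simp
qed

end

lemma cdom_mono:
  assumes g: "g \<in> borel_measurable borel" and u: "u \<in> cdom f" and le: "AE x in sm u. \<bar>g x\<bar> \<le> C * \<bar>f x\<bar>"
  shows "u \<in> cdom g"
  unfolding cdom_iff
proof (rule Bochner_Integration.integrable_bound)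
  show "integrable (sm u) (\<lambda>x. C\<^sup>2 * (f x)\<^sup>2)" using u by (simp add: cdom_iff)
  show "AE x in sm u. norm ((g x)\<^sup>2) \<le> norm (C\<^sup>2 * (f x)\<^sup>2)"
    using le
  proof eventually_elim
    case (elim x)
    then have "\<bar>g x\<bar>\<^sup>2 \<le> (C * \<bar>f x\<bar>)\<^sup>2" by (intro power_mono) auto
    then show ?case by (simp add: power_mult_distrib)
  qed
qed (use g in simp)

end

section \<open>The spectral theorem for positive definite operators\<close>

locale posdef_op = hilbert_ip ip for ip :: "'a::chilbert_space ip" +
  fixes D :: "'a set" and A :: "'a \<Rightarrow> 'a"
  assumes sa: "selfadjoint ip D A" and pd: "positive_definite ip D A"
begin

lemma D_sub: "csubspace D"
  and A_add: "u \<in> D \<Longrightarrow> v \<in> D \<Longrightarrow> A (u + v) = A u + A v"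
  and A_scaleC: "u \<in> D \<Longrightarrow> A (c *\<^sub>C u) = c *\<^sub>C A u"
  using sa unfolding selfadjoint_def densely_defined_linear_def by auto

lemma A_sym: assumes "u \<in> D" "v \<in> D" shows "ip (A u) v = ip u (A v)"
proof -
  have "(\<forall>u\<in>D. ip (A u) v = ip u (A v)) \<longleftrightarrow> v \<in> D \<and> A v = A v"
    using sa unfolding selfadjoint_def by (elim conjE allE)
  then show ?thesis using assms by blast
qed

lemma adjointI: assumes "\<And>u. u \<in> D \<Longrightarrow> ip (A u) v = ip u w" shows "v \<in> D" "A v = w"
proof -
  have "(\<forall>u\<in>D. ip (A u) v = ip u w) \<longleftrightarrow> v \<in> D \<and> w = A v"
    using sa unfolding selfadjoint_def by (elim conjE allE)
  then show "v \<in> D" "A v = w" using assms by blast+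
qed

lemma A_diff: "u \<in> D \<Longrightarrow> v \<in> D \<Longrightarrow> A (u - v) = A u - A v"
  using A_add[of u "(-1) *\<^sub>C v"] A_scaleC[of v "-1"] csubspace_scaleC[OF D_sub, of v "-1"] by simp

lemma A_closed:
  assumes "\<And>n::nat. X n \<in> D" "X \<longlonglongrightarrow> x" "(\<lambda>n. A (X n)) \<longlonglongrightarrow> y"
  shows "x \<in> D" "A x = y"
proof -
  have "ip (A u) x = ip u y" if u: "u \<in> D" for u
  proof -
    have "(\<lambda>n. ip (A u) (X n)) \<longlonglongrightarrow> ip (A u) x" by (intro ip.tendsto tendsto_const assms)
    moreover have "(\<lambda>n. ip u (A (X n))) \<longlonglongrightarrow> ip u y" by (intro ip.tendsto tendsto_const assms)
    ultimately show ?thesis using A_sym[OF u assms(1)] LIMSEQ_unique by simp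
  qed
  then show "x \<in> D" "A x = y" using adjointI[of x y] by auto
qed

text \<open>Some positive lower bound of the form, which may lie strictly below the spectrum. It is
  fixed once so that later constants can refer to it.\<close>

definition lower :: real where
  "lower = (SOME \<alpha>. \<alpha> > 0 \<and> (\<forall>u\<in>D. Re (ip (A u) u) \<ge> \<alpha> * (nrm u)\<^sup>2))"

lemma lower: "lower > 0" "u \<in> D \<Longrightarrow> lower * (nrm u)\<^sup>2 \<le> Re (ip (A u) u)"
proof -
  have "\<exists>\<alpha>. \<alpha> > 0 \<and> (\<forall>u\<in>D. Re (ip (A u) u) \<ge> \<alpha> * (nrm u)\<^sup>2)"
    using pd unfolding positive_definite_def by blast
  from someI_ex[OF this] show "lower > 0" "u \<in> D \<Longrightarrow> lower * (nrm u)\<^sup>2 \<le> Re (ip (A u) u)"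
    unfolding lower_def by auto
qed

lemma nrm_A_ge: assumes u: "u \<in> D" shows "lower * nrm u \<le> nrm (A u)"
proof (cases "u = 0")
  case False
  then have n: "nrm u > 0" using nrm_nonneg[of u] nrm_eq_0[of u] by linarith
  have "lower * nrm u * nrm u \<le> Re (ip (A u) u)" using lower(2)[OF u] by (simp add: power2_eq_square)
  also have "\<dots> \<le> nrm (A u) * nrm u" by (rule order_trans[OF complex_Re_le_cmod Cauchy_Schwarz])
  finally show ?thesis using n by simp
qed simp

lemma inj_A: "inj_on A D"
proof (rule inj_onI)
  fix u v assume uv: "u \<in> D" "v \<in> D" "A u = A v"
  have "lower * nrm (u - v) \<le> nrm (A (u - v))" by (intro nrm_A_ge csubspace_diff[OF D_sub] uv)
  also have "\<dots> = 0" using uv by (simp add: A_diff)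
  finally have "nrm (u - v) \<le> 0" using lower(1) by (simp add: mult_le_0_iff)
  then show "u = v" using nrm_nonneg[of "u - v"] nrm_eq_0[of "u - v"] by simp
qed

text \<open>The range is closed because \<open>A\<close> is closed and bounded below. A vector
  orthogonal to the range lies in the domain of the adjoint with value 0, so by selfadjointness
  \<open>A\<close> annihilates it, and it is 0.\<close>

lemma range_A: "A ` D = UNIV"
proof (rule ccontr)
  assume ne: "A ` D \<noteq> UNIV"
  have sub: "csubspace (A ` D)"
  proof (rule complex_vector.subspaceI)
    show "0 \<in> A ` D" using A_diff[of 0 0] csubspace_0[OF D_sub] by (intro image_eqI[of _ _ 0]) auto
    fix x y c assume "x \<in> A ` D"
    then obtain u where u: "u \<in> D" "x = A u" by blast
    then show "c *\<^sub>C x \<in> A ` D"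
      using A_scaleC csubspace_scaleC[OF D_sub] by (intro image_eqI[of _ _ "c *\<^sub>C u"]) auto
    assume "y \<in> A ` D"
    then obtain v where v: "v \<in> D" "y = A v" by blast
    show "x + y \<in> A ` D"
      using A_add csubspace_add[OF D_sub] u v by (intro image_eqI[of _ _ "u + v"]) auto
  qed
  have cl: "closed (A ` D)"
    unfolding closed_sequential_limits
  proof (intro allI impI, elim conjE)
    fix Y y assume Y: "\<forall>n. Y n \<in> A ` D" "Y \<longlonglongrightarrow> y"
    then have "\<exists>u. u \<in> D \<and> Y n = A u" for n by blast
    then obtain X where X: "\<And>n. X n \<in> D" "\<And>n. Y n = A (X n)" by metis
    have XY: "lower * nrm (X m - X n) \<le> nrm (Y m - Y n)" for m n
      using nrm_A_ge[OF csubspace_diff[OF D_sub X(1) X(1)], of m n] by (simp add: X A_diff)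
    obtain x where x: "X \<longlonglongrightarrow> x"
    proof (rule convergent_nrm_Cauchy[of X])
      fix e :: real assume "e > 0"
      then have "lower * e / 2 > 0" using lower(1) by simp
      moreover have "(\<lambda>n. nrm (Y n - y)) \<longlonglongrightarrow> 0" using Y by (simp add: tendsto_iff_nrm)
      ultimately have "\<forall>\<^sub>F n in sequentially. nrm (Y n - y) < lower * e / 2" by (intro order_tendstoD)
      then obtain M where M: "\<And>n. n \<ge> M \<Longrightarrow> nrm (Y n - y) < lower * e / 2"
        unfolding eventually_sequentially by blast
      show "\<exists>M. \<forall>m\<ge>M. \<forall>n\<ge>M. nrm (X m - X n) < e"
      proof (intro exI allI impI)
        fix m n assume "m \<ge> M" "n \<ge> M"
        then have "lower * nrm (X m - X n) < lower * e"
          using XY[of m n] nrm_triangle3[of "Y m" "Y n" y] M[of m] M[of n] nrm_minus_commute[of y "Y n"] by linarith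
        then show "nrm (X m - X n) < e" using lower(1) by simp
      qed
    qed
    have "(\<lambda>n. A (X n)) \<longlonglongrightarrow> y" using Y(2) by (simp add: X(2)[symmetric])
    from A_closed[OF X(1) x this] show "y \<in> A ` D" by blast
  qed
  obtain v where v: "v \<noteq> 0" "\<And>w. w \<in> A ` D \<Longrightarrow> ip w v = 0"
    by (rule exists_orthogonal[OF sub cl ne]) blast
  have "ip (A u) v = ip u 0" if "u \<in> D" for u using v(2) that by simp
  then have "v \<in> D" "A v = 0" using adjointI[of v 0] by auto
  then have "lower * nrm v \<le> 0" using nrm_A_ge[of v] by simp
  then show False
    using v(1) lower(1) nrm_nonneg[of v] nrm_eq_0[of v] by (simp add: mult_le_0_iff)
qed

section \<open>The scaled inverse and the spectral measure built from it\<close>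

abbreviation "Ainv \<equiv> inv_into D A"

lemma Ainv: "Ainv v \<in> D" "A (Ainv v) = v" "u \<in> D \<Longrightarrow> Ainv (A u) = u"
  using range_A inj_A by (auto simp: inv_into_into f_inv_into_f)

text \<open>\<open>nrm_A_ge\<close> bounds the inverse by \<open>1 / lower\<close>; the factor makes
  it a contraction.\<close>

definition T :: "'a \<Rightarrow> 'a" where "T v = lower *\<^sub>R Ainv v"

lemma T_A: "u \<in> D \<Longrightarrow> T (A u) = lower *\<^sub>R u"
  by (simp add: T_def Ainv)

lemma clinear_Ainv: "clinear Ainv"
  unfolding clinear_def
proof (intro conjI allI)
  fix x y c
  have "Ainv (A (Ainv x + Ainv y)) = Ainv x + Ainv y" by (intro Ainv csubspace_add[OF D_sub])
  then show "Ainv (x + y) = Ainv x + Ainv y" by (simp add: A_add Ainv)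
  have "Ainv (A (c *\<^sub>C Ainv x)) = c *\<^sub>C Ainv x" by (intro Ainv csubspace_scaleC[OF D_sub])
  then show "Ainv (c *\<^sub>C x) = c *\<^sub>C Ainv x" by (simp add: A_scaleC Ainv)
qed

lemma positive_contraction_T: "positive_contraction ip T"
proof
  show "clinear T"
    using clinear_Ainv unfolding T_def clinear_def
    by (auto simp: scaleR_right_distrib scaleR_scaleC_commute)
  fix x y
  have "ip (Ainv x) y = ip x (Ainv y)" using A_sym[OF Ainv(1)[of x] Ainv(1)[of y]] by (simp add: Ainv)
  then show "ip (T x) y = ip x (T y)" by (simp add: T_def ip_scaleR)
  have re: "Re (ip (T x) x) = lower * Re (ip (A (Ainv x)) (Ainv x))"
    by (simp add: T_def ip_scaleR Ainv Re_ip_commute)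
  show "0 \<le> Re (ip (T x) x)"
    unfolding re using lower(1) lower(2)[OF Ainv(1)[of x]]
    by (meson mult_nonneg_nonneg less_imp_le zero_le_power2 order_trans)
  have "lower * Re (ip (A (Ainv x)) (Ainv x)) \<le> lower * (nrm x * nrm (Ainv x))"
    using lower(1) order_trans[OF complex_Re_le_cmod Cauchy_Schwarz[of x "Ainv x"]] by (simp add: Ainv)
  also have "\<dots> \<le> nrm x * nrm x"
    using mult_left_mono[OF nrm_A_ge[OF Ainv(1)[of x]] nrm_nonneg[of x]] by (simp add: Ainv ac_simps)
  finally show "Re (ip (T x) x) \<le> (nrm x)\<^sup>2" unfolding re by (simp add: power2_eq_square)
qed

lemma inj_T: "T v = 0 \<Longrightarrow> v = 0"
  using lower(1) Ainv(2)[of v] A_diff[of 0 0] csubspace_0[OF D_sub] by (simp add: T_def)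

text \<open>The value \<open>lower / 0 = 0\<close> does no harm: the projection of \<open>{0}\<close> vanishes because \<open>T\<close> is injective.\<close>

definition E0 :: "real set \<Rightarrow> 'a \<Rightarrow> 'a" where
  "E0 S = positive_contraction.proj ip T ((\<lambda>x. lower / x) -` S)"

lemma ratio_measurable [measurable]: "(\<lambda>x. lower / x) \<in> borel_measurable borel" by measurable

lemma vimage_ratio: "S \<in> sets borel \<Longrightarrow> (\<lambda>x. lower / x) -` S \<in> sets borel"
  using measurable_sets[OF ratio_measurable, of S] by simp

lemma pvm_E0: "projection_valued_measure ip E0"
proof -
  interpret C: positive_contraction ip T by (rule positive_contraction_T)
  note P = C.projection_valued_measure_proj[unfolded projection_valued_measure_def]
  show ?thesis
    unfolding projection_valued_measure_def
  proof (intro conjI ballI allI impI)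
    fix F :: "nat \<Rightarrow> real set" and u assume F: "range F \<subseteq> sets borel" and d: "disjoint_family F"
    have "(\<lambda>i::nat. C.proj ((\<lambda>x. lower / x) -` F i) u) sums C.proj (\<Union>i. (\<lambda>x. lower / x) -` F i) u"
    proof (rule C.proj_sums)
      show "range (\<lambda>i. (\<lambda>x. lower / x) -` F i) \<subseteq> sets borel" using F by (auto intro: vimage_ratio)
      show "disjoint_family (\<lambda>i. (\<lambda>x. lower / x) -` F i)" using d by (auto simp: disjoint_family_on_def)
    qed
    then show "(\<lambda>i. E0 (F i) u) sums E0 (\<Union>i. F i) u" by (simp add: E0_def vimage_UN)
  qed (use P in \<open>simp_all add: E0_def vimage_ratio\<close>)
qed

lemma proj_zero: "positive_contraction.proj ip T {0} v = 0"
proof -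
  interpret C: positive_contraction ip T by (rule positive_contraction_T)
  have "(nrm (C.proj {0} (T v)))\<^sup>2 = (nrm v)\<^sup>2 * (\<integral>x. indicator {0} x * x\<^sup>2 \<partial>C.\<nu> v)"
    by (rule C.nrm_proj_T_sq) simp
  also have "(\<integral>x. indicator {0} x * x\<^sup>2 \<partial>C.\<nu> v) = (\<integral>x. 0 \<partial>C.\<nu> v)"
    by (intro Bochner_Integration.integral_cong) (auto simp: indicator_def)
  finally have "C.proj {0} (T v) = 0" by simp
  then show ?thesis using C.proj_T[of "{0}" v] inj_T by simp
qed

text \<open>The scalar measure of \<open>T g\<close> is the image under \<open>lower / x\<close> of
  \<open>\<nu> g\<close> with density \<open>(nrm g)\<^sup>2 * x\<^sup>2\<close>. Hence the calculus
  operator sends \<open>T g\<close> to a vector of norm at most \<open>lower * nrm g\<close> whose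
  product with \<open>g\<close> has real part \<open>lower * (nrm g)\<^sup>2\<close>. This is
  equality in the Cauchy-Schwarz inequality and forces the vector to be
  \<open>lower *\<^sub>R g\<close>.\<close>

lemma E0_T:
  shows "T g \<in> calculus_dom ip E0 (\<lambda>x. x)" "calculus_op ip E0 (\<lambda>x. x) (T g) = lower *\<^sub>R g"
proof -
  interpret C: positive_contraction ip T by (rule positive_contraction_T)
  interpret P: pvm ip E0 by unfold_locales (rule pvm_E0)
  let ?\<phi> = "\<lambda>x. lower / x"
  interpret N: prob_space "C.\<nu> g" by (rule C.prob_space_\<nu>)
  have sm: "P.sm (T g) = distr (density (C.\<nu> g) (\<lambda>x. ennreal ((nrm g)\<^sup>2 * x\<^sup>2))) borel ?\<phi>"
  proof (rule measure_eqI)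
    fix S assume "S \<in> sets (P.sm (T g))"
    then have S: "S \<in> sets borel" by simp
    note S' = vimage_ratio[OF S]
    have i: "integrable (C.\<nu> g) (\<lambda>x. indicator (?\<phi> -` S) x * x\<^sup>2)"
    proof (rule C.integrable_\<nu>[of _ 1])
      show "\<bar>indicator (?\<phi> -` S) x * x\<^sup>2\<bar> \<le> 1" if "0 \<le> x" "x \<le> 1" for x :: real
        using that by (auto simp: indicator_def power_le_one)
    qed (use S' in measurable)
    have "emeasure (P.sm (T g)) S = ennreal ((nrm g)\<^sup>2 * (\<integral>x. indicator (?\<phi> -` S) x * x\<^sup>2 \<partial>C.\<nu> g))"
      unfolding P.emeasure_sm[OF S] E0_def C.nrm_proj_T_sq[OF S'] ..
    also have "\<dots> = (\<integral>\<^sup>+x. ennreal ((nrm g)\<^sup>2 * (indicator (?\<phi> -` S) x * x\<^sup>2)) \<partial>C.\<nu> g)"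
      using i by (subst nn_integral_eq_integral) (auto simp: indicator_def)
    also have "\<dots> = (\<integral>\<^sup>+x. ennreal ((nrm g)\<^sup>2 * x\<^sup>2) * indicator (?\<phi> -` S) x \<partial>C.\<nu> g)"
      by (intro nn_integral_cong) (auto simp: indicator_def)
    also have "\<dots> = emeasure (density (C.\<nu> g) (\<lambda>x. ennreal ((nrm g)\<^sup>2 * x\<^sup>2))) (?\<phi> -` S)"
      using S' by (subst emeasure_density) auto
    also have "\<dots> = emeasure (distr (density (C.\<nu> g) (\<lambda>x. ennreal ((nrm g)\<^sup>2 * x\<^sup>2))) borel ?\<phi>) S"
      using S by (subst emeasure_distr) auto
    finally show "emeasure (P.sm (T g)) S = emeasure (distr (density (C.\<nu> g) (\<lambda>x. ennreal ((nrm g)\<^sup>2 * x\<^sup>2))) borel ?\<phi>) S" .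
  qed simp
  \<comment> \<open>Equality holds except at 0, where \<open>lower / 0 = 0\<close>.\<close>
  have b: "x\<^sup>2 * (lower / x)\<^sup>2 \<le> lower\<^sup>2" "0 \<le> x\<^sup>2 * (lower / x)\<^sup>2" for x :: real
    by (cases "x = 0"; simp add: power_divide)+
  have i: "integrable (C.\<nu> g) (\<lambda>x. (nrm g)\<^sup>2 * x\<^sup>2 * (lower / x)\<^sup>2)"
    by (rule C.integrable_\<nu>[of _ "(nrm g)\<^sup>2 * lower\<^sup>2"]) (use b in \<open>auto simp: mult.assoc intro!: mult_left_mono\<close>)
  then have "integrable (density (C.\<nu> g) (\<lambda>x. ennreal ((nrm g)\<^sup>2 * x\<^sup>2))) (\<lambda>x. (lower / x)\<^sup>2)"
    by (subst integrable_density) auto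
  then have i2: "integrable (P.sm (T g)) (\<lambda>x. x\<^sup>2)"
    unfolding sm by (subst integrable_distr_eq) auto
  then show dom: "T g \<in> P.cdom (\<lambda>x. x)" by (simp add: P.cdom_iff)
  have "(nrm (P.cop (\<lambda>x. x) (T g)))\<^sup>2 = (\<integral>x. x\<^sup>2 \<partial>P.sm (T g))"
    using P.nrm_cop[OF _ dom] by simp
  also have "\<dots> = (\<integral>x. (lower / x)\<^sup>2 \<partial>density (C.\<nu> g) (\<lambda>x. ennreal ((nrm g)\<^sup>2 * x\<^sup>2)))"
    unfolding sm by (subst integral_distr) auto
  also have "\<dots> = (\<integral>x. (nrm g)\<^sup>2 * x\<^sup>2 * (lower / x)\<^sup>2 \<partial>C.\<nu> g)"
    by (subst integral_density) auto
  also have "\<dots> \<le> (nrm g)\<^sup>2 * lower\<^sup>2"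
    by (rule C.integral_\<nu>_le) (use b in \<open>auto simp: mult.assoc intro!: mult_left_mono\<close>)
  finally have n1: "(nrm (P.cop (\<lambda>x. x) (T g)))\<^sup>2 \<le> (nrm g)\<^sup>2 * lower\<^sup>2" .
  have simp_int: "integrable (C.\<nu> g) (\<lambda>x. f (lower / x) * x)" if f: "P.simp_op f F" for f F
  proof -
    obtain B where B: "\<And>x. \<bar>f x\<bar> \<le> B" using P.simp_op_bounded[OF f] by blast
    have [measurable]: "f \<in> borel_measurable borel" by (rule P.simp_op_measurable[OF f])
    show ?thesis
    proof (rule C.integrable_\<nu>[of _ "B * 1"])
      show "\<bar>f (lower / x) * x\<bar> \<le> B * 1" if "0 \<le> x" "x \<le> 1" for x
        unfolding abs_mult using B[of "lower / x"] that by (intro mult_mono) auto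
    qed measurable
  qed
  \<comment> \<open>With \<open>T g\<close> in one slot only, the density is \<open>x\<close>
    instead of \<open>x\<^sup>2\<close>.\<close>
  have quad: "Re (ip (F (T g)) g) = (nrm g)\<^sup>2 * (\<integral>x. f (lower / x) * x \<partial>C.\<nu> g)" if "P.simp_op f F" for f F
    using that
  proof (induction rule: P.simp_op.induct)
    case (indicator S)
    then show ?case
      unfolding E0_def C.Re_ip_proj_T[OF vimage_ratio[OF indicator]] by (simp add: indicator_vimage)
  next
    case (add f F h H)
    then show ?case using simp_int[OF add.hyps(1)] simp_int[OF add.hyps(2)]
      by (simp add: ip_add_left distrib_right distrib_left)
  next
    case (scale f F c)
    then show ?case by (simp add: ip_scaleR mult.assoc mult.left_commute[of _ c])
  qed
  obtain fn Fn where a: "P.approx_ops (\<lambda>x. x) fn Fn" using P.approx_ops_exists[of "\<lambda>x. x"] by auto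
  note [measurable] = P.approx_opsD(5)[OF a]
  have "(\<lambda>n. \<integral>x. fn n (lower / x) * x \<partial>C.\<nu> g) \<longlonglongrightarrow> (\<integral>x. (lower / x) * x \<partial>C.\<nu> g)"
  proof (rule integral_dominated_convergence[where w = "\<lambda>x. 2 * lower"])
    show "AE x in C.\<nu> g. (\<lambda>n. fn n (lower / x) * x) \<longlonglongrightarrow> lower / x * x"
      by (intro AE_I2 tendsto_intros P.approx_opsD(3)[OF a])
    show "AE x in C.\<nu> g. norm (fn n (lower / x) * x) \<le> 2 * lower" for n
    proof (intro AE_I2)
      fix x
      have "\<bar>fn n (lower / x)\<bar> * \<bar>x\<bar> \<le> 2 * \<bar>lower / x\<bar> * \<bar>x\<bar>"
        by (intro mult_right_mono P.approx_opsD(4)[OF a]) auto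
      also have "\<dots> \<le> 2 * lower" using lower(1) by (cases "x = 0") auto
      finally show "norm (fn n (lower / x) * x) \<le> 2 * lower" by (simp add: abs_mult)
    qed
  qed auto
  then have "(\<lambda>n. (nrm g)\<^sup>2 * (\<integral>x. fn n (lower / x) * x \<partial>C.\<nu> g)) \<longlonglongrightarrow> (nrm g)\<^sup>2 * (\<integral>x. (lower / x) * x \<partial>C.\<nu> g)"
    by (intro tendsto_intros)
  moreover have "(\<lambda>n. Re (ip (Fn n (T g)) g)) \<longlonglongrightarrow> Re (ip (P.cop (\<lambda>x. x) (T g)) g)"
    by (intro tendsto_Re ip.tendsto tendsto_const P.cop_tendsto(1)[OF a dom])
  ultimately have "Re (ip (P.cop (\<lambda>x. x) (T g)) g) = (nrm g)\<^sup>2 * (\<integral>x. (lower / x) * x \<partial>C.\<nu> g)"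
    unfolding quad[OF P.approx_opsD(2)[OF a]] by (rule LIMSEQ_unique[rotated])
  \<comment> \<open>The product is \<open>lower\<close> except at 0. By \<open>proj_zero\<close> the
    correction at 0 vanishes after multiplication by \<open>(nrm g)\<^sup>2\<close>.\<close>
  also have "(\<integral>x. (lower / x) * x \<partial>C.\<nu> g) = (\<integral>x. lower - lower * indicator {0} x \<partial>C.\<nu> g)"
    by (intro Bochner_Integration.integral_cong) (auto simp: indicator_def)
  also have "\<dots> = lower - lower * measure (C.\<nu> g) {0}"
  proof -
    have i0: "integrable (C.\<nu> g) (\<lambda>x. indicator {0} x :: real)"
      by (rule C.integrable_bdd_meas[OF C.bdd_meas_indicator]) simp
    have "(\<integral>x. lower - lower * indicator {0} x \<partial>C.\<nu> g) = (\<integral>x. lower \<partial>C.\<nu> g) - (\<integral>x. lower * indicator {0} x \<partial>C.\<nu> g)"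
      by (rule Bochner_Integration.integral_diff[OF N.integrable_const integrable_mult_right[OF i0]])
    then show ?thesis
      by (simp only: lebesgue_integral_const N.prob_space[unfolded C.space_\<nu>] scaleR_one integral_mult_right_zero
          Bochner_Integration.integral_indicator C.space_\<nu> Int_UNIV_right)
  qed
  also have "(nrm g)\<^sup>2 * (lower - lower * measure (C.\<nu> g) {0}) = lower * (nrm g)\<^sup>2"
    using C.nrm_proj_sq[of "{0}" g] by (simp add: proj_zero algebra_simps)
  finally have n2: "Re (ip (P.cop (\<lambda>x. x) (T g)) g) = lower * (nrm g)\<^sup>2" .
  have "(nrm (P.cop (\<lambda>x. x) (T g) - lower *\<^sub>R g))\<^sup>2
      = (nrm (P.cop (\<lambda>x. x) (T g)))\<^sup>2 - 2 * (lower * (lower * (nrm g)\<^sup>2)) + lower\<^sup>2 * (nrm g)\<^sup>2"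
    by (simp add: nrm_sq_diff ip_scaleR n2 nrm_scaleR power_mult_distrib)
  also have "\<dots> \<le> 0" using n1 by (simp add: power2_eq_square[of lower] algebra_simps)
  finally have "(nrm (P.cop (\<lambda>x. x) (T g) - lower *\<^sub>R g))\<^sup>2 \<le> 0" .
  then show "P.cop (\<lambda>x. x) (T g) = lower *\<^sub>R g" by simp
qed

theorem is_spectral_measure_E0: "is_spectral_measure ip D A E0"
  unfolding is_spectral_measure_def
proof (intro conjI)
  interpret P: pvm ip E0 by unfold_locales (rule pvm_E0)
  show "projection_valued_measure ip E0" by (rule pvm_E0)
  have *: "u \<in> P.cdom (\<lambda>x. x) \<and> P.cop (\<lambda>x. x) u = A u" if u: "u \<in> D" for u
  proof -
    have "u = T ((1 / lower) *\<^sub>R A u)"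
      using lower(1) T_A[OF u] clinear_scaleR[OF positive_contraction.lin[OF positive_contraction_T]] by simp
    then show ?thesis using E0_T[of "(1 / lower) *\<^sub>R A u"] lower(1) by simp
  qed
  then show "\<forall>u\<in>D. A u = P.cop (\<lambda>x. x) u" by simp
  \<comment> \<open>The calculus operator is a symmetric extension of \<open>A\<close>, and a
    selfadjoint operator has no proper symmetric extension.\<close>
  have "v \<in> D" if v: "v \<in> P.cdom (\<lambda>x. x)" for v
  proof (rule adjointI)
    fix u assume "u \<in> D"
    then show "ip (A u) v = ip u (P.cop (\<lambda>x. x) v)"
      using * P.cop_sym[OF _ _ v, of u] by simp
  qed
  then show "D = P.cdom (\<lambda>x. x)" using * by blast
qed

section \<open>Eigenvectors, lower bound and regular points in terms of the spectral measure\<close>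

abbreviation "E \<equiv> spectral_measure ip D A"

lemma is_spectral_measure_E: "is_spectral_measure ip D A E"
  unfolding spectral_measure_def by (rule someI[of _ E0]) (rule is_spectral_measure_E0)

sublocale pvm ip E
  using is_spectral_measure_E by unfold_locales (simp add: is_spectral_measure_def)

lemma D_eq: "D = cdom (\<lambda>x. x)" and A_eq: "u \<in> D \<Longrightarrow> A u = cop (\<lambda>x. x) u"
  using is_spectral_measure_E by (auto simp: is_spectral_measure_def)

lemma D_iff: "u \<in> D \<longleftrightarrow> u \<in> cdom (\<lambda>x. x)"
  using arg_cong[OF D_eq, of "\<lambda>D. u \<in> D"] .

lemma nrm_A_minus:
  assumes "u \<in> D"
  shows "(nrm (A u - c *\<^sub>R u))\<^sup>2 = (\<integral>x. (x - c)\<^sup>2 \<partial>sm u)" "integrable (sm u) (\<lambda>x. (x - c)\<^sup>2)"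
  using nrm_cop_minus[of "\<lambda>x. x" u c] assms by (simp_all add: D_iff A_eq)

text \<open>By \<open>nrm_A_minus\<close>, being an eigenvector for \<open>r\<close> means that
  \<open>(x - r)\<^sup>2\<close> integrates to 0 against the scalar measure, that is, all mass sits
  at \<open>r\<close>.\<close>

lemma eigenspace_iff: "w \<in> eigenspace D A (complex_of_real r) \<longleftrightarrow> E {r} w = w"
proof
  assume "w \<in> eigenspace D A (complex_of_real r)"
  then have w: "w \<in> D" "A w = r *\<^sub>R w" by (auto simp: eigenspace_def)
  have "(\<integral>x. (x - r)\<^sup>2 \<partial>sm w) = 0" using nrm_A_minus(1)[OF w(1), of r] w(2) by simp
  then have "AE x in sm w. (x - r)\<^sup>2 = 0"
    using nrm_A_minus(2)[OF w(1), of r] by (subst (asm) integral_nonneg_eq_0_iff_AE) auto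
  then have "AE x in sm w. x \<in> {r}" by eventually_elim simp
  then have z: "E (- {r}) w = 0" by (subst (asm) AE_sm_iff) auto
  have "E ({r} \<union> - {r}) w = E {r} w + E (- {r}) w" by (rule E_Un) auto
  then show "E {r} w = w" by (simp add: z Compl_partition)
next
  assume w: "E {r} w = w"
  from cop_point[of "\<lambda>x. x", OF _ w] show "w \<in> eigenspace D A (complex_of_real r)"
    by (auto simp: eigenspace_def D_iff A_eq)
qed

lemma E_point_mem: "E {r} v \<in> eigenspace D A (complex_of_real r)"
  by (simp add: eigenspace_iff E_idem)

lemma E_eigenvector:
  assumes w: "w \<in> eigenspace D A (complex_of_real r)" and S: "S \<in> sets borel"
  shows "E S w = (if r \<in> S then w else 0)"
proof -
  have "E S (E {r} w) = E (S \<inter> {r}) w" using S by (simp add: E_Int)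
  moreover have "S \<inter> {r} = (if r \<in> S then {r} else {})" by auto
  ultimately show ?thesis using w by (simp add: eigenspace_iff)
qed

text \<open>A spectral component of \<open>u\<close> below \<open>lower\<close> would violate the
  lower bound of the form. The half-line is exhausted by bounded intervals because the corresponding
  components then lie in \<open>D\<close>.\<close>

lemma AE_lower: "AE x in sm u. lower \<le> x"
proof -
  have "AE x in sm u. x \<in> - {- real n..<lower}" for n
  proof -
    let ?S = "{- real n..<lower}"
    let ?w = "E ?S u"
    interpret finite_measure "sm ?w" by (rule finite_measure_sm)
    have "\<bar>x\<bar> \<le> max (real n) lower" if "x \<in> ?S" for x using that by auto
    then have c: "?w \<in> cdom (\<lambda>x. x)" by (intro E_mem_cdom_bounded) auto
    then have w: "?w \<in> D" by (simp only: D_iff)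
    have i: "integrable (sm ?w) (\<lambda>x. x)" using integrable_cdom[of "\<lambda>x. x", OF _ c] by simp
    have "lower * (nrm ?w)\<^sup>2 \<le> (\<integral>x. x \<partial>sm ?w)"
      using lower(2)[OF w] Re_ip_cop[of "\<lambda>x. x", OF _ c] by (simp add: A_eq[OF w])
    then have "(\<integral>x. lower - x \<partial>sm ?w) \<le> 0"
      using i by (simp add: measure_sm_UNIV mult.commute)
    moreover have AE: "AE x in sm ?w. x \<in> ?S" by (rule AE_sm_E) simp
    moreover from AE have nn: "AE x in sm ?w. 0 \<le> lower - x" by eventually_elim auto
    moreover have "0 \<le> (\<integral>x. lower - x \<partial>sm ?w)" using nn by (rule integral_nonneg_AE)
    ultimately have "(\<integral>x. lower - x \<partial>sm ?w) = 0" by linarith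
    then have "AE x in sm ?w. lower - x = 0"
      using i nn by (subst (asm) integral_nonneg_eq_0_iff_AE) auto
    with AE have "AE x in sm ?w. x \<in> {}" by eventually_elim auto
    then have "?w = 0" by (subst (asm) AE_sm_iff) auto
    then show ?thesis by (subst AE_sm_iff) auto
  qed
  then have "AE x in sm u. \<forall>n. x \<in> - {- real n..<lower}" by (subst AE_all_countable) blast
  then show ?thesis
  proof eventually_elim
    case (elim x)
    obtain n where "- x \<le> real n" using real_arch_simple by blast
    then show ?case using elim by (auto simp: not_le) (metis linorder_not_less minus_le_iff)
  qed
qed

text \<open>A vector spectrally supported within \<open>\<delta>\<close> of \<open>r\<close>
  satisfies \<open>nrm (A w - r *\<^sub>R w) \<le> \<delta> * nrm w\<close>. The choice of
  \<open>\<delta>\<close> gives \<open>C * \<delta> \<le> 1 / 2\<close>, so that such a vector is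
  bounded by half its own norm.\<close>

lemma E_resolvent:
  assumes C: "\<And>u. u \<in> D \<Longrightarrow> nrm u \<le> C * nrm (A u - r *\<^sub>R u)"
  obtains \<delta> where "\<delta> > 0" "\<And>v. E {r - \<delta><..<r + \<delta>} v = 0"
proof -
  define \<delta> where "\<delta> = 1 / (2 * (\<bar>C\<bar> + 1))"
  have d: "\<delta> > 0" "C * \<delta> \<le> 1 / 2" by (auto simp: \<delta>_def field_simps)
  have "E {r - \<delta><..<r + \<delta>} v = 0" for v
  proof -
    let ?S = "{r - \<delta><..<r + \<delta>}"
    let ?w = "E ?S v"
    interpret finite_measure "sm ?w" by (rule finite_measure_sm)
    have "\<bar>x\<bar> \<le> \<bar>r\<bar> + \<delta>" if "x \<in> ?S" for x using that by auto
    then have w: "?w \<in> D" unfolding D_iff by (intro E_mem_cdom_bounded) auto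
    have "(nrm (A ?w - r *\<^sub>R ?w))\<^sup>2 \<le> (\<integral>x. \<delta>\<^sup>2 \<partial>sm ?w)"
      unfolding nrm_A_minus(1)[OF w]
    proof (rule integral_mono_AE)
      show "AE x in sm ?w. (x - r)\<^sup>2 \<le> \<delta>\<^sup>2"
      proof -
        have "AE x in sm ?w. x \<in> ?S" by (rule AE_sm_E) simp
        then show ?thesis by eventually_elim (use d in \<open>auto simp: abs_le_square_iff[symmetric]\<close>)
      qed
    qed (use nrm_A_minus(2)[OF w] in auto)
    also have "\<dots> = (\<delta> * nrm ?w)\<^sup>2" by (simp add: measure_sm_UNIV power_mult_distrib mult.commute)
    finally have le: "nrm (A ?w - r *\<^sub>R ?w) \<le> \<delta> * nrm ?w" by (rule power2_le_imp_le) (use d in simp)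
    have "nrm ?w \<le> (1 / 2) * nrm ?w"
    proof (cases "C \<ge> 0")
      case True
      have "nrm ?w \<le> C * nrm (A ?w - r *\<^sub>R ?w)" by (rule C[OF w])
      also have "\<dots> \<le> C * (\<delta> * nrm ?w)" by (rule mult_left_mono[OF le True])
      also have "\<dots> \<le> (1 / 2) * nrm ?w" using mult_right_mono[OF d(2) nrm_nonneg[of ?w]] by (simp add: mult.assoc)
      finally show ?thesis .
    next
      case False
      then have "C * nrm (A ?w - r *\<^sub>R ?w) \<le> 0" by (simp add: mult_nonpos_nonneg)
      then show ?thesis using C[OF w] nrm_nonneg[of ?w] by linarith
    qed
    then have "nrm ?w \<le> 0" by simp
    then show ?thesis using nrm_nonneg[of ?w] nrm_eq_0[of ?w] by linarith
  qed
  then show thesis using that d by blast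
qed

text \<open>The null intervals around the points of \<open>S\<close> may be uncountably many; by
  Lindelof countably many of them cover the same set.\<close>

lemma AE_not_locally_null:
  assumes "\<And>r. r \<in> S \<Longrightarrow> \<exists>\<delta>>0. E {r - \<delta><..<r + \<delta>} v = 0"
  shows "AE x in sm v. x \<notin> S"
proof -
  define \<F> where "\<F> = {{r - \<delta><..<r + \<delta>} | r \<delta>. E {r - \<delta><..<r + \<delta>} v = 0}"
  have "\<And>S. S \<in> \<F> \<Longrightarrow> open S" by (auto simp: \<F>_def)
  then obtain \<F>' where F: "\<F>' \<subseteq> \<F>" "countable \<F>'" "\<Union>\<F>' = \<Union>\<F>" using Lindelof by metis
  have "AE x in sm v. x \<notin> B" if BF: "B \<in> \<F>'" for B
  proof -
    obtain r \<delta> where B: "B = {r - \<delta><..<r + \<delta>}" "E {r - \<delta><..<r + \<delta>} v = 0" using BF F(1) unfolding \<F>_def by blast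
    have "AE x in sm v. x \<in> - B" using B by (subst AE_sm_iff) auto
    then show ?thesis by simp
  qed
  then have "AE x in sm v. \<forall>B\<in>\<F>'. x \<notin> B" using F(2) by (subst AE_ball_countable) auto
  then show ?thesis
  proof eventually_elim
    case (elim x)
    show ?case
    proof
      assume "x \<in> S"
      then obtain \<delta> where "\<delta> > 0" "E {x - \<delta><..<x + \<delta>} v = 0" using assms by blast
      then have "x \<in> \<Union>\<F>" unfolding \<F>_def by (intro UnionI[of "{x - \<delta><..<x + \<delta>}"]) auto
      then show False using elim F(3) by blast
    qed
  qed
qed

end

section \<open>Eigenvector expansions and the discrete spectrum\<close>

context hilbert_ip
begin

lemma orthonormal_sum:
  assumes o: "orthonormal_on ip I w" and F: "finite F" "F \<subseteq> I"
  shows "j \<in> F \<Longrightarrow> ip (w j) (\<Sum>k\<in>F. c k *\<^sub>C w k) = c j"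
    and "(nrm (\<Sum>k\<in>F. c k *\<^sub>C w k))\<^sup>2 = (\<Sum>k\<in>F. (cmod (c k))\<^sup>2)"
proof -
  have *: "ip (w j) (\<Sum>k\<in>F. c k *\<^sub>C w k) = c j" if j: "j \<in> F" for j
  proof -
    have "ip (w j) (\<Sum>k\<in>F. c k *\<^sub>C w k) = (\<Sum>k\<in>F. c k * ip (w j) (w k))"
      by (simp add: ip.sum_right ip_scaleC_right)
    also have "\<dots> = (\<Sum>k\<in>F. if j = k then c k else 0)"
      using o j F(2) by (intro sum.cong) (auto simp: orthonormal_on_def subset_iff)
    also have "\<dots> = c j" using j F(1) by simp
    finally show ?thesis .
  qed
  then show "j \<in> F \<Longrightarrow> ip (w j) (\<Sum>k\<in>F. c k *\<^sub>C w k) = c j" .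
  have "ip (\<Sum>k\<in>F. c k *\<^sub>C w k) (\<Sum>k\<in>F. c k *\<^sub>C w k) = (\<Sum>j\<in>F. cnj (c j) * c j)"
    by (subst ip.sum_left) (simp add: ip_scaleC_left * del: ip.sum_right)
  also have "\<dots> = of_real (\<Sum>k\<in>F. (cmod (c k))\<^sup>2)"
    unfolding of_real_sum by (intro sum.cong refl) (metis complex_norm_square mult.commute of_real_power)
  finally show "(nrm (\<Sum>k\<in>F. c k *\<^sub>C w k))\<^sup>2 = (\<Sum>k\<in>F. (cmod (c k))\<^sup>2)"
    unfolding nrm_sq by simp
qed

lemma bessel:
  assumes o: "orthonormal_on ip I w" and F: "finite F" "F \<subseteq> I"
  shows "(\<Sum>k\<in>F. (cmod (ip (w k) v))\<^sup>2) \<le> (nrm v)\<^sup>2"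
proof -
  let ?P = "\<Sum>k\<in>F. ip (w k) v *\<^sub>C w k"
  have "ip ?P v = of_real (\<Sum>k\<in>F. (cmod (ip (w k) v))\<^sup>2)"
    unfolding of_real_sum ip.sum_left ip_scaleC_left
    by (intro sum.cong refl) (metis complex_norm_square mult.commute of_real_power)
  then have "Re (ip v ?P) = (\<Sum>k\<in>F. (cmod (ip (w k) v))\<^sup>2)" unfolding Re_ip_commute[of v] by simp
  then have "(nrm (v - ?P))\<^sup>2 = (nrm v)\<^sup>2 - (\<Sum>k\<in>F. (cmod (ip (w k) v))\<^sup>2)"
    by (simp add: nrm_sq_diff orthonormal_sum(2)[OF o F])
  then show ?thesis using zero_le_power2[of "nrm (v - ?P)"] by linarith
qed

lemma orthonormal_expansion:
  assumes o: "orthonormal_on ip {1..} w"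
    and total: "\<And>z. (\<And>k. k \<ge> (1::nat) \<Longrightarrow> ip (w k) z = 0) \<Longrightarrow> z = 0"
  shows "(\<lambda>m. \<Sum>k=1..m. ip (w k) v *\<^sub>C w k) \<longlonglongrightarrow> v"
proof -
  let ?c = "\<lambda>k. ip (w k) v" and ?P = "\<lambda>m. \<Sum>k=1..m. ip (w k) v *\<^sub>C w k"
  define g where "g k = (if k \<ge> 1 then (cmod (?c k))\<^sup>2 else 0)" for k
  have le: "(\<Sum>k<n. g k) \<le> (nrm v)\<^sup>2" for n
  proof -
    have "(\<Sum>k<n. g k) = (\<Sum>k\<in>{1..<n}. (cmod (?c k))\<^sup>2)"
      by (rule sum.mono_neutral_cong_right) (auto simp: g_def)
    also have "\<dots> \<le> (nrm v)\<^sup>2" by (rule bessel[OF o]) auto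
    finally show ?thesis .
  qed
  have "summable g" by (rule summableI_nonneg_bounded[OF _ le]) (simp add: g_def)
  have tail: "(nrm (?P m - ?P n))\<^sup>2 = (\<Sum>k\<in>{n<..m}. g k)" if "n \<le> m" for m n
  proof -
    have "{1..m} = {1..n} \<union> {n<..m}" using that by auto
    then have "?P m = ?P n + (\<Sum>k\<in>{n<..m}. ?c k *\<^sub>C w k)"
      by (simp only:) (rule sum.union_disjoint, auto)
    then have "(nrm (?P m - ?P n))\<^sup>2 = (nrm (\<Sum>k\<in>{n<..m}. ?c k *\<^sub>C w k))\<^sup>2" by simp
    also have "\<dots> = (\<Sum>k\<in>{n<..m}. (cmod (?c k))\<^sup>2)" by (rule orthonormal_sum(2)[OF o]) auto
    finally show ?thesis by (simp add: g_def)
  qed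
  obtain s where s: "?P \<longlonglongrightarrow> s"
  proof (rule convergent_nrm_Cauchy[of ?P])
    fix e :: real assume e: "e > 0"
    from summable_partial_sum_bound[OF \<open>summable g\<close>, of "e\<^sup>2"] e
    obtain M where M: "\<And>m n. m \<ge> M \<Longrightarrow> norm (\<Sum>k=m..n. g k) < e\<^sup>2" by auto
    have *: "nrm (?P m - ?P n) < e" if "n \<ge> M" "n \<le> m" for m n
    proof (rule power2_less_imp_less)
      have "{n<..m} = {Suc n..m}" by auto
      then show "(nrm (?P m - ?P n))\<^sup>2 < e\<^sup>2" using tail[OF that(2)] M[of "Suc n" m] that by simp
    qed (use e in simp)
    show "\<exists>M. \<forall>m\<ge>M. \<forall>n\<ge>M. nrm (?P m - ?P n) < e"
    proof (intro exI allI impI)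
      fix m n assume "m \<ge> M" "n \<ge> M"
      then show "nrm (?P m - ?P n) < e" using *[of n m] *[of m n] nrm_minus_commute[of "?P m" "?P n"] by (cases "n \<le> m") auto
    qed
  qed
  have "v - s = 0"
  proof (rule total)
    fix j :: nat assume j: "j \<ge> 1"
    have "(\<lambda>m. ip (w j) (?P m)) \<longlonglongrightarrow> ip (w j) s" by (intro ip.tendsto tendsto_const s)
    moreover have "\<forall>\<^sub>F m in sequentially. ip (w j) (?P m) = ip (w j) v"
      using eventually_ge_at_top[of j] by eventually_elim (rule orthonormal_sum(1)[OF o], use j in auto)
    then have "(\<lambda>m. ip (w j) (?P m)) \<longlonglongrightarrow> ip (w j) v" by (rule tendsto_eventually)
    ultimately have "ip (w j) s = ip (w j) v" by (rule LIMSEQ_unique)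
    then show "ip (w j) (v - s) = 0" by (simp add: ip_diff_right)
  qed
  then show ?thesis using s by simp
qed

end

lemma powr_measurable [measurable]: "(\<lambda>x::real. x powr s) \<in> borel_measurable borel"
  by measurable

lemma powr_sq: "(x powr s)\<^sup>2 = (x::real) powr (2 * s)"
  by (simp add: power2_eq_square powr_add[symmetric])

section \<open>Real powers and completeness of the list of eigenvectors\<close>

context posdef_op
begin

abbreviation "pdom s \<equiv> power_dom ip D A s"
abbreviation "pop s \<equiv> op_power ip D A s"

lemma pdom_eq: "power_dom ip D A s = cdom (\<lambda>x. x powr s)"
  by (simp add: power_dom_def)

lemma pop_eq: "op_power ip D A s = cop (\<lambda>x. x powr s)"
  by (simp add: op_power_def)

lemmas pdom_sub = cdom_csubspace[of "\<lambda>x. x powr s" for s, OF powr_measurable, folded pdom_eq]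
lemmas pop_add = cop_add[of "\<lambda>x. x powr s" for s, OF powr_measurable, folded pdom_eq pop_eq]
lemmas pop_scaleC = cop_scaleC[of "\<lambda>x. x powr s" for s, OF powr_measurable, folded pdom_eq pop_eq]
lemmas pop_diff = cop_diff[of "\<lambda>x. x powr s" for s, OF powr_measurable, folded pdom_eq pop_eq]
lemmas pop_sum = cop_sum[of "\<lambda>x. x powr s" for s, OF powr_measurable, folded pdom_eq pop_eq]
lemmas pop_sym = cop_sym[of "\<lambda>x. x powr s" for s, OF powr_measurable, folded pdom_eq pop_eq]
lemmas nrm_pop = nrm_cop[of "\<lambda>x. x powr s" for s, OF powr_measurable, folded pdom_eq pop_eq]
lemmas E_mem_pdom = E_mem_cdom[of _ "\<lambda>x. x powr s" for s, OF _ powr_measurable, folded pdom_eq]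

lemma pdom_mono:
  assumes "s \<le> t" "u \<in> pdom t"
  shows "u \<in> pdom s"
  unfolding pdom_eq
proof (rule cdom_mono[where f = "\<lambda>x. x powr t" and C = "lower powr (s - t)"])
  show "u \<in> cdom (\<lambda>x. x powr t)" using assms(2) by (simp add: pdom_eq)
  show "AE x in sm u. \<bar>x powr s\<bar> \<le> lower powr (s - t) * \<bar>x powr t\<bar>"
    using AE_lower[of u]
  proof eventually_elim
    case (elim x)
    have "x powr (s - t) \<le> lower powr (s - t)" using elim lower(1) assms(1) by (intro powr_mono2') auto
    then have "x powr (s - t) * x powr t \<le> lower powr (s - t) * x powr t" by (rule mult_right_mono) simp
    then show ?case using elim lower(1) by (simp add: powr_add[symmetric])
  qed
qed simp

lemma integrable_pop: "u \<in> pdom s \<Longrightarrow> integrable (sm u) (\<lambda>x. x powr (2 * s))"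
  by (simp add: pdom_eq cdom_iff powr_sq)

lemma nrm_pop_powr: "u \<in> pdom s \<Longrightarrow> (nrm (pop s u))\<^sup>2 = (\<integral>x. x powr (2 * s) \<partial>sm u)"
  by (simp add: nrm_pop powr_sq)

lemma pdom_0: "u \<in> pdom 0" and pop_0: "pop 0 u = u"
proof -
  interpret finite_measure "sm u" by (rule finite_measure_sm)
  \<comment> \<open>As \<open>0 powr 0 = 0\<close>, this uses that the scalar measure lives on
    \<open>{lower..}\<close>.\<close>
  have AE: "AE x in sm u. x powr 0 = 1" using AE_lower[of u] by eventually_elim (use lower(1) in auto)
  have "u \<in> cdom (\<lambda>x. x powr 0)"
    unfolding cdom_iff by (rule integrable_const_bound[of _ 1]) (use AE in auto)
  then show d: "u \<in> pdom 0" by (simp add: pdom_eq)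
  have "(nrm (pop 0 u - 1 *\<^sub>R u))\<^sup>2 = (\<integral>x. (x powr 0 - 1)\<^sup>2 \<partial>sm u)"
    unfolding pop_eq by (rule nrm_cop_minus[OF powr_measurable]) (use d in \<open>simp add: pdom_eq\<close>)
  also have "\<dots> = (\<integral>x. 0 \<partial>sm u)" by (rule integral_cong_AE) (use AE in auto)
  finally show "pop 0 u = u" by simp
qed

lemma pdom_nonpos: "s \<le> 0 \<Longrightarrow> u \<in> pdom s"
  by (rule pdom_mono[OF _ pdom_0])

lemma eigenvector_pop:
  assumes "w \<in> eigenspace D A (complex_of_real r)"
  shows "w \<in> pdom s" "pop s w = (r powr s) *\<^sub>R w"
  using cop_point[OF powr_measurable, of r w s] assms by (simp_all add: eigenspace_iff pdom_eq pop_eq)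

lemma eigenvalue_ge_lower:
  assumes "w \<in> eigenspace D A (complex_of_real r)" "w \<noteq> 0"
  shows "lower \<le> r"
proof -
  have w: "w \<in> D" "A w = r *\<^sub>R w" using assms by (auto simp: eigenspace_def)
  have "lower * (nrm w)\<^sup>2 \<le> r * (nrm w)\<^sup>2" using lower(2)[OF w(1)] by (simp add: w ip_scaleR nrm_sq)
  then show ?thesis using assms(2) by simp
qed

text \<open>The component \<open>E {r} v\<close> lies in the eigenspace, hence in the span of the
  listed vectors for \<open>r\<close>, and is therefore orthogonal to \<open>v\<close>. But its
  product with \<open>v\<close> is its own squared norm.\<close>

lemma lists_orthogonal_null:
  assumes l: "lists_eigenpairs_below b ip D A I \<nu>' w" and r: "ereal r < b"
    and o: "\<And>k. k \<in> I \<Longrightarrow> \<nu>' k = r \<Longrightarrow> ip (w k) v = 0"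
  shows "E {r} v = 0"
proof -
  have "E {r} v \<in> cspan (w ` {k \<in> I. \<nu>' k = r})"
    using l r E_point_mem[of r v] unfolding lists_eigenpairs_below_def by blast
  moreover have "cspan (w ` {k \<in> I. \<nu>' k = r}) \<subseteq> {x. ip x v = 0}"
    by (rule complex_vector.span_minimal)
       (use o in \<open>auto intro!: complex_vector.subspaceI simp: ip_add_left ip_scaleC_left\<close>)
  ultimately have "ip (E {r} v) v = 0" by blast
  then show ?thesis using nrm_E_sq[of "{r}" v] by simp
qed

lemma listsD:
  assumes "lists_eigenpairs_below b ip D A I \<nu>' w"
  shows "mono_on I \<nu>'" "orthonormal_on ip I w" "k \<in> I \<Longrightarrow> ereal (\<nu>' k) < b"
    "k \<in> I \<Longrightarrow> w k \<in> eigenspace D A (complex_of_real (\<nu>' k))" "k \<in> I \<Longrightarrow> w k \<noteq> 0"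
    "k \<in> I \<Longrightarrow> lower \<le> \<nu>' k"
proof -
  show *: "mono_on I \<nu>'" "orthonormal_on ip I w" "k \<in> I \<Longrightarrow> ereal (\<nu>' k) < b"
    "k \<in> I \<Longrightarrow> w k \<in> eigenspace D A (complex_of_real (\<nu>' k))"
    using assms by (auto simp: lists_eigenpairs_below_def)
  show n: "k \<in> I \<Longrightarrow> w k \<noteq> 0"
    using *(2) unfolding orthonormal_on_def by (metis ip_zero(1) zero_neq_one)
  show "k \<in> I \<Longrightarrow> lower \<le> \<nu>' k" using eigenvalue_ge_lower *(4) n by blast
qed

text \<open>A point of the support of the scalar measure of \<open>z\<close> gives approximate eigenvectors orthogonal
  to the list; by compactness they have a limit, an eigenvector that the list misses.\<close>

lemma compact_inverse_total:
  assumes comp: "compact_operator ip Ainv" and l: "lists_eigenpairs_below \<infinity> ip D A {1..} \<nu>' w"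
    and z: "\<And>k. k \<ge> (1::nat) \<Longrightarrow> ip (w k) z = 0"
  shows "z = 0"
proof (rule ccontr)
  assume "z \<noteq> 0"
  have "\<exists>r. \<forall>\<delta>>0. E {r - \<delta><..<r + \<delta>} z \<noteq> 0"
  proof (rule ccontr)
    assume "\<not> ?thesis"
    then have "AE x in sm z. x \<notin> UNIV" by (intro AE_not_locally_null) blast
    then have "AE x in sm z. x \<in> {}" by simp
    then have "z = 0" by (subst (asm) AE_sm_iff) auto
    then show False using \<open>z \<noteq> 0\<close> by simp
  qed
  then obtain r where r: "\<And>\<delta>. \<delta> > 0 \<Longrightarrow> E {r - \<delta><..<r + \<delta>} z \<noteq> 0" by blast
  define d where "d n = 1 / real (Suc n)" for n
  have d: "d n > 0" "d n \<le> 1" for n by (auto simp: d_def)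
  define S where "S n = {r - d n<..<r + d n}" for n
  have S [measurable]: "S n \<in> sets borel" for n by (simp add: S_def)
  define X where "X n = (1 / nrm (E (S n) z)) *\<^sub>R E (S n) z" for n
  have pos: "nrm (E (S n) z) > 0" for n
    using r[OF d(1)[of n]] nrm_nonneg[of "E (S n) z"] nrm_eq_0[of "E (S n) z"] unfolding S_def by linarith
  have X1: "nrm (X n) = 1" for n
  proof -
    have "nrm (E (S n) z) \<noteq> 0" using pos[of n] by linarith
    then show ?thesis by (simp add: X_def nrm_scaleR)
  qed
  have XE: "X n = E (S n) ((1 / nrm (E (S n) z)) *\<^sub>R z)" for n
    unfolding X_def clinear_scaleR[OF E_lin[OF S]] ..
  have XD: "X n \<in> D" for n
    unfolding D_iff XE by (rule E_mem_cdom_bounded[OF S, of _ _ "\<bar>r\<bar> + d n"]) (auto simp: S_def)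
  have near: "nrm (A (X n) - r *\<^sub>R X n) \<le> d n" for n
  proof (rule power2_le_imp_le)
    interpret finite_measure "sm (X n)" by (rule finite_measure_sm)
    have "AE x in sm (X n). x \<in> S n" unfolding XE by (rule AE_sm_E[OF S])
    then have "AE x in sm (X n). (x - r)\<^sup>2 \<le> (d n)\<^sup>2"
      by eventually_elim (use d(1)[of n] in \<open>auto simp: S_def abs_le_square_iff[symmetric]\<close>)
    then have "(\<integral>x. (x - r)\<^sup>2 \<partial>sm (X n)) \<le> (\<integral>x. (d n)\<^sup>2 \<partial>sm (X n))"
      by (intro integral_mono_AE nrm_A_minus XD integrable_const)
    then show "(nrm (A (X n) - r *\<^sub>R X n))\<^sup>2 \<le> (d n)\<^sup>2"
      unfolding nrm_A_minus(1)[OF XD] by (simp add: measure_sm_UNIV X1)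
  qed (use d in \<open>simp add: less_imp_le\<close>)
  have orth: "ip (w k) (X n) = 0" if k: "k \<ge> 1" for k n
  proof -
    have "E (S n) (w k) = w k \<or> E (S n) (w k) = 0"
      using E_eigenvector[OF listsD(4)[OF l] S, of k n] k by auto
    then have "ip (E (S n) (w k)) z = 0" using z[OF k] by auto
    then show ?thesis unfolding XE E_sym[OF S, symmetric] by (simp add: ip_scaleR)
  qed
  \<comment> \<open>Bounds all \<open>nrm (A (X n))\<close>, since \<open>d n \<le> 1\<close>. Thus
    \<open>X n\<close> divided by \<open>R\<close> is the image under \<open>Ainv\<close> of a
    vector in the unit ball.\<close>
  define R where "R = \<bar>r\<bar> + 1"
  have R: "R > 0" by (simp add: R_def)
  have bound: "nrm ((1 / R) *\<^sub>R A (X n)) \<le> 1" for n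
  proof -
    have "nrm (A (X n)) \<le> nrm (A (X n) - r *\<^sub>R X n) + nrm (r *\<^sub>R X n)"
      using nrm_triangle[of "A (X n) - r *\<^sub>R X n" "r *\<^sub>R X n"] by simp
    also have "\<dots> \<le> R" using near[of n] d(2)[of n] by (simp add: nrm_scaleR X1 R_def)
    finally show ?thesis using R by (simp add: nrm_scaleR)
  qed
  have in_closure: "(1 / R) *\<^sub>R X n \<in> closure (Ainv ` {v. nrm v \<le> 1})" for n
  proof -
    have "Ainv ((1 / R) *\<^sub>R A (X n)) = (1 / R) *\<^sub>R X n"
      by (simp add: clinear_scaleR[OF clinear_Ainv] Ainv(3)[OF XD])
    moreover have "Ainv ((1 / R) *\<^sub>R A (X n)) \<in> Ainv ` {v. nrm v \<le> 1}"
      by (intro imageI CollectI bound)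
    ultimately show ?thesis using closure_subset by (metis subsetD)
  qed
  define Y where "Y n = (1 / R) *\<^sub>R X n" for n
  have mem: "\<forall>n. Y n \<in> closure (Ainv ` {v. nrm v \<le> 1})"
    unfolding Y_def using in_closure by blast
  have sc: "seq_compact (closure (Ainv ` {v. nrm v \<le> 1}))"
    using comp by (simp add: compact_operator_def compact_eq_seq_compact_metric)
  obtain x0 s where s: "strict_mono s" and "(Y \<circ> s) \<longlonglongrightarrow> x0"
    by (rule seq_compactE[OF sc mem]) (rule that)
  then have "(\<lambda>n. R *\<^sub>R ((1 / R) *\<^sub>R X (s n))) \<longlonglongrightarrow> R *\<^sub>R x0"
    by (intro tendsto_intros) (simp add: o_def Y_def)
  then have lim: "(\<lambda>n. X (s n)) \<longlonglongrightarrow> R *\<^sub>R x0" using R by simp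
  have "(\<lambda>n. nrm (A (X (s n)) - r *\<^sub>R X (s n))) \<longlonglongrightarrow> 0"
  proof (rule Lim_null_comparison)
    have "d \<longlonglongrightarrow> 0" unfolding d_def[abs_def] using LIMSEQ_inverse_real_of_nat by (simp add: inverse_eq_divide)
    then show "(\<lambda>n. d (s n)) \<longlonglongrightarrow> 0" using LIMSEQ_subseq_LIMSEQ[OF _ s] by (simp add: o_def)
    show "\<forall>\<^sub>F n in sequentially. norm (nrm (A (X (s n)) - r *\<^sub>R X (s n))) \<le> d (s n)"
      using near by (intro always_eventually) simp
  qed
  then have "(\<lambda>n. A (X (s n)) - r *\<^sub>R X (s n)) \<longlonglongrightarrow> 0"
    unfolding tendsto_iff_nrm[of _ 0] by simp
  from tendsto_add[OF this tendsto_scaleR[OF tendsto_const[of r] lim]]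
  have limA: "(\<lambda>n. A (X (s n))) \<longlonglongrightarrow> r *\<^sub>R R *\<^sub>R x0" by simp
  let ?x = "R *\<^sub>R x0"
  have "?x \<in> eigenspace D A (complex_of_real r)"
    using A_closed[OF XD lim limA] by (simp add: eigenspace_def)
  then have x1: "E {r} ?x = ?x" by (simp only: eigenspace_iff)
  have x2: "E {r} ?x = 0"
  proof (rule lists_orthogonal_null[OF l])
    fix k :: nat assume "k \<in> {1..}"
    then have "(\<lambda>n. ip (w k) (X (s n))) \<longlonglongrightarrow> 0" using orth by simp
    moreover have "(\<lambda>n. ip (w k) (X (s n))) \<longlonglongrightarrow> ip (w k) ?x" by (intro ip.tendsto tendsto_const lim)
    ultimately show "ip (w k) ?x = 0" using LIMSEQ_unique by blast
  qed simp
  have "nrm ?x = 1"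
    using LIMSEQ_unique[OF tendsto_nrm[OF lim]] X1 by simp
  then show False using x1 x2 by (metis nrm_zero zero_neq_one)
qed

lemma pdom_sum_eigen:
  assumes "\<And>k. k \<in> F \<Longrightarrow> w k \<in> eigenspace D A (complex_of_real (\<nu>' k))"
  shows "(\<Sum>k\<in>F. c k *\<^sub>C w k) \<in> pdom s"
    and "pop s (\<Sum>k\<in>F. c k *\<^sub>C w k) = (\<Sum>k\<in>F. (c k * of_real (\<nu>' k powr s)) *\<^sub>C w k)"
proof -
  have d: "c k *\<^sub>C w k \<in> pdom s" if "k \<in> F" for k
    by (intro csubspace_scaleC pdom_sub eigenvector_pop(1)[OF assms[OF that]])
  then show "(\<Sum>k\<in>F. c k *\<^sub>C w k) \<in> pdom s" by (intro csubspace_sum pdom_sub)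
  have "pop s (c k *\<^sub>C w k) = (c k * of_real (\<nu>' k powr s)) *\<^sub>C w k" if "k \<in> F" for k
    using eigenvector_pop[OF assms[OF that], of s] by (simp add: pop_scaleC scaleR_scaleC del: scaleC_simps(1))
  then show "pop s (\<Sum>k\<in>F. c k *\<^sub>C w k) = (\<Sum>k\<in>F. (c k * of_real (\<nu>' k powr s)) *\<^sub>C w k)"
    using d by (simp add: pop_sum)
qed

lemma ip_eigenvector_pop:
  assumes w: "w \<in> eigenspace D A (complex_of_real r)" and u: "u \<in> pdom s"
  shows "ip w (pop s u) = of_real (r powr s) * ip w u"
  using pop_sym[OF eigenvector_pop(1)[OF w] u] by (simp add: eigenvector_pop(2)[OF w] ip_scaleR)

end

section \<open>The spectrum below the essential spectrum\<close>

lemma ipnorm_cinner: "ipnorm cinner v = norm (v :: 'a::chilbert_space)"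
  by (simp add: ipnorm_def norm_eq_sqrt_inner inner_Re_cinner)

text \<open>Spectrum and spectral measure are compared for \<open>cinner\<close> because
  \<open>op_spectrum\<close> is written with the norm of the type.\<close>

locale cposdef_op = posdef_op cinner D A for D :: "'a::chilbert_space set" and A
begin

lemma AE_spectrum: "AE x in sm v. complex_of_real x \<in> op_spectrum D A"
proof -
  have "AE x in sm v. x \<notin> {r. complex_of_real r \<notin> op_spectrum D A}"
  proof (rule AE_not_locally_null)
    fix r assume "r \<in> {r. complex_of_real r \<notin> op_spectrum D A}"
    then obtain C where C: "\<And>u. u \<in> D \<Longrightarrow> norm u \<le> C * norm (A u - complex_of_real r *\<^sub>C u)"
      by (auto simp: op_spectrum_def)
    obtain \<delta> where "\<delta> > 0" "\<And>v. E {r - \<delta><..<r + \<delta>} v = 0"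
      by (rule E_resolvent[of C r]) (use C in \<open>auto simp: ipnorm_cinner\<close>)
    then show "\<exists>\<delta>>0. E {r - \<delta><..<r + \<delta>} v = 0" by blast
  qed
  then show ?thesis by simp
qed

lemma eigenvalue_in_spectrum:
  assumes "w \<in> eigenspace D A (complex_of_real r)" "w \<noteq> 0"
  shows "complex_of_real r \<in> op_spectrum D A"
proof -
  have w: "w \<in> D" "A w = r *\<^sub>R w" using assms(1) by (auto simp: eigenspace_def)
  have "0 \<in> D" "A 0 = 0" using A_diff[of 0 0] csubspace_0[OF D_sub] by auto
  then have "\<not> inj_on (\<lambda>u. A u - complex_of_real r *\<^sub>C u) D"
    using inj_onD[of "\<lambda>u. A u - complex_of_real r *\<^sub>C u" D w 0] w assms(2) by auto
  then show ?thesis by (auto simp: op_spectrum_def bij_betw_def)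
qed

context
  fixes I lam u
  assumes l: "lists_eigenpairs_below (ess_inf D A) cinner D A I lam u"
begin

lemma spectrum_below:
  assumes "complex_of_real r \<in> op_spectrum D A" "ereal r < ess_inf D A"
  shows "complex_of_real r isolated_in op_spectrum D A" "\<exists>k\<in>I. lam k = r"
proof -
  have "complex_of_real r \<notin> ess_spectrum D A"
  proof
    assume "complex_of_real r \<in> ess_spectrum D A"
    then have "ess_inf D A \<le> ereal (Re (complex_of_real r))" unfolding ess_inf_def by (rule INF_lower)
    then show False using assms(2) by simp
  qed
  then have i: "complex_of_real r isolated_in op_spectrum D A" and e: "eigenspace D A (complex_of_real r) \<noteq> {0}"
    using assms(1) by (auto simp: ess_spectrum_def)
  show "complex_of_real r isolated_in op_spectrum D A" by (rule i)
  have "eigenspace D A (complex_of_real r) = cspan (u ` {k \<in> I. lam k = r})"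
    using l assms(2) by (auto simp: lists_eigenpairs_below_def)
  then have "cspan (u ` {k \<in> I. lam k = r}) \<noteq> {0}" using e by simp
  then have "{k \<in> I. lam k = r} \<noteq> {}" using complex_vector.span_empty by (metis image_empty)
  then show "\<exists>k\<in>I. lam k = r" by blast
qed

text \<open>Below \<open>t\<close> the spectrum consists of listed eigenvalues, which are countably
  many, and orthogonality removes the point mass at each of them. In the minimax arguments this
  replaces minimization over an orthogonal complement.\<close>

lemma AE_ge_of_orthogonal:
  assumes t: "ereal t \<le> ess_inf D A" and o: "\<And>i. i \<in> I \<Longrightarrow> lam i < t \<Longrightarrow> cinner (u i) v = 0"
  shows "AE x in sm v. t \<le> x"
proof -
  have "AE x in sm v. i \<in> I \<longrightarrow> lam i < t \<longrightarrow> x \<noteq> lam i" for i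
  proof (cases "i \<in> I \<and> lam i < t")
    case True
    then have "E {lam i} v = 0" using o by (intro lists_orthogonal_null[OF l listsD(3)[OF l]]) auto
    then have "AE x in sm v. x \<in> - {lam i}" by (subst AE_sm_iff) auto
    then show ?thesis by simp
  qed auto
  then have "AE x in sm v. \<forall>i. i \<in> I \<longrightarrow> lam i < t \<longrightarrow> x \<noteq> lam i" by (subst AE_all_countable) blast
  with AE_spectrum[of v] show ?thesis
  proof eventually_elim
    case (elim x)
    show ?case
    proof (rule ccontr)
      assume "\<not> t \<le> x"
      then have "ereal x < ereal t" by simp
      then have "ereal x < ess_inf D A" using t by (rule less_le_trans)
      then obtain k where "k \<in> I" "lam k = x" using spectrum_below(2)[OF elim(1)] by blast
      then show False using elim(2) \<open>\<not> t \<le> x\<close> by force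
    qed
  qed
qed

text \<open>Listed eigenvalues lie strictly below the essential spectrum and so are isolated in the
  spectrum. This includes the last one, which has only the essential spectrum above it.\<close>

lemma spectral_gap:
  assumes j: "j \<in> I"
  obtains \<delta> where "\<delta> > 0" "\<And>v. AE x in sm v. x \<le> lam j \<or> lam j + \<delta> \<le> x"
proof -
  have "complex_of_real (lam j) isolated_in op_spectrum D A"
    using spectrum_below(1)[OF eigenvalue_in_spectrum[OF listsD(4,5)[OF l]]] listsD(3)[OF l] j by blast
  then obtain T where T: "open T" "T \<inter> op_spectrum D A = {complex_of_real (lam j)}"
    unfolding isolated_in_def by blast
  then obtain \<delta> where d: "\<delta> > 0" "ball (complex_of_real (lam j)) \<delta> \<subseteq> T" by (metis IntE insertI1 openE)
  have "AE x in sm v. x \<le> lam j \<or> lam j + \<delta> \<le> x" for v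
    using AE_spectrum[of v]
  proof eventually_elim
    case (elim x)
    show ?case
    proof (rule ccontr)
      assume "\<not> (x \<le> lam j \<or> lam j + \<delta> \<le> x)"
      then have x: "lam j < x" "x < lam j + \<delta>" by auto
      have "dist (complex_of_real (lam j)) (complex_of_real x) = \<bar>lam j - x\<bar>"
        by (metis dist_norm norm_of_real of_real_diff real_norm_def)
      then have "complex_of_real x \<in> T" using x d(2) by auto
      then have "complex_of_real x = complex_of_real (lam j)" using elim T(2) by blast
      then show False using x(1) by simp
    qed
  qed
  then show thesis using that d(1) by blast
qed

end

end

section \<open>Heinz's inequality\<close>

text \<open>Discrete form of the fact that \<open>s powr \<theta> * min 1 (x / s)\<close>,
  integrated against ds/s, gives a multiple of \<open>x powr \<theta>\<close>. If \<open>x\<close>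
  exceeds half the top dyadic point, the last summand alone suffices, whence the factor 2. The
  truncation of \<open>x\<close> is removed in \<open>heinz\<close> by letting \<open>J\<close>
  grow.\<close>

lemma min_powr_le_dyadic_sum:
  fixes a x \<theta> :: real
  assumes a: "0 < a" "a \<le> x" and \<theta>: "0 \<le> \<theta>"
  shows "(min x (a * 2 ^ J)) powr \<theta> \<le> 2 * (\<Sum>j\<le>J. (a * 2 ^ j) powr \<theta> * min 1 (x / (a * 2 ^ j)))"
proof (induction J)
  case 0
  then show ?case using a by (simp add: min_def)
next
  case (Suc J)
  let ?s = "\<lambda>j. a * 2 ^ j"
  let ?t = "\<lambda>j. ?s j powr \<theta> * min 1 (x / ?s j)"
  have nn: "0 \<le> ?t j" for j using a by simp
  show ?case
  proof (cases "x \<le> ?s J")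
    case True
    then have "min x (?s (Suc J)) = min x (?s J)" using a by (simp add: min_def)
    then show ?thesis using Suc nn[of "Suc J"] by simp
  next
    case False
    then have "1 / 2 \<le> min 1 (x / ?s (Suc J))" using a by (simp add: field_simps)
    then have "?s (Suc J) powr \<theta> * (1 / 2) \<le> ?t (Suc J)" by (rule mult_left_mono) simp
    moreover have "(min x (?s (Suc J))) powr \<theta> \<le> ?s (Suc J) powr \<theta>"
      using a \<theta> by (intro powr_mono2) auto
    moreover have "0 \<le> (\<Sum>j\<le>J. ?t j)" by (intro sum_nonneg nn)
    ultimately show ?thesis by simp
  qed
qed

text \<open>Each term is dominated by an increment of a bounded function of \<open>a * 2 ^ j\<close>.\<close>

lemma dyadic_sum_le:
  fixes \<theta> :: real
  assumes \<theta>: "0 < \<theta>" "\<theta> < 1"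
  obtains K where "K \<ge> 0" "\<And>a m J. 0 < a \<Longrightarrow> 0 < m \<Longrightarrow>
    (\<Sum>j\<le>J. (a * 2 ^ j) powr \<theta> * min 1 (m / (a * 2 ^ j))) \<le> K * m powr \<theta>"
proof -
  \<comment> \<open>Sums of the geometric series with ratios \<open>(1 / 2) powr \<theta>\<close>
    and \<open>2 powr (\<theta> - 1)\<close>, which govern the terms with dyadic points below and
    above \<open>m\<close>. They converge for \<open>0 < \<theta>\<close> and
    \<open>\<theta> < 1\<close> respectively.\<close>
  define b c where "b = 1 / (1 - (1 / 2) powr \<theta>)" and "c = 1 / (1 - 2 powr (\<theta> - 1))"
  have "(1 / 2 :: real) powr \<theta> < 1 powr \<theta>" using \<theta> by (intro powr_less_mono2) auto
  then have b: "b > 0" "b * (1 - (1 / 2) powr \<theta>) = 1" by (auto simp: b_def)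
  have "2 powr (\<theta> - 1) < (2 :: real) powr 0" using \<theta> by (intro powr_less_mono) auto
  then have c: "c > 0" "c * (1 - 2 powr (\<theta> - 1)) = 1" by (auto simp: c_def)
  have "(\<Sum>j\<le>J. (a * 2 ^ j) powr \<theta> * min 1 (m / (a * 2 ^ j))) \<le> (b + c) * m powr \<theta>"
    if a: "0 < a" and m: "0 < m" for a m :: real and J
  proof -
    define \<phi> where "\<phi> s = b * (min (s / 2) m) powr \<theta> - c * (m * (max s m) powr (\<theta> - 1))" for s
    have step: "s powr \<theta> * min 1 (m / s) \<le> \<phi> (2 * s) - \<phi> s" if s: "s > 0" for s
    proof -
      have mono1: "(min (s / 2) m) powr \<theta> \<le> (min s m) powr \<theta>" using s m \<theta> by (intro powr_mono2) auto
      have mono2: "(max (2 * s) m) powr (\<theta> - 1) \<le> (max s m) powr (\<theta> - 1)"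
        using s m \<theta> by (intro powr_mono2') auto
      show ?thesis
      proof (cases "s \<le> m")
        case True
        have "b * (s powr \<theta> - (s / 2) powr \<theta>) = s powr \<theta> * (b * (1 - (1 / 2) powr \<theta>))"
          using s powr_mult[of s "1/2" \<theta>] by (simp add: algebra_simps)
        then have "s powr \<theta> = b * (s powr \<theta> - (s / 2) powr \<theta>)" using b by simp
        moreover have "min s m = s" "min (s / 2) m = s / 2" "min 1 (m / s) = 1" using True s by (auto simp: min_def)
        moreover have "0 \<le> c * (m * ((max s m) powr (\<theta> - 1) - (max (2 * s) m) powr (\<theta> - 1)))"
          using c m mono2 by simp
        ultimately show ?thesis by (simp add: \<phi>_def algebra_simps)
      next
        case False
        have "c * (m * (s powr (\<theta> - 1) - (2 * s) powr (\<theta> - 1))) = m * s powr (\<theta> - 1) * (c * (1 - 2 powr (\<theta> - 1)))"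
          using s by (simp add: powr_mult algebra_simps)
        also have "\<dots> = s powr \<theta> * (m / s)" using c s by (simp add: powr_diff)
        finally have "s powr \<theta> * (m / s) = c * (m * (s powr (\<theta> - 1) - (2 * s) powr (\<theta> - 1)))" ..
        moreover have "max s m = s" "max (2 * s) m = 2 * s" "min 1 (m / s) = m / s" using False s m by (auto simp: min_def max_def)
        moreover have "0 \<le> b * ((min s m) powr \<theta> - (min (s / 2) m) powr \<theta>)" using b mono1 by simp
        ultimately show ?thesis by (simp add: \<phi>_def algebra_simps)
      qed
    qed
    have "(\<Sum>j\<le>J. (a * 2 ^ j) powr \<theta> * min 1 (m / (a * 2 ^ j))) \<le> (\<Sum>j<Suc J. \<phi> (a * 2 ^ Suc j) - \<phi> (a * 2 ^ j))"
      unfolding lessThan_Suc_atMost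
    proof (intro sum_mono)
      show "(a * 2 ^ j) powr \<theta> * min 1 (m / (a * 2 ^ j)) \<le> \<phi> (a * 2 ^ Suc j) - \<phi> (a * 2 ^ j)" for j
        using step[of "a * 2 ^ j"] a by (simp add: mult.left_commute)
    qed
    also have "\<dots> = \<phi> (a * 2 ^ Suc J) - \<phi> a"
      using sum_lessThan_telescope[of "\<lambda>j. \<phi> (a * 2 ^ j)" "Suc J"] by simp
    also have "\<dots> \<le> b * m powr \<theta> + c * m powr \<theta>"
    proof -
      have "\<phi> (a * 2 ^ Suc J) \<le> b * (min (a * 2 ^ Suc J / 2) m) powr \<theta>"
        using c m by (simp add: \<phi>_def)
      also have "\<dots> \<le> b * m powr \<theta>" using b a m \<theta> by (intro mult_left_mono powr_mono2) auto
      finally have 1: "\<phi> (a * 2 ^ Suc J) \<le> b * m powr \<theta>" .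
      have "- \<phi> a \<le> c * (m * (max a m) powr (\<theta> - 1))" using b by (simp add: \<phi>_def)
      also have "\<dots> \<le> c * (m * m powr (\<theta> - 1))" using c m \<theta> by (intro mult_left_mono powr_mono2') auto
      also have "m * m powr (\<theta> - 1) = m powr \<theta>" using m by (simp add: powr_diff)
      finally show ?thesis using 1 by simp
    qed
    finally show ?thesis by (simp add: algebra_simps)
  qed
  then show thesis using that[of "b + c"] b c by simp
qed

section \<open>Trial vectors and interpolation between the exponents 0 and 1/2\<close>

locale trial_setting = a: cposdef_op D\<^sub>A A + m: posdef_op G D\<^sub>M M
  for A M :: "'a::chilbert_space \<Rightarrow> 'a" and D\<^sub>A D\<^sub>M :: "'a set" and G :: "'a ip" +
  fixes \<mu> :: "nat \<Rightarrow> real" and q :: "nat \<Rightarrow> 'a"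
  assumes comp: "compact_operator G (inv_into D\<^sub>M M)"
    and lists_q: "lists_eigenpairs_below \<infinity> G D\<^sub>M M {1..} \<mu> q"
    and incl: "continuously_included
           (power_dom G D\<^sub>M M (1/2)) (\<lambda>v. ipnorm G (op_power G D\<^sub>M M (1/2) v))
           (power_dom cinner D\<^sub>A A (1/2)) (scale_norm D\<^sub>A A (1/2))"
begin

lemmas q_lists = m.listsD[OF lists_q]

lemma \<mu>_pos: "k \<ge> 1 \<Longrightarrow> \<mu> k > 0"
  using q_lists(6)[of k] m.lower(1) by simp

text \<open>The two endpoint estimates between which \<open>heinz\<close> interpolates. The first
  expresses the equivalence of the two norms, the second the inclusion of the domains. For finite
  sums of eigenvectors both sides are explicit.\<close>

lemma finite_sum_bounds:
  obtains C where "C \<ge> 0"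
    "\<And>F c. finite F \<Longrightarrow> F \<subseteq> {1..} \<Longrightarrow> (\<Sum>k\<in>F. c k *\<^sub>C q k) \<in> a.pdom (1/2)"
    "\<And>F c. finite F \<Longrightarrow> F \<subseteq> {1..} \<Longrightarrow> (norm (\<Sum>k\<in>F. c k *\<^sub>C q k))\<^sup>2 \<le> C * (\<Sum>k\<in>F. (cmod (c k))\<^sup>2)"
    "\<And>F c. finite F \<Longrightarrow> F \<subseteq> {1..} \<Longrightarrow>
      (norm (a.pop (1/2) (\<Sum>k\<in>F. c k *\<^sub>C q k)))\<^sup>2 \<le> C * (\<Sum>k\<in>F. \<mu> k * (cmod (c k))\<^sup>2)"
proof -
  obtain c0 where c0: "c0 > 0" "\<And>v. c0 * norm v \<le> m.nrm v" using m.norm_equivalence by metis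
  obtain C1 where C1: "\<And>v. v \<in> m.pdom (1/2) \<Longrightarrow> norm (a.pop (1/2) v) \<le> C1 * m.nrm (m.pop (1/2) v)"
    and sub: "m.pdom (1/2) \<subseteq> a.pdom (1/2)"
    using incl unfolding continuously_included_def scale_norm_def by blast
  define C where "C = max ((1 / c0)\<^sup>2) (C1\<^sup>2)"
  have C: "C \<ge> 0" "(1 / c0)\<^sup>2 \<le> C" "C1\<^sup>2 \<le> C" by (auto simp: C_def le_max_iff_disj)
  show thesis
  proof (rule that[of C])
    fix F :: "nat set" and c assume F: "finite F" "F \<subseteq> {1..}"
    let ?v = "\<Sum>k\<in>F. c k *\<^sub>C q k"
    have e: "k \<in> F \<Longrightarrow> q k \<in> eigenspace D\<^sub>M M (complex_of_real (\<mu> k))" for k using q_lists(4) F(2) by auto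
    have vm: "?v \<in> m.pdom (1/2)" by (rule m.pdom_sum_eigen(1)[of F q \<mu>]) (rule e)
    then show "?v \<in> a.pdom (1/2)" using sub by blast
    have "norm ?v \<le> 1 / c0 * m.nrm ?v" using c0(2)[of ?v] c0(1) by (simp add: field_simps)
    then have "(norm ?v)\<^sup>2 \<le> (1 / c0 * m.nrm ?v)\<^sup>2" by (rule power_mono) simp
    also have "\<dots> = (1 / c0)\<^sup>2 * (\<Sum>k\<in>F. (cmod (c k))\<^sup>2)"
      unfolding power_mult_distrib m.orthonormal_sum(2)[OF q_lists(2) F] ..
    also have "\<dots> \<le> C * (\<Sum>k\<in>F. (cmod (c k))\<^sup>2)" by (intro mult_right_mono C sum_nonneg) simp
    finally show "(norm ?v)\<^sup>2 \<le> C * (\<Sum>k\<in>F. (cmod (c k))\<^sup>2)" .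
    have "(norm (a.pop (1/2) ?v))\<^sup>2 \<le> (C1 * m.nrm (m.pop (1/2) ?v))\<^sup>2"
      by (rule power_mono[OF C1[OF vm]]) simp
    also have "\<dots> = C1\<^sup>2 * (\<Sum>k\<in>F. (cmod (c k * of_real (\<mu> k powr (1/2))))\<^sup>2)"
    proof -
      have "m.pop (1/2) ?v = (\<Sum>k\<in>F. (c k * of_real (\<mu> k powr (1/2))) *\<^sub>C q k)"
        by (rule m.pdom_sum_eigen(2)[of F q \<mu>]) (rule e)
      then show ?thesis unfolding power_mult_distrib by (simp only: m.orthonormal_sum(2)[OF q_lists(2) F])
    qed
    also have "(\<Sum>k\<in>F. (cmod (c k * of_real (\<mu> k powr (1/2))))\<^sup>2) = (\<Sum>k\<in>F. \<mu> k * (cmod (c k))\<^sup>2)"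
    proof (rule sum.cong[OF refl])
      fix k assume "k \<in> F"
      then have "\<mu> k > 0" using F(2) \<mu>_pos by auto
      then have "(\<mu> k powr (1/2))\<^sup>2 = \<mu> k" by (simp add: powr_sq)
      then show "(cmod (c k * of_real (\<mu> k powr (1/2))))\<^sup>2 = \<mu> k * (cmod (c k))\<^sup>2"
        by (simp add: norm_mult power_mult_distrib)
    qed
    also have "C1\<^sup>2 * (\<Sum>k\<in>F. \<mu> k * (cmod (c k))\<^sup>2) \<le> C * (\<Sum>k\<in>F. \<mu> k * (cmod (c k))\<^sup>2)"
    proof (intro mult_right_mono C sum_nonneg mult_nonneg_nonneg)
      show "0 \<le> \<mu> k" if "k \<in> F" for k using that F(2) \<mu>_pos[of k] by auto
    qed simp
    finally show "(norm (a.pop (1/2) ?v))\<^sup>2 \<le> C * (\<Sum>k\<in>F. \<mu> k * (cmod (c k))\<^sup>2)" .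
  qed (rule C)
qed

text \<open>Comparable to the K-functional of real interpolation, the infimum of
  \<open>(norm v0)\<^sup>2 + (norm (a.pop (1/2) v1))\<^sup>2 / s\<close> over splittings
  \<open>v = v0 + v1\<close>, whose spectral weight is \<open>x / (s + x)\<close>. The outer
  \<open>max 0\<close> keeps the integrand bounded at negative \<open>x\<close>, which carry no
  mass.\<close>

definition K_functional :: "real \<Rightarrow> 'a \<Rightarrow> real" where
  "K_functional s v = (\<integral>x. max 0 (min 1 (x / s)) \<partial>a.sm v)"

text \<open>The square root of the weight exhibits \<open>K_functional s\<close> as the squared norm
  of a linear image, so the parallelogram law applies.\<close>

lemma K_functional_add_le: "K_functional s (u + v) \<le> 2 * K_functional s u + 2 * K_functional s v"
proof -
  let ?h = "\<lambda>x. sqrt (max 0 (min 1 (x / s)))"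
  have h: "?h \<in> borel_measurable borel" by measurable
  have d: "u \<in> a.cdom ?h" for u
    unfolding a.cdom_iff by (rule a.integrable_bounded_sm[of _ 1]) auto
  have eq: "K_functional s u = (norm (a.cop ?h u))\<^sup>2" for u
    using a.nrm_cop[OF h d, of u] by (simp add: K_functional_def ipnorm_cinner)
  show ?thesis
    unfolding eq a.cop_add[OF h d d] using a.nrm_sq_add_le by (simp add: ipnorm_cinner)
qed

lemma K_functional_le_norm: "K_functional s u \<le> (norm u)\<^sup>2"
proof -
  interpret finite_measure "a.sm u" by (rule a.finite_measure_sm)
  have "K_functional s u \<le> (\<integral>x. 1 \<partial>a.sm u)"
    unfolding K_functional_def by (rule integral_mono) (auto intro: a.integrable_bounded_sm[of _ 1])
  then show ?thesis by (simp add: a.measure_sm_UNIV ipnorm_cinner)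
qed

lemma K_functional_le_half:
  assumes u: "u \<in> a.pdom (1/2)" and s: "s > 0"
  shows "K_functional s u \<le> (norm (a.pop (1/2) u))\<^sup>2 / s"
proof -
  have i: "integrable (a.sm u) (\<lambda>x. x powr 1)" using a.integrable_pop[OF u] by simp
  have "K_functional s u \<le> (\<integral>x. x powr 1 / s \<partial>a.sm u)"
    unfolding K_functional_def
  proof (rule integral_mono_AE)
    show "AE x in a.sm u. max 0 (min 1 (x / s)) \<le> x powr 1 / s"
      using a.AE_lower[of u] by eventually_elim (use a.lower(1) s in \<open>auto simp: max_def\<close>)
  qed (use i in \<open>auto intro: a.integrable_bounded_sm[of _ 1]\<close>)
  then show ?thesis using a.nrm_pop_powr[OF u] by (simp add: ipnorm_cinner)
qed

text \<open>The K-method: split a sum into its parts with \<open>\<mu> k \<le> s\<close> and \<open>\<mu> k > s\<close>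
  and sum over dyadic \<open>s\<close>.\<close>

theorem heinz:
  assumes \<tau>: "0 \<le> \<tau>" "\<tau> \<le> 1/2"
  obtains K where "K \<ge> 0" "\<And>F c. finite F \<Longrightarrow> F \<subseteq> {1..} \<Longrightarrow>
    (norm (a.pop \<tau> (\<Sum>k\<in>F. c k *\<^sub>C q k)))\<^sup>2 \<le> K * (\<Sum>k\<in>F. \<mu> k powr (2 * \<tau>) * (cmod (c k))\<^sup>2)"
proof -
  obtain C where C: "C \<ge> 0"
    "\<And>F c. finite F \<Longrightarrow> F \<subseteq> {1..} \<Longrightarrow> (\<Sum>k\<in>F. c k *\<^sub>C q k) \<in> a.pdom (1/2)"
    "\<And>F c. finite F \<Longrightarrow> F \<subseteq> {1..} \<Longrightarrow> (norm (\<Sum>k\<in>F. c k *\<^sub>C q k))\<^sup>2 \<le> C * (\<Sum>k\<in>F. (cmod (c k))\<^sup>2)"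
    "\<And>F c. finite F \<Longrightarrow> F \<subseteq> {1..} \<Longrightarrow>
      (norm (a.pop (1/2) (\<Sum>k\<in>F. c k *\<^sub>C q k)))\<^sup>2 \<le> C * (\<Sum>k\<in>F. \<mu> k * (cmod (c k))\<^sup>2)"
    by (rule finite_sum_bounds) (rule that)
  \<comment> \<open>\<open>dyadic_sum_le\<close> covers only exponents strictly between 0 and 1; at
    the two ends the claim is one of the endpoint estimates.\<close>
  consider "\<tau> = 0" | "\<tau> = 1/2" | "0 < 2 * \<tau>" "2 * \<tau> < 1" using \<tau> by linarith
  then show thesis
  proof cases
    case 1
    show thesis
    proof (rule that[OF C(1)])
      fix F :: "nat set" and c assume F: "finite F" "F \<subseteq> {1..}"
      have "(\<Sum>k\<in>F. \<mu> k powr (2 * \<tau>) * (cmod (c k))\<^sup>2) = (\<Sum>k\<in>F. (cmod (c k))\<^sup>2)"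
        using F(2) \<mu>_pos by (intro sum.cong refl) (fastforce simp: 1)
      then show "(norm (a.pop \<tau> (\<Sum>k\<in>F. c k *\<^sub>C q k)))\<^sup>2 \<le> C * (\<Sum>k\<in>F. \<mu> k powr (2 * \<tau>) * (cmod (c k))\<^sup>2)"
        using C(3)[OF F] by (simp add: 1 a.pop_0)
    qed
  next
    case 2
    show thesis
    proof (rule that[OF C(1)])
      fix F :: "nat set" and c assume F: "finite F" "F \<subseteq> {1..}"
      have "(\<Sum>k\<in>F. \<mu> k powr (2 * \<tau>) * (cmod (c k))\<^sup>2) = (\<Sum>k\<in>F. \<mu> k * (cmod (c k))\<^sup>2)"
        using F(2) \<mu>_pos by (intro sum.cong refl) (fastforce simp: 2)
      then show "(norm (a.pop \<tau> (\<Sum>k\<in>F. c k *\<^sub>C q k)))\<^sup>2 \<le> C * (\<Sum>k\<in>F. \<mu> k powr (2 * \<tau>) * (cmod (c k))\<^sup>2)"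
        using C(4)[OF F] by (simp only: 2)
    qed
  next
    case 3
    define \<theta> where "\<theta> = 2 * \<tau>"
    obtain K where K: "K \<ge> 0" "\<And>a m J. 0 < a \<Longrightarrow> 0 < m \<Longrightarrow>
      (\<Sum>j\<le>J. (a * 2 ^ j) powr \<theta> * min 1 (m / (a * 2 ^ j))) \<le> K * m powr \<theta>"
      by (rule dyadic_sum_le[of \<theta>]) (use 3 in \<open>auto simp: \<theta>_def\<close>)
    show thesis
    \<comment> \<open>One factor 2 stems from splitting the sum, the other from
      \<open>min_powr_le_dyadic_sum\<close>; \<open>C\<close> is the endpoint constant and
      \<open>K\<close> that of the dyadic sums.\<close>
    proof (rule that[of "4 * C * K"])
      show "0 \<le> 4 * C * K" using C K by simp
      fix F :: "nat set" and c assume F: "finite F" "F \<subseteq> {1..}"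
      let ?v = "\<Sum>k\<in>F. c k *\<^sub>C q k"
      have pos: "\<mu> k > 0" if "k \<in> F" for k using that F(2) \<mu>_pos by auto
      have Kle: "K_functional s ?v \<le> 2 * C * (\<Sum>k\<in>F. min 1 (\<mu> k / s) * (cmod (c k))\<^sup>2)" if s: "s > 0" for s
      proof -
        let ?Fhi = "{k \<in> F. s < \<mu> k}" and ?Flo = "{k \<in> F. \<mu> k \<le> s}"
        have fin: "finite ?Fhi" "finite ?Flo" "?Fhi \<subseteq> {1..}" "?Flo \<subseteq> {1..}" using F by auto
        have un: "?Fhi \<union> ?Flo = F" "?Fhi \<inter> ?Flo = {}" by auto
        let ?vhi = "\<Sum>k\<in>?Fhi. c k *\<^sub>C q k" and ?vlo = "\<Sum>k\<in>?Flo. c k *\<^sub>C q k"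
        have v: "?v = ?vhi + ?vlo" using sum.union_disjoint[OF fin(1,2) un(2), of "\<lambda>k. c k *\<^sub>C q k"] unfolding un(1) .
        have "K_functional s ?vhi \<le> C * (\<Sum>k\<in>?Fhi. (cmod (c k))\<^sup>2)"
          by (rule order_trans[OF K_functional_le_norm C(3)[OF fin(1,3)]])
        also have "(\<Sum>k\<in>?Fhi. (cmod (c k))\<^sup>2) = (\<Sum>k\<in>?Fhi. min 1 (\<mu> k / s) * (cmod (c k))\<^sup>2)"
          using s by (intro sum.cong) (auto simp: min_def)
        finally have 0: "K_functional s ?vhi \<le> C * (\<Sum>k\<in>?Fhi. min 1 (\<mu> k / s) * (cmod (c k))\<^sup>2)" .
        have "K_functional s ?vlo \<le> (norm (a.pop (1/2) ?vlo))\<^sup>2 / s"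
          by (rule K_functional_le_half[OF C(2)[OF fin(2,4)] s])
        also have "\<dots> \<le> C * (\<Sum>k\<in>?Flo. \<mu> k * (cmod (c k))\<^sup>2) / s"
          using s by (intro divide_right_mono C(4)[OF fin(2,4)]) simp
        also have "\<dots> = C * (\<Sum>k\<in>?Flo. \<mu> k / s * (cmod (c k))\<^sup>2)"
          by (simp add: sum_divide_distrib[symmetric])
        also have "(\<Sum>k\<in>?Flo. \<mu> k / s * (cmod (c k))\<^sup>2) = (\<Sum>k\<in>?Flo. min 1 (\<mu> k / s) * (cmod (c k))\<^sup>2)"
          using s by (intro sum.cong) (auto simp: min_def)
        finally have 1: "K_functional s ?vlo \<le> C * (\<Sum>k\<in>?Flo. min 1 (\<mu> k / s) * (cmod (c k))\<^sup>2)" .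
        have "K_functional s ?v \<le> 2 * K_functional s ?vhi + 2 * K_functional s ?vlo" unfolding v by (rule K_functional_add_le)
        also have "\<dots> \<le> 2 * (C * (\<Sum>k\<in>?Fhi. min 1 (\<mu> k / s) * (cmod (c k))\<^sup>2)) + 2 * (C * (\<Sum>k\<in>?Flo. min 1 (\<mu> k / s) * (cmod (c k))\<^sup>2))"
          using 0 1 by linarith
        also have "\<dots> = 2 * C * (\<Sum>k\<in>?Fhi \<union> ?Flo. min 1 (\<mu> k / s) * (cmod (c k))\<^sup>2)"
          unfolding sum.union_disjoint[OF fin(1,2) un(2)] by (simp add: distrib_left)
        finally show ?thesis unfolding un(1) .
      qed
      define s where "s j = a.lower * 2 ^ j" for j :: nat
      have s: "s j > 0" for j using a.lower(1) by (simp add: s_def)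
      have dom: "?v \<in> a.pdom \<tau>" by (rule a.pdom_mono[OF \<tau>(2) C(2)[OF F]])
      have trunc: "(\<integral>x. (min x (s J)) powr \<theta> \<partial>a.sm ?v) \<le> 4 * C * K * (\<Sum>k\<in>F. \<mu> k powr \<theta> * (cmod (c k))\<^sup>2)" for J
      proof -
        have i: "integrable (a.sm ?v) (\<lambda>x. max 0 (min 1 (x / s j)))" for j
          by (rule a.integrable_bounded_sm[of _ 1]) auto
        have "(\<integral>x. (min x (s J)) powr \<theta> \<partial>a.sm ?v) \<le> (\<integral>x. 2 * (\<Sum>j\<le>J. s j powr \<theta> * max 0 (min 1 (x / s j))) \<partial>a.sm ?v)"
        proof (rule integral_mono_AE)
          interpret finite_measure "a.sm ?v" by (rule a.finite_measure_sm)
          show "integrable (a.sm ?v) (\<lambda>x. (min x (s J)) powr \<theta>)"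
          proof (rule integrable_const_bound[of _ "s J powr \<theta>"])
            show "AE x in a.sm ?v. norm ((min x (s J)) powr \<theta>) \<le> s J powr \<theta>"
              using a.AE_lower[of ?v]
              by eventually_elim (use a.lower(1) s[of J] 3 in \<open>auto simp: \<theta>_def intro!: powr_mono2\<close>)
          qed simp
          show "integrable (a.sm ?v) (\<lambda>x. 2 * (\<Sum>j\<le>J. s j powr \<theta> * max 0 (min 1 (x / s j))))"
            using i by simp
          show "AE x in a.sm ?v. (min x (s J)) powr \<theta> \<le> 2 * (\<Sum>j\<le>J. s j powr \<theta> * max 0 (min 1 (x / s j)))"
            using a.AE_lower[of ?v]
          proof eventually_elim
            case (elim x)
            have "max 0 (min 1 (x / s j)) = min 1 (x / s j)" for j
              using elim a.lower(1) s[of j] by (intro max_absorb2) simp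
            then show ?case
              using min_powr_le_dyadic_sum[OF a.lower(1) elim, of \<theta> J] 3 by (simp add: s_def \<theta>_def)
          qed
        qed
        also have "\<dots> = 2 * (\<Sum>j\<le>J. s j powr \<theta> * K_functional (s j) ?v)"
          using i by (simp add: K_functional_def)
        also have "\<dots> \<le> 2 * (\<Sum>j\<le>J. s j powr \<theta> * (2 * C * (\<Sum>k\<in>F. min 1 (\<mu> k / s j) * (cmod (c k))\<^sup>2)))"
          by (intro mult_left_mono sum_mono Kle s) auto
        also have "\<dots> = 4 * C * (\<Sum>k\<in>F. (\<Sum>j\<le>J. s j powr \<theta> * min 1 (\<mu> k / s j)) * (cmod (c k))\<^sup>2)"
          unfolding sum_distrib_left sum_distrib_right by (subst sum.swap) (simp add: ac_simps)
        also have "\<dots> \<le> 4 * C * (\<Sum>k\<in>F. (K * \<mu> k powr \<theta>) * (cmod (c k))\<^sup>2)"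
          unfolding s_def using C(1)
          by (intro mult_left_mono sum_mono mult_right_mono K(2) a.lower(1) pos) auto
        also have "\<dots> = 4 * C * K * (\<Sum>k\<in>F. \<mu> k powr \<theta> * (cmod (c k))\<^sup>2)"
          by (simp add: sum_distrib_left ac_simps)
        finally show ?thesis .
      qed
      have "(\<lambda>J. \<integral>x. (min x (s J)) powr \<theta> \<partial>a.sm ?v) \<longlonglongrightarrow> (\<integral>x. x powr \<theta> \<partial>a.sm ?v)"
      proof (rule integral_dominated_convergence[where w = "\<lambda>x. x powr \<theta>"])
        show "integrable (a.sm ?v) (\<lambda>x. x powr \<theta>)" using a.integrable_pop[OF dom] by (simp add: \<theta>_def)
        show "AE x in a.sm ?v. (\<lambda>J. (min x (s J)) powr \<theta>) \<longlonglongrightarrow> x powr \<theta>"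
        proof (intro AE_I2)
          fix x
          have "filterlim (\<lambda>J. a.lower * 2 ^ J) at_top sequentially"
          proof (rule filterlim_tendsto_pos_mult_at_top[OF tendsto_const a.lower(1)])
            show "filterlim (\<lambda>J::nat. (2::real) ^ J) at_top sequentially" by real_asymp
          qed
          then have "\<forall>\<^sub>F J in sequentially. x \<le> s J" unfolding s_def by (simp add: filterlim_at_top)
          then have "\<forall>\<^sub>F J in sequentially. (min x (s J)) powr \<theta> = x powr \<theta>" by eventually_elim simp
          then show "(\<lambda>J. (min x (s J)) powr \<theta>) \<longlonglongrightarrow> x powr \<theta>" by (rule tendsto_eventually)
        qed
        show "AE x in a.sm ?v. norm ((min x (s J)) powr \<theta>) \<le> x powr \<theta>" for J
          using a.AE_lower[of ?v]
          by eventually_elim (use a.lower(1) s[of J] 3 in \<open>auto simp: \<theta>_def intro!: powr_mono2\<close>)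
      qed auto
      then have "(\<integral>x. x powr \<theta> \<partial>a.sm ?v) \<le> 4 * C * K * (\<Sum>k\<in>F. \<mu> k powr \<theta> * (cmod (c k))\<^sup>2)"
        by (rule LIMSEQ_le_const2) (use trunc in blast)
      then show "(norm (a.pop \<tau> ?v))\<^sup>2 \<le> 4 * C * K * (\<Sum>k\<in>F. \<mu> k powr (2 * \<tau>) * (cmod (c k))\<^sup>2)"
        using a.nrm_pop_powr[OF dom] by (simp add: \<theta>_def ipnorm_cinner)
    qed
  qed
qed

end

section \<open>Rayleigh--Ritz approximation\<close>

text \<open>Elimination with pivot \<open>p\<close>; \<open>m'\<close> is the reduced matrix. Both
  minimax bounds use it to find, among combinations of \<open>j\<close> vectors, a nontrivial one
  that satisfies \<open>j - 1\<close> orthogonality conditions.\<close>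

lemma homogeneous_system_nontrivial:
  fixes m :: "'k \<Rightarrow> 'i \<Rightarrow> 'f::field"
  assumes "finite J" "finite I" "card J < card I"
  obtains x where "\<exists>i\<in>I. x i \<noteq> 0" "\<And>k. k \<in> J \<Longrightarrow> (\<Sum>i\<in>I. m k i * x i) = 0"
proof -
  have "\<exists>x. (\<exists>i\<in>I. x i \<noteq> 0) \<and> (\<forall>k\<in>J. (\<Sum>i\<in>I. m k i * x i) = 0)"
    using assms
  proof (induction J arbitrary: I m rule: finite_induct)
    case empty
    then have "I \<noteq> {}" by auto
    then show ?case by (intro exI[of _ "\<lambda>i. 1"]) auto
  next
    case (insert k J)
    show ?case
    proof (cases "\<forall>i\<in>I. m k i = 0")
      case True
      have "card J < card I" using insert by simp
      then obtain x where "\<exists>i\<in>I. x i \<noteq> 0" "\<forall>k\<in>J. (\<Sum>i\<in>I. m k i * x i) = 0"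
        using insert.IH[of I m] insert.prems by blast
      then show ?thesis using True by (intro exI[of _ x]) simp
    next
      case False
      then obtain p where p: "p \<in> I" "m k p \<noteq> 0" by blast
      let ?I = "I - {p}"
      define m' where "m' r i = m r i - m r p * m k i / m k p" for r i
      have "card J < card ?I" "finite ?I" using insert p(1) by (simp_all add: card_Diff_singleton)
      then obtain x where x: "\<exists>i\<in>?I. x i \<noteq> 0" "\<forall>r\<in>J. (\<Sum>i\<in>?I. m' r i * x i) = 0"
        using insert.IH[of ?I m'] by blast
      define y where "y i = (if i = p then - (\<Sum>i\<in>?I. m k i * x i) / m k p else x i)" for i
      have split: "(\<Sum>i\<in>I. m r i * y i) = m r p * y p + (\<Sum>i\<in>?I. m r i * x i)" for r
        using insert.prems(1) p(1) by (subst sum.remove[of _ p]) (auto simp: y_def intro!: sum.cong)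
      have "(\<Sum>i\<in>I. m k i * y i) = 0" unfolding split using p(2) by (simp add: y_def)
      moreover have "(\<Sum>i\<in>I. m r i * y i) = 0" if r: "r \<in> J" for r
      proof -
        have "(\<Sum>i\<in>?I. m' r i * x i) = (\<Sum>i\<in>?I. m r i * x i) - m r p / m k p * (\<Sum>i\<in>?I. m k i * x i)"
          unfolding sum_distrib_left sum_subtractf[symmetric] by (intro sum.cong refl) (simp add: m'_def field_simps)
        then show ?thesis unfolding split using x(2) r by (simp add: y_def)
      qed
      moreover have "\<exists>i\<in>I. y i \<noteq> 0" using x(1) by (auto simp: y_def)
      ultimately show ?thesis by (intro exI[of _ y]) auto
    qed
  qed
  then show thesis using that by blast
qed

section \<open>Semicontinuity of graph norms and Rayleigh quotients\<close>

context pvm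
begin

text \<open>Lower semicontinuity. The \<open>X m\<close> converge only in the original space, so the
  bound is tested against vectors of the dense domain, onto which the operator is moved by symmetry.
  Eigenvector expansions converge in just this sense.\<close>

lemma nrm_cop_le_limit:
  assumes f: "f \<in> borel_measurable borel" and X: "\<And>m::nat. X m \<in> cdom f" "X \<longlonglongrightarrow> x" and x: "x \<in> cdom f"
    and B: "\<And>m. nrm (cop f (X m)) \<le> B"
  shows "nrm (cop f x) \<le> B"
proof -
  let ?y = "cop f x"
  have B0: "B \<ge> 0" using order_trans[OF nrm_nonneg B] .
  obtain S where S: "\<And>n::nat. S n \<in> sets borel" "\<And>n u. E (S n) u \<in> cdom f" "\<And>u. (\<lambda>n. E (S n) u) \<longlonglongrightarrow> u"
    using cdom_dense_seq[OF f] by blast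
  have "cmod (ip ?y (E (S n) ?y)) \<le> B * nrm ?y" for n
  proof -
    let ?v = "E (S n) ?y"
    have v: "?v \<in> cdom f" by (rule S(2))
    have "(\<lambda>m. ip (X m) (cop f ?v)) \<longlonglongrightarrow> ip x (cop f ?v)" by (intro ip.tendsto tendsto_const X)
    then have "(\<lambda>m. cmod (ip (cop f (X m)) ?v)) \<longlonglongrightarrow> cmod (ip ?y ?v)"
      unfolding cop_sym[OF f X(1) v] cop_sym[OF f x v] by (rule tendsto_norm)
    then show ?thesis
    proof (rule LIMSEQ_le_const2, intro exI allI impI)
      fix m
      have "cmod (ip (cop f (X m)) ?v) \<le> nrm (cop f (X m)) * nrm ?v" by (rule Cauchy_Schwarz)
      also have "\<dots> \<le> B * nrm ?y" by (intro mult_mono B nrm_E_le S(1) B0 nrm_nonneg)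
      finally show "cmod (ip (cop f (X m)) ?v) \<le> B * nrm ?y" .
    qed
  qed
  moreover have "(\<lambda>n. cmod (ip ?y (E (S n) ?y))) \<longlonglongrightarrow> cmod (ip ?y ?y)"
    by (intro tendsto_norm ip.tendsto tendsto_const S(3))
  ultimately have "cmod (ip ?y ?y) \<le> B * nrm ?y" by (intro LIMSEQ_le_const2[of _ _ "B * nrm ?y"]) auto
  then have "nrm ?y * nrm ?y \<le> B * nrm ?y"
    unfolding ip_self norm_of_real by (simp add: power2_eq_square)
  then show ?thesis
    using B0 nrm_nonneg[of ?y] by (cases "nrm ?y = 0") auto
qed

end

context posdef_op
begin

lemma pop_lincomb:
  assumes "\<And>i. i \<in> J \<Longrightarrow> v i \<in> pdom s"
  shows "(\<Sum>i\<in>J. y i *\<^sub>C v i) \<in> pdom s"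
    and "pop s (\<Sum>i\<in>J. y i *\<^sub>C v i) = (\<Sum>i\<in>J. y i *\<^sub>C pop s (v i))"
proof -
  show "(\<Sum>i\<in>J. y i *\<^sub>C v i) \<in> pdom s"
    by (intro csubspace_sum csubspace_scaleC pdom_sub assms)
  have "pop s (\<Sum>i\<in>J. y i *\<^sub>C v i) = (\<Sum>i\<in>J. pop s (y i *\<^sub>C v i))"
    by (intro pop_sum csubspace_scaleC pdom_sub assms)
  also have "\<dots> = (\<Sum>i\<in>J. y i *\<^sub>C pop s (v i))" by (intro sum.cong refl pop_scaleC assms)
  finally show "pop s (\<Sum>i\<in>J. y i *\<^sub>C v i) = (\<Sum>i\<in>J. y i *\<^sub>C pop s (v i))" .
qed

text \<open>The quotient of the two squared norms is the mean of \<open>x\<close> with respect to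
  the scalar measure with density \<open>x powr (2 * \<tau> - 1)\<close>.\<close>

lemma pop_low_le:
  assumes u: "u \<in> pdom \<tau>" and \<tau>: "\<tau> \<le> 1/2" and AE: "AE x in sm u. c \<le> x"
  shows "c * (nrm (pop (\<tau> - 1/2) u))\<^sup>2 \<le> (nrm (pop \<tau> u))\<^sup>2"
proof -
  have u': "u \<in> pdom (\<tau> - 1/2)" using \<tau> by (intro pdom_nonpos) simp
  have "(\<integral>x. c * x powr (2 * (\<tau> - 1/2)) \<partial>sm u) \<le> (\<integral>x. x powr (2 * \<tau>) \<partial>sm u)"
  proof (rule integral_mono_AE)
    show "AE x in sm u. c * x powr (2 * (\<tau> - 1/2)) \<le> x powr (2 * \<tau>)"
      using AE AE_lower[of u]
    proof eventually_elim
      case (elim x)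
      then have x: "x > 0" using lower(1) by simp
      have "c * x powr (2 * (\<tau> - 1/2)) \<le> x * x powr (2 * (\<tau> - 1/2))"
        by (rule mult_right_mono[OF elim(1)]) simp
      also have "\<dots> = x powr (2 * \<tau>)" using x by (simp add: powr_diff)
      finally show ?case .
    qed
  qed (use integrable_pop[OF u] integrable_pop[OF u'] in auto)
  then show ?thesis by (simp add: nrm_pop_powr[OF u] nrm_pop_powr[OF u'])
qed

end

section \<open>Ritz vectors and the Ritz projection\<close>

lemma sum_cmod_sq_pos:
  assumes "finite I" "\<exists>i\<in>I. x i \<noteq> 0"
  shows "0 < (\<Sum>i\<in>I. (cmod (x i))\<^sup>2)"
proof -
  obtain i where "i \<in> I" "x i \<noteq> 0" using assms(2) by blast
  then show ?thesis by (intro sum_pos2[OF assms(1), of i]) auto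
qed

lemma norm_sum_sq_orthogonal:
  fixes w :: "'i \<Rightarrow> 'a::chilbert_space"
  assumes "finite I" and o: "\<And>i j. i \<in> I \<Longrightarrow> j \<in> I \<Longrightarrow> cinner (w i) (w j) = (if i = j then complex_of_real (d i) else 0)"
  shows "(norm (\<Sum>i\<in>I. x i *\<^sub>C w i))\<^sup>2 = (\<Sum>i\<in>I. d i * (cmod (x i))\<^sup>2)"
proof -
  interpret hilbert_ip cinner by unfold_locales (rule equivalent_ip_cinner)
  have "cinner (w j) (\<Sum>i\<in>I. x i *\<^sub>C w i) = of_real (d j) * x j" if j: "j \<in> I" for j
  proof -
    have "cinner (w j) (\<Sum>i\<in>I. x i *\<^sub>C w i) = (\<Sum>i\<in>I. if j = i then of_real (d j) * x i else 0)"
      unfolding ip.sum_right ip_scaleC_right using o[OF j] by (intro sum.cong) auto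
    then show ?thesis using j assms(1) by simp
  qed
  then have "cinner (\<Sum>i\<in>I. x i *\<^sub>C w i) (\<Sum>i\<in>I. x i *\<^sub>C w i) = (\<Sum>j\<in>I. cnj (x j) * (of_real (d j) * x j))"
    by (subst ip.sum_left) (simp add: ip_scaleC_left del: ip.sum_right)
  also have "\<dots> = of_real (\<Sum>i\<in>I. d i * (cmod (x i))\<^sup>2)"
    unfolding of_real_sum of_real_mult
    by (intro sum.cong refl) (metis complex_norm_square mult.commute mult.left_commute of_real_power)
  finally show ?thesis using nrm_sq[of "\<Sum>i\<in>I. x i *\<^sub>C w i"] by (simp add: ipnorm_cinner)
qed

text \<open>Of the Ritz pairs only order, domain and the two diagonalized forms are kept. The trial
  vectors themselves return in \<open>trial_span\<close>.\<close>

locale ritz_approx = cposdef_op D A for D :: "'a::chilbert_space set" and A +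
  fixes \<tau> :: real and n :: nat and L :: "nat \<Rightarrow> real" and U :: "nat \<Rightarrow> 'a"
  assumes \<tau>: "0 \<le> \<tau>" "\<tau> \<le> 1/2"
    and U_dom: "i \<in> {1..n} \<Longrightarrow> U i \<in> pdom \<tau>"
    and L_mono: "mono_on {1..n} L"
    and U_mass: "i \<in> {1..n} \<Longrightarrow> j \<in> {1..n} \<Longrightarrow> scale_ip D A (\<tau> - 1/2) (U i) (U j) = (if i = j then 1 else 0)"
    and U_energy: "i \<in> {1..n} \<Longrightarrow> j \<in> {1..n} \<Longrightarrow> scale_ip D A \<tau> (U i) (U j) = (if i = j then complex_of_real (L i) else 0)"
begin

text \<open>\<open>P\<close> carries the energy and \<open>R\<close> the mass: the Rayleigh quotient
  of \<open>v\<close> is \<open>(norm (P v))\<^sup>2 / (norm (R v))\<^sup>2\<close>. The exponents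
  differ by 1/2, so on eigenvectors it is the eigenvalue.\<close>

abbreviation "P \<equiv> pop \<tau>"
abbreviation "R \<equiv> pop (\<tau> - 1/2)"

lemma R_dom [simp]: "u \<in> pdom (\<tau> - 1/2)"
  using \<tau> by (intro pdom_nonpos) simp

lemmas P_sub = pdom_sub[of \<tau>]

lemma U_mass': "i \<in> {1..n} \<Longrightarrow> j \<in> {1..n} \<Longrightarrow> cinner (R (U i)) (R (U j)) = (if i = j then complex_of_real 1 else 0)"
  using U_mass[of i j] by (simp add: scale_ip_def)

lemma U_energy': "i \<in> {1..n} \<Longrightarrow> j \<in> {1..n} \<Longrightarrow> cinner (P (U i)) (P (U j)) = (if i = j then complex_of_real (L i) else 0)"
  using U_energy[of i j] by (simp add: scale_ip_def)

lemma lin_comb: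
  assumes "I \<subseteq> {1..n}"
  shows "(\<Sum>i\<in>I. x i *\<^sub>C U i) \<in> pdom \<tau>"
    and "P (\<Sum>i\<in>I. x i *\<^sub>C U i) = (\<Sum>i\<in>I. x i *\<^sub>C P (U i))"
    and "R (\<Sum>i\<in>I. x i *\<^sub>C U i) = (\<Sum>i\<in>I. x i *\<^sub>C R (U i))"
proof -
  have d: "i \<in> I \<Longrightarrow> U i \<in> pdom \<tau>" for i using assms U_dom by blast
  show "(\<Sum>i\<in>I. x i *\<^sub>C U i) \<in> pdom \<tau>" by (rule pop_lincomb(1)[OF d])
  show "P (\<Sum>i\<in>I. x i *\<^sub>C U i) = (\<Sum>i\<in>I. x i *\<^sub>C P (U i))" by (rule pop_lincomb(2)[OF d])
  show "R (\<Sum>i\<in>I. x i *\<^sub>C U i) = (\<Sum>i\<in>I. x i *\<^sub>C R (U i))" by (rule pop_lincomb(2)[OF R_dom])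
qed

lemma norm_R_comb:
  assumes "I \<subseteq> {1..n}"
  shows "(norm (R (\<Sum>i\<in>I. x i *\<^sub>C U i)))\<^sup>2 = (\<Sum>i\<in>I. (cmod (x i))\<^sup>2)"
proof -
  have "finite I" using assms finite_subset by blast
  have "(norm (\<Sum>i\<in>I. x i *\<^sub>C R (U i)))\<^sup>2 = (\<Sum>i\<in>I. 1 * (cmod (x i))\<^sup>2)"
    by (rule norm_sum_sq_orthogonal[OF \<open>finite I\<close>]) (intro U_mass'; use assms in blast)
  then show ?thesis unfolding lin_comb(3)[OF assms] by simp
qed

lemma norm_P_comb:
  assumes "I \<subseteq> {1..n}"
  shows "(norm (P (\<Sum>i\<in>I. x i *\<^sub>C U i)))\<^sup>2 = (\<Sum>i\<in>I. L i * (cmod (x i))\<^sup>2)"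
proof -
  have "finite I" using assms finite_subset by blast
  then show ?thesis
    unfolding lin_comb(2)[OF assms]
    by (rule norm_sum_sq_orthogonal) (intro U_energy'; use assms in blast)
qed

lemma norm_R_le: "v \<in> pdom \<tau> \<Longrightarrow> lower * (norm (R v))\<^sup>2 \<le> (norm (P v))\<^sup>2"
  using pop_low_le[OF _ \<tau>(2) AE_lower, of v] by (simp add: ipnorm_cinner)

lemma norm_P_U: "i \<in> {1..n} \<Longrightarrow> (norm (P (U i)))\<^sup>2 = L i"
  using norm_P_comb[of "{i}" "\<lambda>_. 1"] by simp

lemma norm_R_U: "i \<in> {1..n} \<Longrightarrow> norm (R (U i)) = 1"
  using norm_R_comb[of "{i}" "\<lambda>_. 1"] by (intro power2_eq_imp_eq[of _ 1]) simp_all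

lemma L_pos: assumes "i \<in> {1..n}" shows "L i > 0"
  using norm_R_le[OF U_dom[OF assms]] norm_R_U[OF assms] norm_P_U[OF assms] lower(1) by simp

text \<open>The energy-orthogonal projection onto the span of the \<open>U k\<close>, which are
  energy-orthogonal with squared energy norm \<open>L k\<close>.\<close>

definition ritz_proj :: "'a \<Rightarrow> 'a" where
  "ritz_proj u = (\<Sum>k=1..n. (cinner (P (U k)) (P u) / complex_of_real (L k)) *\<^sub>C U k)"

lemma ritz_proj_dom: "ritz_proj u \<in> pdom \<tau>"
  unfolding ritz_proj_def by (rule lin_comb(1)) simp

lemma ritz_proj_orthogonal:
  assumes u: "u \<in> pdom \<tau>" and j: "j \<in> {1..n}"
  shows "cinner (P (U j)) (P (u - ritz_proj u)) = 0"
proof -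
  have "cinner (P (U j)) (P (ritz_proj u))
      = (\<Sum>k=1..n. cinner (P (U k)) (P u) / complex_of_real (L k) * cinner (P (U j)) (P (U k)))"
    unfolding ritz_proj_def lin_comb(2)[OF order_refl] by (simp add: ip.sum_right ip_scaleC_right)
  also have "\<dots> = (\<Sum>k=1..n. if j = k then cinner (P (U j)) (P u) else 0)"
    using j L_pos[OF j] by (intro sum.cong) (auto simp: U_energy')
  also have "\<dots> = cinner (P (U j)) (P u)" using j by simp
  finally show ?thesis by (simp add: pop_diff[OF u ritz_proj_dom] ip_diff_right)
qed

lemma ritz_proj_orthogonal_comb:
  assumes u: "u \<in> pdom \<tau>" and I: "I \<subseteq> {1..n}"
  shows "cinner (P (\<Sum>i\<in>I. x i *\<^sub>C U i)) (P (u - ritz_proj u)) = 0"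
  unfolding lin_comb(2)[OF I] ip.sum_left ip_scaleC_left
  using ritz_proj_orthogonal[OF u] I by (intro sum.neutral) auto

lemma ritz_proj_best:
  assumes u: "u \<in> pdom \<tau>"
  shows "norm (P (u - ritz_proj u)) \<le> norm (P (u - (\<Sum>i=1..n. y i *\<^sub>C U i)))"
proof (rule power2_le_imp_le)
  let ?p = "\<Sum>i=1..n. y i *\<^sub>C U i"
  let ?z = "\<lambda>k. cinner (P (U k)) (P u) / complex_of_real (L k) - y k"
  have z: "ritz_proj u - ?p = (\<Sum>k=1..n. ?z k *\<^sub>C U k)"
    unfolding ritz_proj_def sum_subtractf[symmetric] by (simp add: complex_vector.scale_left_diff_distrib)
  have d: "u - ritz_proj u \<in> pdom \<tau>" "ritz_proj u - ?p \<in> pdom \<tau>"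
    by (intro csubspace_diff P_sub u ritz_proj_dom lin_comb(1) order_refl)+
  have "u - ?p = (u - ritz_proj u) + (ritz_proj u - ?p)" by simp
  then have "P (u - ?p) = P (u - ritz_proj u) + P (ritz_proj u - ?p)" using pop_add[OF d] by simp
  moreover have "cinner (P (ritz_proj u - ?p)) (P (u - ritz_proj u)) = 0"
    unfolding z by (rule ritz_proj_orthogonal_comb[OF u]) simp
  ultimately have "(norm (P (u - ?p)))\<^sup>2 = (norm (P (u - ritz_proj u)))\<^sup>2 + (norm (P (ritz_proj u - ?p)))\<^sup>2"
    using nrm_sq_add[of "P (u - ritz_proj u)" "P (ritz_proj u - ?p)"]
    by (simp add: ipnorm_cinner Re_ip_commute[of "P (u - ritz_proj u)"])
  then show "(norm (P (u - ritz_proj u)))\<^sup>2 \<le> (norm (P (u - ?p)))\<^sup>2" by simp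
qed simp

lemma ritz_proj_comb:
  assumes "\<And>i. i \<in> J \<Longrightarrow> u i \<in> pdom \<tau>"
  shows "(\<Sum>i\<in>J. x i *\<^sub>C ritz_proj (u i))
    = (\<Sum>k=1..n. ((\<Sum>i\<in>J. cinner (P (U k)) (P (u i)) * x i) / complex_of_real (L k)) *\<^sub>C U k)"
  unfolding ritz_proj_def complex_vector.scale_sum_right
  by (subst sum.swap) (simp add: complex_vector.scale_sum_left[symmetric] sum_divide_distrib mult.commute)

context
  fixes w r assumes w: "w \<in> eigenspace D A (complex_of_real r)" and r: "r > 0"
begin

lemma energy_eigenvector: "v \<in> pdom \<tau> \<Longrightarrow> cinner (P w) (P v) = of_real (r powr (2 * \<tau>)) * cinner w v"
  by (simp add: eigenvector_pop(2)[OF w] ip_scaleR ip_eigenvector_pop[OF w] mult.assoc[symmetric]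
      powr_add[symmetric] of_real_mult[symmetric] del: of_real_mult)

lemma mass_eigenvector: "cinner (R w) (R v) = of_real (r powr (2 * \<tau> - 1)) * cinner w v"
proof -
  have "cinner (R w) (R v) = of_real (r powr (\<tau> - 1/2) * r powr (\<tau> - 1/2)) * cinner w v"
    by (simp add: eigenvector_pop(2)[OF w] ip_scaleR ip_eigenvector_pop[OF w])
  also have "r powr (\<tau> - 1/2) * r powr (\<tau> - 1/2) = r powr (2 * \<tau> - 1)" by (simp add: powr_add[symmetric])
  finally show ?thesis .
qed

lemma energy_eq_mass: "v \<in> pdom \<tau> \<Longrightarrow> cinner (P w) (P v) = of_real r * cinner (R w) (R v)"
  using r by (simp add: energy_eigenvector mass_eigenvector powr_diff)

lemma norm_P_eigenvector: "norm (P w) = sqrt r * norm (R w)"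
proof -
  have "r powr \<tau> = sqrt r * r powr (\<tau> - 1/2)" using r by (simp add: powr_diff powr_half_sqrt)
  then show ?thesis using r by (simp add: eigenvector_pop(2)[OF w])
qed

text \<open>Galerkin orthogonality: the error \<open>w - ritz_proj w\<close> has no energy product with \<open>U j\<close>.\<close>

lemma ritz_coefficient:
  assumes j: "j \<in> {1..n}"
  shows "of_real (L j - r) * cinner (R w) (R (U j)) = of_real (L j) * cinner (R (w - ritz_proj w)) (R (U j))"
proof -
  have wd: "w \<in> pdom \<tau>" by (rule eigenvector_pop(1)[OF w])
  let ?y = "\<lambda>k. cinner (P (U k)) (P w) / complex_of_real (L k)"
  have y: "cinner (R (ritz_proj w)) (R (U j)) = cnj (?y j)"
  proof -
    have "cinner (R (ritz_proj w)) (R (U j)) = (\<Sum>k=1..n. cnj (?y k) * cinner (R (U k)) (R (U j)))"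
      unfolding ritz_proj_def lin_comb(3)[OF order_refl] by (simp add: ip.sum_left ip_scaleC_left)
    also have "\<dots> = (\<Sum>k=1..n. if k = j then cnj (?y k) else 0)"
      using j by (intro sum.cong) (auto simp: U_mass')
    finally show ?thesis using j by simp
  qed
  have "of_real (L j) * cinner (R (ritz_proj w)) (R (U j)) = cinner (P w) (P (U j))"
    unfolding y using L_pos[OF j] ip_commute[of "P w" "P (U j)"] by simp
  also have "\<dots> = of_real r * cinner (R w) (R (U j))" by (rule energy_eq_mass[OF U_dom[OF j]])
  finally have "of_real (L j) * cinner (R (ritz_proj w)) (R (U j)) = of_real r * cinner (R w) (R (U j))" .
  then show ?thesis by (simp add: pop_diff ip_diff_left algebra_simps)
qed

end

section \<open>Bounds for the Ritz values from below and above\<close>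

context
  fixes I lam u
  assumes l: "lists_eigenpairs_below (ess_inf D A) cinner D A I lam u" and I1: "0 \<notin> I"
    and I_down: "\<And>i j. j \<in> I \<Longrightarrow> 1 \<le> i \<Longrightarrow> i \<le> j \<Longrightarrow> i \<in> I"
begin

lemma lam_lower: "i \<in> I \<Longrightarrow> lower \<le> lam i"
  by (rule listsD(6)[OF l])

lemma lam_pos: "i \<in> I \<Longrightarrow> lam i > 0"
  using lam_lower[of i] lower(1) by linarith

lemma lam_less_imp: "i \<in> I \<Longrightarrow> j \<in> I \<Longrightarrow> lam i < lam j \<Longrightarrow> i \<in> {1..<j}"
  using listsD(1)[OF l] I1 by (metis atLeastLessThan_iff less_one linorder_not_less mono_on_def not_le)

text \<open>A nonzero combination of the first \<open>j\<close> Ritz vectors can be made orthogonal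
  to the first \<open>j - 1\<close> eigenvectors. Its Rayleigh quotient is at least
  \<open>lam j\<close> by its spectral support and at most \<open>L j\<close> by
  diagonalization.\<close>

lemma eigenvalue_lower_bound:
  assumes j: "j \<in> I" "j \<in> {1..n}"
  shows "lam j \<le> L j"
proof -
  obtain x where x: "\<exists>i\<in>{1..j}. x i \<noteq> 0" "\<And>k. k \<in> {1..<j} \<Longrightarrow> (\<Sum>i\<in>{1..j}. cinner (u k) (U i) * x i) = 0"
    by (rule homogeneous_system_nontrivial[of "{1..<j}" "{1..j}" "\<lambda>k i. cinner (u k) (U i)"])
       (use j in auto)
  let ?v = "\<Sum>i\<in>{1..j}. x i *\<^sub>C U i"
  have J: "{1..j} \<subseteq> {1..n}" using j by auto
  have "AE x in sm ?v. lam j \<le> x"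
  proof (rule AE_ge_of_orthogonal[OF l])
    show "ereal (lam j) \<le> ess_inf D A" using listsD(3)[OF l j(1)] by simp
    fix i assume "i \<in> I" "lam i < lam j"
    then have "i \<in> {1..<j}" using lam_less_imp j by blast
    then show "cinner (u i) ?v = 0"
      using x(2)[of i] by (simp add: ip.sum_right ip_scaleC_right mult.commute)
  qed
  then have "lam j * (norm (R ?v))\<^sup>2 \<le> (norm (P ?v))\<^sup>2"
    using pop_low_le[OF lin_comb(1)[OF J] \<tau>(2)] by (simp add: ipnorm_cinner)
  also have "\<dots> = (\<Sum>i\<in>{1..j}. L i * (cmod (x i))\<^sup>2)" by (rule norm_P_comb[OF J])
  also have "\<dots> \<le> (\<Sum>i\<in>{1..j}. L j * (cmod (x i))\<^sup>2)"
    using L_mono j by (intro sum_mono mult_right_mono) (auto simp: mono_on_def)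
  also have "\<dots> = L j * (norm (R ?v))\<^sup>2" unfolding norm_R_comb[OF J] sum_distrib_left ..
  finally have "lam j * (norm (R ?v))\<^sup>2 \<le> L j * (norm (R ?v))\<^sup>2" .
  moreover have "(norm (R ?v))\<^sup>2 > 0"
    unfolding norm_R_comb[OF J] using x(1) by (intro sum_cmod_sq_pos) auto
  ultimately show ?thesis by simp
qed

text \<open>The test vector \<open>?v\<close> combines the Ritz projections of
  \<open>u 1, ..., u j\<close> so that it has no component along the first \<open>j - 1\<close> Ritz
  vectors; its energy is then at least \<open>L j\<close> times its mass. Projection does not
  increase the energy, so all depends on how much mass \<open>?v\<close> loses against
  \<open>?u\<close>. Bounded directly, the mass product of \<open>?u\<close> with the error
  \<open>?e\<close> would be linear in \<open>\<epsilon>\<close>; rewritten as an energy product it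
  is quadratic.\<close>

lemma eigenvalue_upper_bound:
  assumes j: "j \<in> I" "j \<in> {1..n}"
    and e: "\<And>i. i \<in> {1..j} \<Longrightarrow> norm (P (u i - ritz_proj (u i))) \<le> \<epsilon>"
  shows "L j * (1 - 2 * real j / (lower * lam j powr (2 * \<tau> - 1)) * \<epsilon>\<^sup>2) \<le> lam j"
proof -
  have jI: "i \<in> I" if "i \<in> {1..j}" for i using I_down[OF j(1), of i] that by auto
  have ev: "u i \<in> eigenspace D A (complex_of_real (lam i))" if "i \<in> {1..j}" for i
    using listsD(4)[OF l jI[OF that]] .
  have lpos: "lam i > 0" "lower \<le> lam i" "lam i \<le> lam j" if "i \<in> {1..j}" for i
    using lam_pos[OF jI[OF that]] lam_lower[OF jI[OF that]] listsD(1)[OF l] jI[OF that] j(1) that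
    by (auto simp: mono_on_def)
  have ud: "u i \<in> pdom \<tau>" if "i \<in> {1..j}" for i by (rule eigenvector_pop(1)[OF ev[OF that]])
  have e0: "\<epsilon> \<ge> 0" using order_trans[OF norm_ge_zero e[of 1]] j by auto
  obtain x where x: "\<exists>i\<in>{1..j}. x i \<noteq> 0" "\<And>k. k \<in> {1..<j} \<Longrightarrow> (\<Sum>i\<in>{1..j}. cinner (P (U k)) (P (u i)) * x i) = 0"
    by (rule homogeneous_system_nontrivial[of "{1..<j}" "{1..j}" "\<lambda>k i. cinner (P (U k)) (P (u i))"])
       (use j in auto)
  define err where "err i = u i - ritz_proj (u i)" for i
  have ed: "err i \<in> pdom \<tau>" if "i \<in> {1..j}" for i
    unfolding err_def by (intro csubspace_diff P_sub ud that ritz_proj_dom)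
  let ?v = "\<Sum>i=1..j. x i *\<^sub>C ritz_proj (u i)" and ?u = "\<Sum>i=1..j. x i *\<^sub>C u i" and ?e = "\<Sum>i=1..j. x i *\<^sub>C err i"
  \<comment> \<open>Dividing by the eigenvalues turns mass products with \<open>?u\<close> into
    energy products with \<open>?u'\<close>.\<close>
  let ?x' = "\<lambda>i. x i * of_real (1 / lam i)"
  let ?u' = "\<Sum>i=1..j. ?x' i *\<^sub>C u i" and ?e' = "\<Sum>i=1..j. ?x' i *\<^sub>C err i" and ?v' = "\<Sum>i=1..j. ?x' i *\<^sub>C ritz_proj (u i)"
  have dom: "(\<Sum>i=1..j. y i *\<^sub>C u i) \<in> pdom \<tau>" "(\<Sum>i=1..j. y i *\<^sub>C err i) \<in> pdom \<tau>"
    "(\<Sum>i=1..j. y i *\<^sub>C ritz_proj (u i)) \<in> pdom \<tau>" for y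
    by (intro csubspace_sum csubspace_scaleC P_sub ud ed ritz_proj_dom; assumption)+
  have uev: "(\<Sum>i=1..j. y i *\<^sub>C u i) = (\<Sum>i=1..j. y i *\<^sub>C ritz_proj (u i)) + (\<Sum>i=1..j. y i *\<^sub>C err i)" for y
    unfolding sum.distrib[symmetric] err_def by (simp add: complex_vector.scale_right_diff_distrib)
  have orth: "cinner (P (\<Sum>i=1..j. y i *\<^sub>C ritz_proj (u i))) (P ?e) = 0" for y
  proof -
    have eP: "P ?e = (\<Sum>i=1..j. x i *\<^sub>C P (err i))"
      by (rule pop_lincomb(2)[OF ed])
    have comb: "(\<Sum>i=1..j. y i *\<^sub>C ritz_proj (u i))
        = (\<Sum>k=1..n. ((\<Sum>i=1..j. cinner (P (U k)) (P (u i)) * y i) / complex_of_real (L k)) *\<^sub>C U k)"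
      by (rule ritz_proj_comb[OF ud])
    have "cinner (P (\<Sum>i=1..j. y i *\<^sub>C ritz_proj (u i))) (P (err i)) = 0" if i: "i \<in> {1..j}" for i
      unfolding comb err_def by (rule ritz_proj_orthogonal_comb[OF ud[OF i]]) simp
    then show ?thesis unfolding eP ip.sum_right ip_scaleC_right by (intro sum.neutral) auto
  qed
  have Pe: "norm (P (\<Sum>i=1..j. y i *\<^sub>C err i)) \<le> (\<Sum>i=1..j. cmod (y i)) * \<epsilon>" for y
  proof -
    have "P (\<Sum>i=1..j. y i *\<^sub>C err i) = (\<Sum>i=1..j. y i *\<^sub>C P (err i))"
      by (rule pop_lincomb(2)[OF ed])
    also have "norm \<dots> \<le> (\<Sum>i=1..j. norm (y i *\<^sub>C P (err i)))" by (rule norm_sum)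
    also have "\<dots> \<le> (\<Sum>i=1..j. cmod (y i) * \<epsilon>)"
    proof (rule sum_mono)
      fix i assume "i \<in> {1..j}"
      then show "norm (y i *\<^sub>C P (err i)) \<le> cmod (y i) * \<epsilon>"
        using nrm_scaleC[of "y i" "P (err i)"] e[of i] by (simp add: ipnorm_cinner err_def mult_left_mono)
    qed
    finally show ?thesis by (simp add: sum_distrib_right)
  qed
  let ?X = "\<Sum>i=1..j. (cmod (x i))\<^sup>2"
  let ?s = "\<Sum>i=1..j. cmod (x i)"
  have Ru: "R ?u = (\<Sum>i=1..j. x i *\<^sub>C R (u i))" by (rule pop_lincomb(2)[OF R_dom])
  have Pu: "P ?u = (\<Sum>i=1..j. x i *\<^sub>C P (u i))"
    by (rule pop_lincomb(2)[OF ud])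
  have on: "cinner (u i) (u k) = (if i = k then 1 else 0)" if "i \<in> {1..j}" "k \<in> {1..j}" for i k
    using listsD(2)[OF l] jI that unfolding orthonormal_on_def by blast
  have bu: "(norm (R ?u))\<^sup>2 = (\<Sum>i=1..j. lam i powr (2 * \<tau> - 1) * (cmod (x i))\<^sup>2)"
    unfolding Ru
    by (rule norm_sum_sq_orthogonal) (auto simp: mass_eigenvector[OF ev lpos(1)] on[simplified])
  have au: "(norm (P ?u))\<^sup>2 = (\<Sum>i=1..j. lam i powr (2 * \<tau>) * (cmod (x i))\<^sup>2)"
    unfolding Pu
    by (rule norm_sum_sq_orthogonal) (auto simp: energy_eigenvector[OF ev lpos(1) ud] on[simplified])
  have au_le: "(norm (P ?u))\<^sup>2 \<le> lam j * (norm (R ?u))\<^sup>2"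
    unfolding au bu sum_distrib_left
  proof (rule sum_mono)
    fix i assume i: "i \<in> {1..j}"
    have "lam i powr (2 * \<tau>) = lam i * lam i powr (2 * \<tau> - 1)" using lpos(1)[OF i] by (simp add: powr_diff)
    also have "\<dots> \<le> lam j * lam i powr (2 * \<tau> - 1)" using lpos(3)[OF i] by (rule mult_right_mono) simp
    finally have "lam i powr (2 * \<tau>) * (cmod (x i))\<^sup>2 \<le> (lam j * lam i powr (2 * \<tau> - 1)) * (cmod (x i))\<^sup>2"
      by (rule mult_right_mono) simp
    then show "lam i powr (2 * \<tau>) * (cmod (x i))\<^sup>2 \<le> lam j * (lam i powr (2 * \<tau> - 1) * (cmod (x i))\<^sup>2)"
      by (simp add: mult.assoc)
  qed
  have Xpos: "?X > 0" using x(1) by (intro sum_cmod_sq_pos) auto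
  let ?c = "lam j powr (2 * \<tau> - 1)"
  have cpos: "?c > 0" using lam_pos[OF j(1)] by simp
  have bu_ge: "?c * ?X \<le> (norm (R ?u))\<^sup>2"
    unfolding bu sum_distrib_left
  proof (intro sum_mono mult_right_mono)
    show "?c \<le> lam i powr (2 * \<tau> - 1)" if "i \<in> {1..j}" for i
      using lpos[OF that] \<tau>(2) by (intro powr_mono2') auto
  qed simp
  have bupos: "(norm (R ?u))\<^sup>2 > 0" using bu_ge Xpos cpos by (meson mult_pos_pos less_le_trans)
  have s_le: "?s\<^sup>2 \<le> real j * ?X"
    using sum_squared_le_sum_of_squares[of "\<lambda>i. cmod (x i)" "{1..j}"] by (simp add: mult.commute)
  have be: "Re (cinner (R ?u) (R ?e)) \<le> ?s\<^sup>2 * \<epsilon>\<^sup>2 / lower"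
  proof -
    have "cinner (R ?u) (R ?e) = (\<Sum>i=1..j. cnj (x i) * cinner (R (u i)) (R ?e))"
      unfolding Ru by (simp add: ip.sum_left ip_scaleC_left)
    also have "\<dots> = (\<Sum>i=1..j. cnj (?x' i) * cinner (P (u i)) (P ?e))"
    proof (rule sum.cong[OF refl])
      fix i assume i: "i \<in> {1..j}"
      show "cnj (x i) * cinner (R (u i)) (R ?e) = cnj (?x' i) * cinner (P (u i)) (P ?e)"
        unfolding energy_eq_mass[OF ev[OF i] lpos(1)[OF i] dom(2)] using lpos(1)[OF i] by simp
    qed
    also have "\<dots> = cinner (P ?u') (P ?e)"
    proof -
      have "P ?u' = (\<Sum>i=1..j. ?x' i *\<^sub>C P (u i))"
        by (rule pop_lincomb(2)[OF ud])
      then show ?thesis by (simp only: ip.sum_left ip_scaleC_left)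
    qed
    \<comment> \<open>The projected part of \<open>?u'\<close> has no energy product with
      \<open>?e\<close>, so an error stands in both slots.\<close>
    also have "\<dots> = cinner (P ?e') (P ?e)"
      unfolding uev[of ?x'] pop_add[OF dom(3,2)] ip_add_left orth by simp
    finally have "Re (cinner (R ?u) (R ?e)) \<le> norm (P ?e') * norm (P ?e)"
      using order_trans[OF complex_Re_le_cmod Cauchy_Schwarz[of "P ?e'" "P ?e"]] by (simp add: ipnorm_cinner)
    also have "\<dots> \<le> ((\<Sum>i=1..j. cmod (?x' i)) * \<epsilon>) * (?s * \<epsilon>)"
      by (intro mult_mono Pe mult_nonneg_nonneg sum_nonneg e0) auto
    also have "(\<Sum>i=1..j. cmod (?x' i)) \<le> ?s / lower"
      unfolding sum_divide_distrib
    proof (rule sum_mono)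
      fix i assume i: "i \<in> {1..j}"
      have "cmod (x i) / lam i \<le> cmod (x i) / lower"
        using lpos[OF i] lower(1) by (intro divide_left_mono) auto
      then show "cmod (?x' i) \<le> cmod (x i) / lower" using lpos(1)[OF i] by (simp add: norm_mult norm_divide)
    qed
    finally show ?thesis using e0
      by (simp add: mult_right_mono sum_nonneg power2_eq_square ac_simps)
  qed
  have "(norm (P ?u))\<^sup>2 = (norm (P ?v))\<^sup>2 + (norm (P ?e))\<^sup>2"
    unfolding uev[of x] pop_add[OF dom(3,2)]
    using nrm_sq_add[of "P ?v" "P ?e"] orth[of x] by (simp add: ipnorm_cinner)
  then have v_le: "(norm (P ?v))\<^sup>2 \<le> (norm (P ?u))\<^sup>2" by simp
  have "(norm (R ?v))\<^sup>2 = (norm (R ?u))\<^sup>2 - 2 * Re (cinner (R ?u) (R ?e)) + (norm (R ?e))\<^sup>2"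
  proof -
    have "?v = ?u - ?e" using uev[of x] by simp
    then have "R ?v = R ?u - R ?e" by (simp only: pop_diff[OF R_dom R_dom])
    then show ?thesis using nrm_sq_diff[of "R ?u" "R ?e"] by (simp add: ipnorm_cinner)
  qed
  then have bv: "(norm (R ?v))\<^sup>2 \<ge> (norm (R ?u))\<^sup>2 - 2 * (?s\<^sup>2 * \<epsilon>\<^sup>2 / lower)"
    using be zero_le_power2[of "norm (R ?e)"] by linarith
  have Lv: "L j * (norm (R ?v))\<^sup>2 \<le> (norm (P ?v))\<^sup>2"
  proof -
    let ?y = "\<lambda>k. (\<Sum>i\<in>{1..j}. cinner (P (U k)) (P (u i)) * x i) / complex_of_real (L k)"
    have v: "?v = (\<Sum>k=1..n. ?y k *\<^sub>C U k)" by (rule ritz_proj_comb[OF ud])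
    have y0: "?y k = 0" if "k \<in> {1..<j}" for k using x(2)[OF that] by simp
    have "L j * (norm (R ?v))\<^sup>2 = (\<Sum>k=1..n. L j * (cmod (?y k))\<^sup>2)"
      unfolding v norm_R_comb[OF order_refl] by (simp add: sum_distrib_left)
    also have "\<dots> \<le> (\<Sum>k=1..n. L k * (cmod (?y k))\<^sup>2)"
    proof (rule sum_mono)
      fix k assume k: "k \<in> {1..n}"
      show "L j * (cmod (?y k))\<^sup>2 \<le> L k * (cmod (?y k))\<^sup>2"
      proof (cases "k < j")
        case True
        then have "?y k = 0" using y0 k by auto
        then show ?thesis by (simp only: norm_zero) simp
      next
        case False
        then have "L j \<le> L k" using L_mono k j by (auto simp: mono_on_def)
        then show ?thesis by (rule mult_right_mono) simp
      qed
    qed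
    also have "\<dots> = (norm (P ?v))\<^sup>2" unfolding v norm_P_comb[OF order_refl] ..
    finally show ?thesis .
  qed
  \<comment> \<open>The 2 belongs to the mixed term of the square, \<open>j\<close> to the
    Cauchy-Schwarz inequality for \<open>?s\<close>, \<open>lower\<close> to the divisions by
    \<open>lam i\<close>; \<open>?c * ?X\<close> bounds the mass of \<open>?u\<close> from
    below.\<close>
  let ?C = "2 * real j / (lower * ?c)"
  have "2 * (?s\<^sup>2 * \<epsilon>\<^sup>2 / lower) \<le> ?C * \<epsilon>\<^sup>2 * (norm (R ?u))\<^sup>2"
  proof -
    have "2 * (?s\<^sup>2 * \<epsilon>\<^sup>2 / lower) \<le> 2 * ((real j * ?X) * \<epsilon>\<^sup>2 / lower)"
      using s_le lower(1) by (intro mult_left_mono divide_right_mono mult_right_mono) auto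
    also have "\<dots> = ?C * \<epsilon>\<^sup>2 * (?c * ?X)" using cpos by simp
    also have "\<dots> \<le> ?C * \<epsilon>\<^sup>2 * (norm (R ?u))\<^sup>2"
      using lower(1) cpos by (intro mult_left_mono bu_ge) auto
    finally show ?thesis .
  qed
  then have "(1 - ?C * \<epsilon>\<^sup>2) * (norm (R ?u))\<^sup>2 \<le> (norm (R ?v))\<^sup>2" using bv by (simp add: algebra_simps)
  then have "L j * ((1 - ?C * \<epsilon>\<^sup>2) * (norm (R ?u))\<^sup>2) \<le> L j * (norm (R ?v))\<^sup>2"
    using L_pos[OF j(2)] by (intro mult_left_mono) auto
  also have "\<dots> \<le> lam j * (norm (R ?u))\<^sup>2" using Lv v_le au_le by linarith
  finally have "(L j * (1 - ?C * \<epsilon>\<^sup>2)) * (norm (R ?u))\<^sup>2 \<le> lam j * (norm (R ?u))\<^sup>2"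
    by (simp add: mult.assoc)
  then show ?thesis using bupos by simp
qed

end

end

section \<open>Ritz vectors near the eigenspaces\<close>

context ritz_approx
begin

lemma U_inj: "inj_on U {1..n}"
proof (rule inj_onI)
  fix i j assume ij: "i \<in> {1..n}" "j \<in> {1..n}" "U i = U j"
  show "i = j"
  proof (rule ccontr)
    assume "i \<noteq> j"
    then have "cinner (R (U i)) (R (U i)) = 0" using U_mass'[OF ij(1,2)] ij(3) by simp
    then show False using U_mass'[OF ij(1,1)] by simp
  qed
qed

lemma U_independent: "complex_vector.independent (U ` {1..n})"
proof (rule complex_vector.independent_if_scalars_zero)
  fix f x assume s: "(\<Sum>x\<in>U ` {1..n}. f x *\<^sub>C x) = 0" and x: "x \<in> U ` {1..n}"
  have s': "(\<Sum>i\<in>{1..n}. f (U i) *\<^sub>C U i) = 0" using s unfolding sum.reindex[OF U_inj] by (simp add: o_def)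
  have "R 0 = 0" using pop_diff[OF R_dom R_dom, of 0 0] by simp
  then have "(\<Sum>i\<in>{1..n}. (cmod (f (U i)))\<^sup>2) = 0"
    using norm_R_comb[OF order_refl, of "\<lambda>i. f (U i)"] unfolding s' by simp
  then show "f x = 0" using x by (auto simp: sum_nonneg_eq_0_iff)
qed simp

text \<open>The length of \<open>R y\<close> differs from 1 by at most
  \<open>norm (R (V - y))\<close>, hence by at most \<open>norm (P (V - y)) / sqrt lower\<close>.
  Rescaling an eigenvector by that much costs the extra term, since its energy norm is
  \<open>sqrt r\<close> times its mass norm.\<close>

lemma eigenvector_normalized:
  assumes y: "y \<in> eigenspace D A (complex_of_real r)" "y \<noteq> 0" and V: "V \<in> pdom \<tau>" "norm (R V) = 1"
  shows "norm (R ((1 / norm (R y)) *\<^sub>R y)) = 1"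
    and "norm (P ((1 / norm (R y)) *\<^sub>R y - V)) \<le> (1 + sqrt (r / lower)) * norm (P (V - y))"
proof -
  have r: "r > 0" using eigenvalue_ge_lower[OF y] lower(1) by simp
  let ?t = "norm (R y)"
  have yd: "y \<in> pdom \<tau>" by (rule eigenvector_pop(1)[OF y(1)])
  have t: "?t > 0" using r y by (simp add: eigenvector_pop(2)[OF y(1)])
  have scale: "pop s ((1 / ?t) *\<^sub>R y) = (1 / ?t) *\<^sub>R pop s y" for s
    using pop_scaleC[OF eigenvector_pop(1)[OF y(1)], of s "complex_of_real (1 / ?t)"] by (simp only: scaleC_simps(1))
  show "norm (R ((1 / ?t) *\<^sub>R y)) = 1" using t by (simp add: scale)
  have wd: "(1 / ?t) *\<^sub>R y \<in> pdom \<tau>" by (rule csubspace_scaleR[OF P_sub yd])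
  have "\<bar>norm (R V) - ?t\<bar> \<le> norm (R V - R y)" by (rule norm_triangle_ineq3)
  also have "R V - R y = R (V - y)" by (simp add: pop_diff)
  also have "norm (R (V - y)) \<le> norm (P (V - y)) / sqrt lower"
  proof (rule power2_le_imp_le)
    show "(norm (R (V - y)))\<^sup>2 \<le> (norm (P (V - y)) / sqrt lower)\<^sup>2"
      using norm_R_le[OF csubspace_diff[OF P_sub V(1) yd]] lower(1) by (simp add: power_divide field_simps)
  qed (use lower(1) in simp)
  finally have 1: "\<bar>1 - ?t\<bar> \<le> norm (P (V - y)) / sqrt lower" by (simp add: V(2))
  have "norm (P ((1 / ?t) *\<^sub>R y) - P y) = norm ((1 / ?t - 1) *\<^sub>R P y)"
    by (simp add: scale scaleR_left_diff_distrib)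
  also have "\<dots> = \<bar>1 / ?t - 1\<bar> * (sqrt r * ?t)" by (simp only: norm_scaleR norm_P_eigenvector[OF y(1) r])
  also have "\<dots> = \<bar>(1 / ?t - 1) * ?t\<bar> * sqrt r" using t by (simp add: abs_mult)
  also have "(1 / ?t - 1) * ?t = 1 - ?t" using t by (simp add: field_simps)
  also have "\<bar>1 - ?t\<bar> * sqrt r \<le> norm (P (V - y)) / sqrt lower * sqrt r"
    using 1 r by (intro mult_right_mono) auto
  finally have 2: "norm (P ((1 / ?t) *\<^sub>R y) - P y) \<le> sqrt (r / lower) * norm (P (V - y))"
    by (simp add: real_sqrt_divide mult.commute)
  have "norm (P ((1 / ?t) *\<^sub>R y - V)) = norm ((P ((1 / ?t) *\<^sub>R y) - P y) - (P V - P y))"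
    by (simp add: pop_diff[OF wd V(1)])
  also have "\<dots> \<le> norm (P ((1 / ?t) *\<^sub>R y) - P y) + norm (P V - P y)" by (rule norm_triangle_ineq4)
  also have "P V - P y = P (V - y)" by (simp add: pop_diff[OF V(1) yd])
  finally show "norm (P ((1 / ?t) *\<^sub>R y - V)) \<le> (1 + sqrt (r / lower)) * norm (P (V - y))"
    using 2 by (simp add: distrib_right)
qed

context
  fixes I lam u
  assumes l: "lists_eigenpairs_below (ess_inf D A) cinner D A I lam u" and I1: "0 \<notin> I"
begin

text \<open>\<open>ritz_coefficient\<close> is divided by \<open>L j - lam i\<close>, which is at
  least the positive gap \<open>lam j - lam i\<close>. The power of \<open>lam i\<close> converts
  the mass product into the original inner product.\<close>

lemma coefficient_bound:
  assumes i: "i \<in> I" "lam i < lam j" and j: "j \<in> I" "j \<in> {1..n}" and Lj: "lam j \<le> L j"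
    and e: "norm (P (u i - ritz_proj (u i))) \<le> \<epsilon>"
  shows "(cmod (cinner (u i) (U j)))\<^sup>2 \<le> (lam i powr (1 - 2 * \<tau>) * L j / (lam j - lam i))\<^sup>2 / lower * \<epsilon>\<^sup>2"
proof -
  have ev: "u i \<in> eigenspace D A (complex_of_real (lam i))" by (rule listsD(4)[OF l i(1)])
  have pos: "lam i > 0" using listsD(6)[OF l i(1)] lower(1) by simp
  let ?e = "u i - ritz_proj (u i)"
  have ed: "?e \<in> pdom \<tau>" by (intro csubspace_diff P_sub eigenvector_pop(1)[OF ev] ritz_proj_dom)
  let ?b = "cinner (R (u i)) (R (U j))"
  have "(L j - lam i) * cmod ?b = cmod (of_real (L j - lam i) * ?b)"
    using i Lj by (simp add: norm_mult del: of_real_diff)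
  also have "\<dots> = L j * cmod (cinner (R ?e) (R (U j)))"
    unfolding ritz_coefficient[OF ev pos j(2)] using L_pos[OF j(2)] by (simp add: norm_mult)
  also have "\<dots> \<le> L j * norm (R ?e)"
    using Cauchy_Schwarz[of "R ?e" "R (U j)"] L_pos[OF j(2)] norm_R_U[OF j(2)] by (simp add: ipnorm_cinner)
  finally have 1: "(L j - lam i) * cmod ?b \<le> L j * norm (R ?e)" .
  have "(lam j - lam i) * cmod ?b \<le> (L j - lam i) * cmod ?b" using Lj by (intro mult_right_mono) auto
  then have 2: "cmod ?b \<le> L j / (lam j - lam i) * norm (R ?e)" using 1 i by (simp add: field_simps)
  have c: "cmod (cinner (u i) (U j)) = lam i powr (1 - 2 * \<tau>) * cmod ?b"
  proof -
    have "lam i powr (1 - 2 * \<tau>) * lam i powr (2 * \<tau> - 1) = 1" using pos by (simp add: powr_add[symmetric])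
    then show ?thesis unfolding mass_eigenvector[OF ev pos] by (simp add: norm_mult mult.assoc[symmetric])
  qed
  have "lower * (norm (R ?e))\<^sup>2 \<le> \<epsilon>\<^sup>2"
    using norm_R_le[OF ed] power_mono[OF e norm_ge_zero, of 2] by linarith
  then have 3: "(norm (R ?e))\<^sup>2 \<le> \<epsilon>\<^sup>2 / lower" using lower(1) by (simp add: field_simps)
  have "cmod (cinner (u i) (U j)) \<le> lam i powr (1 - 2 * \<tau>) * L j / (lam j - lam i) * norm (R ?e)"
    unfolding c using mult_left_mono[OF 2, of "lam i powr (1 - 2 * \<tau>)"] by simp
  then have "(cmod (cinner (u i) (U j)))\<^sup>2 \<le> (lam i powr (1 - 2 * \<tau>) * L j / (lam j - lam i) * norm (R ?e))\<^sup>2"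
    by (rule power_mono) simp
  also have "\<dots> \<le> (lam i powr (1 - 2 * \<tau>) * L j / (lam j - lam i))\<^sup>2 * (\<epsilon>\<^sup>2 / lower)"
    unfolding power_mult_distrib[of _ "norm _"] by (rule mult_left_mono[OF 3]) simp
  finally show ?thesis by simp
qed

text \<open>Rests on a pointwise majorant of \<open>x powr (2 * \<tau>)\<close> away from
  \<open>lam j\<close>. Above the gap, \<open>\<kappa>\<close> is the largest value of
  \<open>x / (x - lam j)\<close>, so \<open>\<kappa> * (x - lam j) * x powr (2 * \<tau> - 1)\<close>
  suffices, and its full integral is \<open>\<kappa> * (L j - lam j)\<close>. Below
  \<open>lam j\<close> this expression is negative, and the bracketed constant compensates it there,
  at the price of the spectral mass of \<open>U j\<close> below \<open>lam j\<close>, which the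
  squared coefficients give.\<close>

lemma eigenvector_bound:
  assumes j: "j \<in> I" "j \<in> {1..n}"
    and \<delta>: "\<delta> > 0" "\<And>v. AE x in sm v. x \<le> lam j \<or> lam j + \<delta> \<le> x"
  defines "\<kappa> \<equiv> (lam j + \<delta>) / \<delta>"
  shows "(norm (P (U j - E {lam j} (U j))))\<^sup>2 \<le> \<kappa> * (L j - lam j)
    + (lam j powr (2 * \<tau>) + \<kappa> * (lam j * lower powr (2 * \<tau> - 1)))
      * (\<Sum>i\<in>{i \<in> I. lam i < lam j}. (cmod (cinner (u i) (U j)))\<^sup>2)"
proof -
  let ?r = "lam j" and ?U = "U j"
  let ?F = "{i \<in> I. lam i < ?r}"
  define C where "C = ?r powr (2 * \<tau>) + \<kappa> * (?r * lower powr (2 * \<tau> - 1))"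
  have lpos: "?r > 0" "lower \<le> ?r" using listsD(6)[OF l j(1)] lower(1) by auto
  have \<kappa>: "\<kappa> > 0" using lpos \<delta> by (simp add: \<kappa>_def)
  have Ud: "?U \<in> pdom \<tau>" by (rule U_dom[OF j(2)])
  have "?F \<subseteq> {1..<j}"
    using listsD(1)[OF l] I1 j(1) by (auto simp: mono_on_def not_less_eq_eq[symmetric]) (metis One_nat_def gr0I less_eq_Suc_le, metis linorder_not_less)
  then have fin: "finite ?F" using finite_subset by blast
  \<comment> \<open>Once these components are removed no spectral mass below \<open>lam j\<close> is
    left, so \<open>?z\<close> is exactly the low part of \<open>U j\<close>.\<close>
  let ?z = "\<Sum>i\<in>?F. cinner (u i) ?U *\<^sub>C u i"
  have orth: "cinner (u i) (?U - ?z) = 0" if "i \<in> ?F" for i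
    using orthonormal_sum(1)[OF listsD(2)[OF l] fin _ that] by (simp add: ip_diff_right)
  have "AE x in sm (?U - ?z). ?r \<le> x"
    by (rule AE_ge_of_orthogonal[OF l]) (use listsD(3)[OF l j(1)] orth in auto)
  then have "AE x in sm (?U - ?z). x \<in> {?r..}" by simp
  then have "E (- {?r..}) (?U - ?z) = 0" by (subst (asm) AE_sm_iff) auto
  moreover have "- {?r..} = {..<?r}" by auto
  ultimately have "E {..<?r} ?U = E {..<?r} ?z" by (simp add: clinear_diff[OF E_lin])
  also have "\<dots> = ?z"
    unfolding clinear_sum[OF E_lin[of "{..<?r}", simplified]] clinear_scaleC[OF E_lin[of "{..<?r}", simplified]]
    by (intro sum.cong refl) (subst E_eigenvector[OF listsD(4)[OF l]], auto)
  finally have "(norm (E {..<?r} ?U))\<^sup>2 = (\<Sum>i\<in>?F. (cmod (cinner (u i) ?U))\<^sup>2)"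
    using orthonormal_sum(2)[OF listsD(2)[OF l] fin, of "\<lambda>i. cinner (u i) ?U"] by (simp add: ipnorm_cinner)
  then have low: "(\<integral>x. indicator {..<?r} x \<partial>sm ?U) = (\<Sum>i\<in>?F. (cmod (cinner (u i) ?U))\<^sup>2)"
    by (subst integral_indicator_sm) (simp_all add: ipnorm_cinner)
  have iP: "integrable (sm ?U) (\<lambda>x. x powr (2 * \<tau>))" by (rule integrable_pop[OF Ud])
  have iR: "integrable (sm ?U) (\<lambda>x. x powr (2 * \<tau> - 1))"
    using integrable_pop[OF R_dom, of ?U] by (simp add: algebra_simps)
  have iI: "integrable (sm ?U) (\<lambda>x. indicator {..<?r} x :: real)"
    by (rule integrable_bounded_sm[of _ 1]) (auto simp: indicator_def)
  have nP: "(\<integral>x. x powr (2 * \<tau>) \<partial>sm ?U) = L j"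
    using nrm_pop_powr[OF Ud] norm_P_U[OF j(2)] by (simp add: ipnorm_cinner)
  have nR: "(\<integral>x. x powr (2 * \<tau> - 1) \<partial>sm ?U) = 1"
    using nrm_pop_powr[OF R_dom, of ?U] norm_R_U[OF j(2)] by (simp add: ipnorm_cinner algebra_simps)
  let ?S = "- {?r}"
  have S: "?S \<in> sets borel" by simp
  have "E ({?r} \<union> ?S) ?U = E {?r} ?U + E ?S ?U" by (rule E_Un) auto
  moreover have "{?r} \<union> ?S = UNIV" by auto
  ultimately have "?U = E {?r} ?U + E ?S ?U" by (metis E_UNIV)
  then have "?U - E {?r} ?U = E ?S ?U" by (metis add_diff_cancel_left')
  then have "(norm (P (?U - E {?r} ?U)))\<^sup>2 = (\<integral>x. x powr (2 * \<tau>) \<partial>sm (E ?S ?U))"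
    using nrm_pop_powr[OF E_mem_pdom[OF S Ud]] by (simp add: ipnorm_cinner)
  also have "\<dots> = (\<integral>x. indicator ?S x * x powr (2 * \<tau>) \<partial>sm ?U)"
    by (rule integral_sm_E[OF S powr_measurable])
  also have "\<dots> \<le> (\<integral>x. \<kappa> * (x powr (2 * \<tau>) - ?r * x powr (2 * \<tau> - 1)) + C * indicator {..<?r} x \<partial>sm ?U)"
  proof (rule integral_mono_AE)
    show "integrable (sm ?U) (\<lambda>x. indicator ?S x * x powr (2 * \<tau>))"
      by (rule Bochner_Integration.integrable_bound[OF iP]) (auto simp: indicator_def)
    show "integrable (sm ?U) (\<lambda>x. \<kappa> * (x powr (2 * \<tau>) - ?r * x powr (2 * \<tau> - 1)) + C * indicator {..<?r} x)"
      by (intro Bochner_Integration.integrable_add Bochner_Integration.integrable_diff integrable_mult_right iP iR iI)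
    show "AE x in sm ?U. indicator ?S x * x powr (2 * \<tau>)
        \<le> \<kappa> * (x powr (2 * \<tau>) - ?r * x powr (2 * \<tau> - 1)) + C * indicator {..<?r} x"
      using AE_lower[of ?U] \<delta>(2)[of ?U]
    proof eventually_elim
      case (elim x)
      have x: "x > 0" using elim(1) lower(1) by simp
      have p: "x powr (2 * \<tau>) = x * x powr (2 * \<tau> - 1)" using x by (simp add: powr_diff)
      consider "x < ?r" | "x = ?r" | "?r + \<delta> \<le> x" using elim(2) by linarith
      then show ?case
      proof cases
        case 1
        have "x powr (2 * \<tau>) \<le> ?r powr (2 * \<tau>)" using 1 x \<tau> by (intro powr_mono2) auto
        moreover have "\<kappa> * (?r * x powr (2 * \<tau> - 1)) \<le> \<kappa> * (?r * lower powr (2 * \<tau> - 1))"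
          using \<kappa> lpos lower(1) elim(1) \<tau> by (intro mult_left_mono powr_mono2') auto
        moreover have "0 \<le> \<kappa> * x powr (2 * \<tau>)" using \<kappa> by simp
        ultimately show ?thesis using 1 by (simp add: C_def right_diff_distrib)
      next
        case 2
        then show ?thesis using p by simp
      next
        case 3
        have "x \<le> \<kappa> * (x - ?r)"
        proof -
          have "\<kappa> * (x - ?r) - x = ?r * (x - (?r + \<delta>)) / \<delta>" using \<delta>(1) by (simp add: \<kappa>_def field_simps)
          also have "\<dots> \<ge> 0" using 3 lpos \<delta>(1) by simp
          finally show ?thesis by simp
        qed
        then have "x * x powr (2 * \<tau> - 1) \<le> \<kappa> * (x - ?r) * x powr (2 * \<tau> - 1)" by (rule mult_right_mono) simp
        then show ?thesis using 3 \<delta>(1) by (simp add: p left_diff_distrib mult.assoc)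
      qed
    qed
  qed
  also have "\<dots> = \<kappa> * (L j - ?r) + C * (\<Sum>i\<in>?F. (cmod (cinner (u i) ?U))\<^sup>2)"
  proof -
    have "(\<integral>x. \<kappa> * (x powr (2 * \<tau>) - ?r * x powr (2 * \<tau> - 1)) + C * indicator {..<?r} x \<partial>sm ?U)
      = (\<integral>x. \<kappa> * (x powr (2 * \<tau>) - ?r * x powr (2 * \<tau> - 1)) \<partial>sm ?U) + (\<integral>x. C * indicator {..<?r} x \<partial>sm ?U)"
      by (intro Bochner_Integration.integral_add Bochner_Integration.integrable_diff integrable_mult_right iP iR iI)
    also have "(\<integral>x. \<kappa> * (x powr (2 * \<tau>) - ?r * x powr (2 * \<tau> - 1)) \<partial>sm ?U) = \<kappa> * (L j - ?r)"
      using iP iR by (simp add: nP nR)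
    also have "(\<integral>x. C * indicator {..<?r} x \<partial>sm ?U) = C * (\<Sum>i\<in>?F. (cmod (cinner (u i) ?U))\<^sup>2)"
      by (simp only: integral_mult_right_zero low)
    finally show ?thesis .
  qed
  finally show ?thesis unfolding C_def .
qed

end

end

section \<open>Approximation by the trial vectors\<close>

context trial_setting
begin

definition trial_proj :: "nat \<Rightarrow> 'a \<Rightarrow> 'a" where
  "trial_proj n v = (\<Sum>k=1..n. G (q k) v *\<^sub>C q k)"

lemma trial_proj_tendsto: "(\<lambda>n. trial_proj n v) \<longlonglongrightarrow> v"
  unfolding trial_proj_def
  by (rule m.orthonormal_expansion[OF q_lists(2)]) (rule m.compact_inverse_total[OF comp lists_q])

lemma q_dom: "k \<ge> 1 \<Longrightarrow> s \<le> 1/2 \<Longrightarrow> q k \<in> a.pdom s"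
proof -
  assume k: "k \<ge> 1" and s: "s \<le> 1/2"
  have "q k \<in> m.pdom (1/2)" by (rule m.eigenvector_pop(1)[OF q_lists(4)]) (use k in simp)
  then have "q k \<in> a.pdom (1/2)" using incl by (auto simp: continuously_included_def)
  then show ?thesis using a.pdom_mono s by blast
qed

text \<open>By Bessel's inequality for \<open>m.pop \<sigma> v\<close>, the series of
  \<open>\<mu> k powr (2 * \<sigma>)\<close> times the squared coefficients converges, and
  \<open>\<rho>\<close> is a multiple of its tails. Beyond \<open>n\<close> the weight
  \<open>\<mu> k powr (2 * \<tau>)\<close> is at most
  \<open>\<mu> (n + 1) powr (2 * \<tau> - 2 * \<sigma>)\<close> times the weight of the series.
  \<open>heinz\<close> handles finite pieces of the remainder, and \<open>nrm_cop_le_limit\<close>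
  the whole.\<close>

lemma tail_estimate:
  assumes \<tau>: "0 \<le> \<tau>" "\<tau> \<le> 1/2" "\<tau> \<le> \<sigma>" and v: "v \<in> m.pdom \<sigma>" "v \<in> a.pdom \<tau>"
  obtains \<rho> where "\<rho> \<longlonglongrightarrow> 0" "\<And>n. 0 \<le> \<rho> n"
    "\<And>n. (norm (a.pop \<tau> (v - trial_proj n v)))\<^sup>2 \<le> \<rho> n * \<mu> (n + 1) powr (2 * \<tau> - 2 * \<sigma>)"
proof -
  obtain K where K: "K \<ge> 0" "\<And>F c. finite F \<Longrightarrow> F \<subseteq> {1..} \<Longrightarrow>
    (norm (a.pop \<tau> (\<Sum>k\<in>F. c k *\<^sub>C q k)))\<^sup>2 \<le> K * (\<Sum>k\<in>F. \<mu> k powr (2 * \<tau>) * (cmod (c k))\<^sup>2)"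
    by (rule heinz[OF \<tau>(1,2)]) (rule that)
  let ?c = "\<lambda>k. G (q k) v"
  define g where "g k = (if k \<ge> 1 then \<mu> k powr (2 * \<sigma>) * (cmod (?c k))\<^sup>2 else 0)" for k
  have g0: "g k \<ge> 0" for k by (simp add: g_def)
  have "(\<Sum>k<n. g k) \<le> (m.nrm (m.pop \<sigma> v))\<^sup>2" for n
  proof -
    have "(\<Sum>k<n. g k) = (\<Sum>k\<in>{1..<n}. (cmod (G (q k) (m.pop \<sigma> v)))\<^sup>2)"
    proof (rule sum.mono_neutral_cong_right)
      fix k assume k: "k \<in> {1..<n}"
      have "G (q k) (m.pop \<sigma> v) = of_real (\<mu> k powr \<sigma>) * ?c k"
        by (rule m.ip_eigenvector_pop[OF q_lists(4) v(1)]) (use k in simp)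
      then show "g k = (cmod (G (q k) (m.pop \<sigma> v)))\<^sup>2"
        using k by (simp add: g_def norm_mult power_mult_distrib powr_sq)
    qed (auto simp: g_def)
    also have "\<dots> \<le> (m.nrm (m.pop \<sigma> v))\<^sup>2" by (rule m.bessel[OF q_lists(2)]) auto
    finally show ?thesis .
  qed
  then have sg: "summable g" by (intro summableI_nonneg_bounded[OF g0])
  \<comment> \<open>The tail starts at \<open>n + 1\<close>, as \<open>trial_proj n\<close> uses up
    the indices 1 to \<open>n\<close>.\<close>
  define \<rho> where "\<rho> n = K * (\<Sum>k. g (k + (n + 1)))" for n
  show thesis
  proof (rule that[of \<rho>])
    have "(\<lambda>n. \<Sum>k. g (k + n)) \<longlonglongrightarrow> 0" by (rule suminf_exist_split2[OF sg])
    then have "(\<lambda>n. \<Sum>k. g (k + (n + 1))) \<longlonglongrightarrow> 0" by (rule LIMSEQ_ignore_initial_segment)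
    then show "\<rho> \<longlonglongrightarrow> 0" unfolding \<rho>_def[abs_def] using tendsto_mult_right_zero by blast
    have sg': "summable (\<lambda>k. g (k + (n + 1)))" for n by (simp only: summable_iff_shift sg)
    show "0 \<le> \<rho> n" for n unfolding \<rho>_def by (intro mult_nonneg_nonneg K suminf_nonneg sg' g0)
    fix n
    let ?p = "\<mu> (n + 1) powr (2 * \<tau> - 2 * \<sigma>)"
    let ?X = "\<lambda>m. \<Sum>k\<in>{n<..n + m}. ?c k *\<^sub>C q k"
    have X: "?X m = trial_proj (n + m) v - trial_proj n v" for m
    proof -
      have "{1..n + m} = {1..n} \<union> {n<..n + m}" by auto
      then have "trial_proj (n + m) v = trial_proj n v + ?X m"
        unfolding trial_proj_def by (simp only:) (rule sum.union_disjoint, auto)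
      then show ?thesis by simp
    qed
    have lim: "?X \<longlonglongrightarrow> v - trial_proj n v"
      unfolding X using LIMSEQ_ignore_initial_segment[OF trial_proj_tendsto, of n v]
      by (intro tendsto_diff tendsto_const) (simp add: add.commute)
    have Xd: "?X m \<in> a.pdom \<tau>" for m
      by (intro csubspace_sum csubspace_scaleC a.pdom_sub q_dom \<tau>) auto
    have vd: "v - trial_proj n v \<in> a.pdom \<tau>"
      unfolding trial_proj_def by (intro csubspace_diff csubspace_sum csubspace_scaleC a.pdom_sub q_dom \<tau> v) auto
    have B: "(norm (a.pop \<tau> (?X m)))\<^sup>2 \<le> \<rho> n * ?p" for m
    proof -
      have "(norm (a.pop \<tau> (?X m)))\<^sup>2 \<le> K * (\<Sum>k\<in>{n<..n + m}. \<mu> k powr (2 * \<tau>) * (cmod (?c k))\<^sup>2)"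
        by (rule K(2)) auto
      also have "\<dots> \<le> K * (\<Sum>k\<in>{n<..n + m}. ?p * g k)"
      proof (intro mult_left_mono K sum_mono)
        fix k assume k: "k \<in> {n<..n + m}"
        then have k1: "k \<ge> 1" by auto
        have "\<mu> (n + 1) \<le> \<mu> k" using q_lists(1) k by (auto simp: mono_on_def)
        then have "\<mu> k powr (2 * \<tau> - 2 * \<sigma>) \<le> ?p" using \<mu>_pos[of "n + 1"] \<tau> by (intro powr_mono2') auto
        then have "\<mu> k powr (2 * \<tau> - 2 * \<sigma>) * g k \<le> ?p * g k" by (rule mult_right_mono[OF _ g0])
        moreover have "\<mu> k powr (2 * \<tau>) = \<mu> k powr (2 * \<tau> - 2 * \<sigma>) * \<mu> k powr (2 * \<sigma>)" by (simp add: powr_add[symmetric])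
        ultimately show "\<mu> k powr (2 * \<tau>) * (cmod (?c k))\<^sup>2 \<le> ?p * g k" using k1 by (simp add: g_def mult.assoc)
      qed
      also have "(\<Sum>k\<in>{n<..n + m}. ?p * g k) = ?p * (\<Sum>k<m. g (k + (n + 1)))"
        unfolding sum_distrib_left
        by (rule sum.reindex_bij_witness[of _ "\<lambda>k. k + (n + 1)" "\<lambda>k. k - (n + 1)"]) auto
      also have "K * (?p * (\<Sum>k<m. g (k + (n + 1)))) \<le> K * (?p * (\<Sum>k. g (k + (n + 1))))"
        by (intro mult_left_mono sum_le_suminf sg' g0 K) auto
      also have "\<dots> = \<rho> n * ?p" by (simp add: \<rho>_def)
      finally show ?thesis .
    qed
    have "a.nrm (a.cop (\<lambda>x. x powr \<tau>) (v - trial_proj n v)) \<le> sqrt (\<rho> n * ?p)"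
    proof (rule a.nrm_cop_le_limit[OF powr_measurable])
      show "?X \<longlonglongrightarrow> v - trial_proj n v" by (rule lim)
      show "?X m \<in> a.cdom (\<lambda>x. x powr \<tau>)" for m using Xd by (simp add: a.pdom_eq)
      show "v - trial_proj n v \<in> a.cdom (\<lambda>x. x powr \<tau>)" using vd by (simp add: a.pdom_eq)
      show "a.nrm (a.cop (\<lambda>x. x powr \<tau>) (?X m)) \<le> sqrt (\<rho> n * ?p)" for m
        using B[of m] by (simp add: a.pop_eq ipnorm_cinner real_le_rsqrt)
    qed
    then have "norm (a.pop \<tau> (v - trial_proj n v)) \<le> sqrt (\<rho> n * ?p)" by (simp add: a.pop_eq ipnorm_cinner)
    then have "(norm (a.pop \<tau> (v - trial_proj n v)))\<^sup>2 \<le> (sqrt (\<rho> n * ?p))\<^sup>2" by (rule power_mono) simp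
    also have "\<dots> = \<rho> n * ?p" using order_trans[OF zero_le_power2 B[of 0]] by simp
    finally show "(norm (a.pop \<tau> (v - trial_proj n v)))\<^sup>2 \<le> \<rho> n * \<mu> (n + 1) powr (2 * \<tau> - 2 * \<sigma>)" .
  qed
qed

lemma ritz_approx_of_ritz_pairs:
  assumes \<tau>: "0 \<le> \<tau>" "\<tau> \<le> 1/2" and r: "ritz_pairs D\<^sub>A A \<tau> q n L U"
  shows "ritz_approx D\<^sub>A A \<tau> n L U"
proof
  fix i assume "i \<in> {1..n}"
  then obtain x where "U i = (\<Sum>k=1..n. x k *\<^sub>C q k)" using r unfolding ritz_pairs_def by blast
  then show "U i \<in> a.pdom \<tau>"
    using \<tau> by (auto intro!: csubspace_sum csubspace_scaleC a.pdom_sub q_dom)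
qed (use \<tau> r in \<open>auto simp: ritz_pairs_def\<close>)

text \<open>The \<open>n\<close> independent vectors \<open>U i\<close> lie in a span of
  \<open>n\<close> vectors and so exhaust it. Best approximation by Ritz vectors can then be
  compared with the truncated expansion in the \<open>q k\<close>.\<close>

lemma trial_span:
  assumes \<tau>: "0 \<le> \<tau>" "\<tau> \<le> 1/2" and r: "ritz_pairs D\<^sub>A A \<tau> q n L U"
  obtains y where "(\<Sum>k=1..n. c k *\<^sub>C q k) = (\<Sum>i=1..n. y i *\<^sub>C U i)"
proof -
  interpret ritz_approx D\<^sub>A A \<tau> n L U by (rule ritz_approx_of_ritz_pairs[OF assms])
  let ?Q = "q ` {1..n}" and ?W = "U ` {1..n}"
  note inj = U_inj and ind = U_independent
  have sub: "?W \<subseteq> cspan ?Q"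
  proof
    fix x assume "x \<in> ?W"
    then obtain i where i: "i \<in> {1..n}" "x = U i" by blast
    then obtain c where "x = (\<Sum>k=1..n. c k *\<^sub>C q k)" using r unfolding ritz_pairs_def by blast
    then show "x \<in> cspan ?Q"
      by (simp only:) (intro complex_vector.span_sum complex_vector.span_scale complex_vector.span_base imageI)
  qed
  have "card ?Q \<le> n" using card_image_le[of "{1..n}" q] by simp
  have "?Q \<subseteq> cspan ?W"
  proof (rule ccontr)
    assume "\<not> ?Q \<subseteq> cspan ?W"
    then obtain x where x: "x \<in> ?Q" "x \<notin> cspan ?W" by blast
    have i2: "complex_vector.independent (insert x ?W)"
      using complex_vector.independent_insertI[OF x(2) ind] .
    have "insert x ?W \<subseteq> cspan ?Q"
      by (simp only: insert_subset) (intro conjI complex_vector.span_base x(1) sub)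
    then have "card (insert x ?W) \<le> card ?Q"
      using complex_vector.independent_span_bound[OF _ i2, of ?Q] by simp
    moreover have "card (insert x ?W) = Suc n"
      using x(2) complex_vector.span_base[of x ?W] card_image[OF inj] by (subst card_insert_disjoint) auto
    ultimately show False using \<open>card ?Q \<le> n\<close> by simp
  qed
  have "(\<Sum>k=1..n. c k *\<^sub>C q k) \<in> cspan ?W"
    by (intro complex_vector.span_sum complex_vector.span_scale subsetD[OF \<open>?Q \<subseteq> cspan ?W\<close>] imageI)
  moreover have "cspan ?W = range (\<lambda>f. \<Sum>v\<in>?W. f v *\<^sub>C v)" by (rule complex_vector.span_finite) simp
  ultimately obtain f where "(\<Sum>k=1..n. c k *\<^sub>C q k) = (\<Sum>v\<in>?W. f v *\<^sub>C v)" by blast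
  then have "(\<Sum>k=1..n. c k *\<^sub>C q k) = (\<Sum>i=1..n. f (U i) *\<^sub>C U i)"
    unfolding sum.reindex[OF inj] by (simp add: o_def)
  then show thesis by (rule that)
qed

end

section \<open>Convergence\<close>

lemma smallo_of_factor_tendsto_0:
  fixes f g h :: "nat \<Rightarrow> real"
  assumes "h \<longlonglongrightarrow> 0" "\<forall>\<^sub>F n in sequentially. \<bar>f n\<bar> \<le> h n * \<bar>g n\<bar>"
  shows "f \<in> o(g)"
proof (rule landau_o.smallI)
  fix c :: real assume "c > 0"
  then have "\<forall>\<^sub>F n in sequentially. h n < c" using assms(1) by (rule order_tendstoD(2)[rotated])
  with assms(2) show "\<forall>\<^sub>F n in sequentially. norm (f n) \<le> c * norm (g n)"
  proof eventually_elim
    case (elim n)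
    have "h n * \<bar>g n\<bar> \<le> c * \<bar>g n\<bar>" using elim(2) by (intro mult_right_mono) auto
    then show ?case using elim(1) by simp
  qed
qed

context trial_setting
begin

lemma ritz_convergence:
  fixes L :: "nat \<Rightarrow> nat \<Rightarrow> real" and U :: "nat \<Rightarrow> nat \<Rightarrow> 'a"
  assumes lists_u: "lists_eigenpairs_below (ess_inf D\<^sub>A A) cinner D\<^sub>A A I lam u"
    and I1: "0 \<notin> I" and I_down: "\<And>i j. j \<in> I \<Longrightarrow> 1 \<le> i \<Longrightarrow> i \<le> j \<Longrightarrow> i \<in> I"
    and lI: "{1..l} \<subseteq> I"
    and \<mu>_top: "filterlim \<mu> at_top sequentially"
    and ritz: "\<And>n. ritz_pairs D\<^sub>A A \<tau> q n (L n) (U n)"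
    and \<tau>: "0 \<le> \<tau>" "\<tau> \<le> 1/2" "\<tau> \<le> \<sigma>"
    and u_dom: "\<And>j. j \<in> {1..l} \<Longrightarrow> u j \<in> m.pdom \<sigma>"
  shows "(\<forall>j\<in>{1..l}. (\<lambda>n. L n j - lam j) \<in> o(\<lambda>n. \<mu> (n + 1) powr (2 * \<tau> - 2 * \<sigma>))) \<and>
    (\<exists>w :: nat \<Rightarrow> nat \<Rightarrow> 'a.
       (\<forall>\<^sub>F n in sequentially. \<forall>j\<in>{1..l}.
          w n j \<in> eigenspace D\<^sub>A A (complex_of_real (lam j)) \<and>
          scale_norm D\<^sub>A A (\<tau> - 1/2) (w n j) = 1) \<and>
       (\<forall>j\<in>{1..l}. (\<lambda>n. scale_norm D\<^sub>A A \<tau> (w n j - U n j)) \<in> o(\<lambda>n. \<mu> (n + 1) powr (\<tau> - \<sigma>))))"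
proof -
  have ra: "ritz_approx D\<^sub>A A \<tau> n (L n) (U n)" for n by (rule ritz_approx_of_ritz_pairs[OF \<tau>(1,2) ritz])
  note u_lists = a.listsD[OF lists_u]
  define p where "p n = \<mu> (n + 1) powr (2 * \<tau> - 2 * \<sigma>)" for n
  have p0: "p n \<ge> 0" for n by (simp add: p_def)
  have ev_u: "u i \<in> eigenspace D\<^sub>A A (complex_of_real (lam i))" if "i \<in> {1..l}" for i
    using u_lists(4) lI that by blast
  have "\<exists>\<rho>. \<rho> \<longlonglongrightarrow> 0 \<and> (\<forall>n. 0 \<le> \<rho> n) \<and> (\<forall>n. (norm (a.pop \<tau> (u i - trial_proj n (u i))))\<^sup>2 \<le> \<rho> n * p n)"
    if i: "i \<in> {1..l}" for i
    by (rule tail_estimate[OF \<tau> u_dom[OF i] a.eigenvector_pop(1)[OF ev_u[OF i]]]) (auto simp: p_def)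
  then obtain \<rho>' where \<rho>': "\<And>i. i \<in> {1..l} \<Longrightarrow> \<rho>' i \<longlonglongrightarrow> 0" "\<And>i n. i \<in> {1..l} \<Longrightarrow> 0 \<le> \<rho>' i n"
    "\<And>i n. i \<in> {1..l} \<Longrightarrow> (norm (a.pop \<tau> (u i - trial_proj n (u i))))\<^sup>2 \<le> \<rho>' i n * p n"
    by metis
  \<comment> \<open>A common error for all indices up to \<open>l\<close>: the bounds for
    \<open>j\<close> involve the errors of the eigenvectors with smaller indices too.\<close>
  define \<rho> where "\<rho> n = (\<Sum>i=1..l. \<rho>' i n)" for n
  have \<rho>_lim: "\<rho> \<longlonglongrightarrow> 0" unfolding \<rho>_def[abs_def] by (rule tendsto_null_sum) (rule \<rho>'(1))
  have \<rho>0: "\<rho> n \<ge> 0" for n unfolding \<rho>_def by (intro sum_nonneg \<rho>'(2))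
  have \<rho>_le: "\<rho>' i n \<le> \<rho> n" if "i \<in> {1..l}" for i n
    unfolding \<rho>_def by (rule member_le_sum[OF that]) (use \<rho>'(2) in auto)
  define \<epsilon> where "\<epsilon> n = sqrt (\<rho> n * p n)" for n
  have \<epsilon>2: "(\<epsilon> n)\<^sup>2 = \<rho> n * p n" for n using \<rho>0 p0 by (simp add: \<epsilon>_def)
  have err: "norm (a.pop \<tau> (u i - ritz_approx.ritz_proj D\<^sub>A A \<tau> n (L n) (U n) (u i))) \<le> \<epsilon> n" if i: "i \<in> {1..l}" for i n
  proof -
    interpret R: ritz_approx D\<^sub>A A \<tau> n "L n" "U n" by (rule ra)
    obtain y where y: "(\<Sum>k=1..n. G (q k) (u i) *\<^sub>C q k) = (\<Sum>i=1..n. y i *\<^sub>C U n i)"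
      by (rule trial_span[OF \<tau>(1,2) ritz])
    have "norm (a.pop \<tau> (u i - R.ritz_proj (u i))) \<le> norm (a.pop \<tau> (u i - trial_proj n (u i)))"
      unfolding trial_proj_def y by (rule R.ritz_proj_best[OF a.eigenvector_pop(1)[OF ev_u[OF i]]])
    also have "\<dots> \<le> sqrt (\<rho>' i n * p n)" using \<rho>'(3)[OF i] by (rule real_le_rsqrt)
    also have "\<dots> \<le> \<epsilon> n" unfolding \<epsilon>_def using \<rho>_le[OF i] p0 by (intro real_sqrt_le_mono mult_right_mono)
    finally show ?thesis .
  qed
  \<comment> \<open>As \<open>\<mu>\<close> tends to infinity and
    \<open>\<tau> \<le> \<sigma>\<close>, \<open>p n\<close> is eventually at most 1, but for
    \<open>\<tau> = \<sigma>\<close> it does not tend to 0; the smallness is due to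
    \<open>\<rho>\<close>.\<close>
  have \<epsilon>_small: "\<forall>\<^sub>F n in sequentially. C * (\<rho> n * p n) < c" if c: "c > 0" for C c :: real
  proof -
    have "\<forall>\<^sub>F n in sequentially. 1 \<le> \<mu> n" using \<mu>_top by (simp add: filterlim_at_top)
    then have "\<forall>\<^sub>F n in sequentially. 1 \<le> \<mu> (n + 1)" by (rule eventually_compose_filterlim) (rule filterlim_add_const_nat_at_top)
    then have "\<forall>\<^sub>F n in sequentially. norm (\<bar>C\<bar> * (\<rho> n * p n)) \<le> \<bar>C\<bar> * \<rho> n"
    proof eventually_elim
      case (elim n)
      have "p n \<le> \<mu> (n + 1) powr 0" unfolding p_def using elim \<tau> by (intro powr_mono) auto
      then have "\<rho> n * p n \<le> \<rho> n * 1" using elim \<rho>0 by (intro mult_left_mono) auto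
      then show ?case using \<rho>0 p0 by (simp add: abs_mult mult_left_mono)
    qed
    moreover have "(\<lambda>n. \<bar>C\<bar> * \<rho> n) \<longlonglongrightarrow> 0" using tendsto_mult_right_zero[OF \<rho>_lim] .
    ultimately have "(\<lambda>n. \<bar>C\<bar> * (\<rho> n * p n)) \<longlonglongrightarrow> 0" by (rule Lim_null_comparison)
    then have "\<forall>\<^sub>F n in sequentially. \<bar>C\<bar> * (\<rho> n * p n) < c" using c by (intro order_tendstoD)
    then show ?thesis
    proof eventually_elim
      case (elim n)
      have "C * (\<rho> n * p n) \<le> \<bar>C\<bar> * (\<rho> n * p n)" using \<rho>0 p0 by (intro mult_right_mono) auto
      then show ?case using elim by linarith
    qed
  qed
  define C1 where "C1 j = 2 * real j / (a.lower * lam j powr (2 * \<tau> - 1))" for j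
  have lam_pos: "lam j > 0" if "j \<in> {1..l}" for j
    using u_lists(6)[of j] a.lower(1) lI that by force
  have C1: "C1 j \<ge> 0" for j using a.lower(1) by (simp add: C1_def)
  \<comment> \<open>When \<open>C1 j * (\<rho> n * p n)\<close> is below 1/2, the upper bound first
    gives \<open>L n j \<le> 2 * lam j\<close>; inserted back, this makes the excess proportional to
    \<open>\<rho> n * p n\<close>.\<close>
  have eigenvalues: "\<forall>\<^sub>F n in sequentially. j \<le> n \<and> lam j \<le> L n j \<and> L n j \<le> 2 * lam j \<and> L n j - lam j \<le> 2 * lam j * C1 j * (\<rho> n * p n)"
    if j: "j \<in> {1..l}" for j
    using \<epsilon>_small[of "1/2" "C1 j", simplified] eventually_ge_at_top[of j]
  proof eventually_elim
    case (elim n)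
    interpret R: ritz_approx D\<^sub>A A \<tau> n "L n" "U n" by (rule ra)
    have jI: "j \<in> I" and jn: "j \<in> {1..n}" using j lI elim by auto
    have lo: "lam j \<le> L n j" by (rule R.eigenvalue_lower_bound[OF lists_u I1 I_down jI jn])
    have "L n j * (1 - C1 j * (\<epsilon> n)\<^sup>2) \<le> lam j"
      unfolding C1_def by (rule R.eigenvalue_upper_bound[OF lists_u I1 I_down jI jn]) (use j err in auto)
    then have up: "L n j * (1 - C1 j * (\<rho> n * p n)) \<le> lam j" by (simp only: \<epsilon>2)
    have "L n j * (1 / 2) \<le> L n j * (1 - C1 j * (\<rho> n * p n))"
      using elim(1) R.L_pos[OF jn] by (intro mult_left_mono) auto
    then have two: "L n j \<le> 2 * lam j" using up by simp
    have "L n j - lam j \<le> L n j * (C1 j * (\<rho> n * p n))" using up by (simp add: algebra_simps)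
    also have "\<dots> \<le> 2 * lam j * (C1 j * (\<rho> n * p n))" using two C1 \<rho>0 p0 by (intro mult_right_mono mult_nonneg_nonneg)
    finally show ?case using lo two elim(2) by (simp add: mult.assoc)
  qed
  define y where "y n j = a.E {lam j} (U n j)" for n j
  have "\<exists>K. \<forall>\<^sub>F n in sequentially. (norm (a.pop \<tau> (U n j - y n j)))\<^sup>2 \<le> K * (\<rho> n * p n)"
    if j: "j \<in> {1..l}" for j
  proof -
    have jI: "j \<in> I" using j lI by blast
    obtain \<delta> where \<delta>: "\<delta> > 0" "\<And>v. AE x in a.sm v. x \<le> lam j \<or> lam j + \<delta> \<le> x"
      by (rule a.spectral_gap[OF lists_u jI]) (rule that)
    define \<kappa> where "\<kappa> = (lam j + \<delta>) / \<delta>"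
    define C where "C = lam j powr (2 * \<tau>) + \<kappa> * (lam j * a.lower powr (2 * \<tau> - 1))"
    have \<kappa>: "\<kappa> \<ge> 0" using lam_pos[OF j] \<delta>(1) by (simp add: \<kappa>_def)
    have C: "C \<ge> 0" using \<kappa> lam_pos[OF j] by (simp add: C_def)
    let ?F = "{i \<in> I. lam i < lam j}"
    \<comment> \<open>The constant of \<open>coefficient_bound\<close>, with \<open>L n j\<close>
      replaced by its eventual bound \<open>2 * lam j\<close> so as not to depend on
      \<open>n\<close>.\<close>
    define B where "B i = (lam i powr (1 - 2 * \<tau>) * (2 * lam j) / (lam j - lam i))\<^sup>2 / a.lower" for i
    have "\<forall>\<^sub>F n in sequentially. (norm (a.pop \<tau> (U n j - y n j)))\<^sup>2
        \<le> (\<kappa> * (2 * lam j * C1 j) + C * (\<Sum>i\<in>?F. B i)) * (\<rho> n * p n)"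
      using eigenvalues[OF j]
    proof eventually_elim
      case (elim n)
      interpret R: ritz_approx D\<^sub>A A \<tau> n "L n" "U n" by (rule ra)
      have jn: "j \<in> {1..n}" using j elim by auto
      have "(cmod (cinner (u i) (U n j)))\<^sup>2 \<le> B i * (\<rho> n * p n)" if i: "i \<in> ?F" for i
      proof -
        have iI: "i \<in> I" "lam i < lam j" using i by auto
        \<comment> \<open>A smaller eigenvalue has a smaller index, so \<open>u i\<close> is again
          among the vectors assumed to lie in the domain of \<open>M\<^sup>\<sigma>\<close>.\<close>
        have "i \<in> {1..<j}" by (rule R.lam_less_imp[OF lists_u I1 I_down iI(1) jI iI(2)])
        then have il: "i \<in> {1..l}" using j by auto
        have "(cmod (cinner (u i) (U n j)))\<^sup>2
            \<le> (lam i powr (1 - 2 * \<tau>) * L n j / (lam j - lam i))\<^sup>2 / a.lower * (\<epsilon> n)\<^sup>2"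
          using elim by (intro R.coefficient_bound[OF lists_u I1 iI jI jn _ err[OF il]]) auto
        also have "\<dots> \<le> B i * (\<epsilon> n)\<^sup>2"
          unfolding B_def
          using elim iI(2) R.L_pos[OF jn] a.lower(1)
          by (intro mult_right_mono divide_right_mono power_mono mult_left_mono divide_nonneg_nonneg mult_nonneg_nonneg) auto
        finally show ?thesis by (simp only: \<epsilon>2)
      qed
      then have sum: "(\<Sum>i\<in>?F. (cmod (cinner (u i) (U n j)))\<^sup>2) \<le> (\<Sum>i\<in>?F. B i) * (\<rho> n * p n)"
        unfolding sum_distrib_right by (rule sum_mono)
      have "(norm (a.pop \<tau> (U n j - y n j)))\<^sup>2 \<le> \<kappa> * (L n j - lam j) + C * (\<Sum>i\<in>?F. (cmod (cinner (u i) (U n j)))\<^sup>2)"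
        unfolding y_def C_def \<kappa>_def by (rule R.eigenvector_bound[OF lists_u I1 jI jn \<delta>])
      also have "\<dots> \<le> \<kappa> * (2 * lam j * C1 j * (\<rho> n * p n)) + C * ((\<Sum>i\<in>?F. B i) * (\<rho> n * p n))"
        using elim by (intro add_mono mult_left_mono sum \<kappa> C) auto
      finally show ?case by (simp add: algebra_simps)
    qed
    then show ?thesis by blast
  qed
  then have "\<forall>j\<in>{1..l}. \<exists>K. \<forall>\<^sub>F n in sequentially. (norm (a.pop \<tau> (U n j - y n j)))\<^sup>2 \<le> K * (\<rho> n * p n)"
    by blast
  from bchoice[OF this] obtain K where
    "\<forall>j\<in>{1..l}. \<forall>\<^sub>F n in sequentially. (norm (a.pop \<tau> (U n j - y n j)))\<^sup>2 \<le> K j * (\<rho> n * p n)" ..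
  then have K: "\<forall>\<^sub>F n in sequentially. (norm (a.pop \<tau> (U n j - y n j)))\<^sup>2 \<le> K j * (\<rho> n * p n)"
    if "j \<in> {1..l}" for j using that by blast
  define w where "w n j = (1 / norm (a.pop (\<tau> - 1/2) (y n j))) *\<^sub>R y n j" for n j
  have y_eig: "y n j \<in> eigenspace D\<^sub>A A (complex_of_real (lam j))" for n j
    unfolding y_def by (rule a.E_point_mem)
  have eigenvectors: "\<forall>\<^sub>F n in sequentially. w n j \<in> eigenspace D\<^sub>A A (complex_of_real (lam j)) \<and>
      norm (a.pop (\<tau> - 1/2) (w n j)) = 1 \<and>
      norm (a.pop \<tau> (w n j - U n j)) \<le> (1 + sqrt (lam j / a.lower)) * sqrt (K j * (\<rho> n * p n))"
    if j: "j \<in> {1..l}" for j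
    using K[OF j] \<epsilon>_small[of "lam j" "K j", OF lam_pos[OF j]] eigenvalues[OF j]
  proof eventually_elim
    case (elim n)
    interpret R: ritz_approx D\<^sub>A A \<tau> n "L n" "U n" by (rule ra)
    have jn: "j \<in> {1..n}" using j elim by auto
    \<comment> \<open>Otherwise the squared energy norm of \<open>U n j\<close>, which is
      \<open>L n j \<ge> lam j\<close>, would be at most \<open>K j * (\<rho> n * p n)\<close>,
      which is eventually below \<open>lam j\<close>.\<close>
    have y0: "y n j \<noteq> 0"
    proof
      assume "y n j = 0"
      then show False using elim R.norm_P_U[OF jn] by simp
    qed
    note N = R.eigenvector_normalized[OF y_eig y0 R.U_dom[OF jn] R.norm_R_U[OF jn], folded w_def]
    have "norm (a.pop \<tau> (U n j - y n j)) \<le> sqrt (K j * (\<rho> n * p n))" by (rule real_le_rsqrt[OF elim(1)])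
    then have "(1 + sqrt (lam j / a.lower)) * norm (a.pop \<tau> (U n j - y n j))
        \<le> (1 + sqrt (lam j / a.lower)) * sqrt (K j * (\<rho> n * p n))"
      using lam_pos[OF j] a.lower(1) by (intro mult_left_mono) auto
    moreover have "a.E {lam j} (w n j) = w n j"
      using y_eig[of n j] unfolding w_def by (simp add: a.eigenspace_iff clinear_scaleR[OF a.E_lin])
    ultimately show ?case using N by (simp add: a.eigenspace_iff)
  qed
  have "(\<lambda>n. L n j - lam j) \<in> o(\<lambda>n. \<mu> (n + 1) powr (2 * \<tau> - 2 * \<sigma>))" if j: "j \<in> {1..l}" for j
  proof (rule smallo_of_factor_tendsto_0)
    show "(\<lambda>n. 2 * lam j * C1 j * \<rho> n) \<longlonglongrightarrow> 0" by (rule tendsto_mult_right_zero[OF \<rho>_lim])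
    show "\<forall>\<^sub>F n in sequentially. \<bar>L n j - lam j\<bar> \<le> 2 * lam j * C1 j * \<rho> n * \<bar>\<mu> (n + 1) powr (2 * \<tau> - 2 * \<sigma>)\<bar>"
      using eigenvalues[OF j] by eventually_elim (simp add: p_def mult.assoc)
  qed
  moreover have "(\<lambda>n. scale_norm D\<^sub>A A \<tau> (w n j - U n j)) \<in> o(\<lambda>n. \<mu> (n + 1) powr (\<tau> - \<sigma>))" if j: "j \<in> {1..l}" for j
  proof (rule smallo_of_factor_tendsto_0)
    let ?c = "1 + sqrt (lam j / a.lower)"
    have "(\<lambda>n. sqrt (K j * \<rho> n)) \<longlonglongrightarrow> sqrt 0"
      by (intro tendsto_real_sqrt tendsto_mult_right_zero \<rho>_lim)
    then have "(\<lambda>n. sqrt (K j * \<rho> n)) \<longlonglongrightarrow> 0" by simp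
    then show "(\<lambda>n. ?c * sqrt (K j * \<rho> n)) \<longlonglongrightarrow> 0" by (rule tendsto_mult_right_zero)
    have sq: "sqrt (p n) = \<mu> (n + 1) powr (\<tau> - \<sigma>)" for n
    proof (rule real_sqrt_unique)
      show "(\<mu> (n + 1) powr (\<tau> - \<sigma>))\<^sup>2 = p n" unfolding powr_sq p_def by (simp add: right_diff_distrib)
    qed simp
    show "\<forall>\<^sub>F n in sequentially. \<bar>scale_norm D\<^sub>A A \<tau> (w n j - U n j)\<bar> \<le> ?c * sqrt (K j * \<rho> n) * \<bar>\<mu> (n + 1) powr (\<tau> - \<sigma>)\<bar>"
      using eigenvectors[OF j]
      by eventually_elim (simp add: scale_norm_def real_sqrt_mult sq mult.assoc)
  qed
  moreover have "\<forall>\<^sub>F n in sequentially. \<forall>j\<in>{1..l}. w n j \<in> eigenspace D\<^sub>A A (complex_of_real (lam j)) \<and>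
      scale_norm D\<^sub>A A (\<tau> - 1/2) (w n j) = 1"
  proof (rule eventually_ball_finite)
    show "\<forall>j\<in>{1..l}. \<forall>\<^sub>F n in sequentially. w n j \<in> eigenspace D\<^sub>A A (complex_of_real (lam j)) \<and>
      scale_norm D\<^sub>A A (\<tau> - 1/2) (w n j) = 1"
    proof
      fix j assume "j \<in> {1..l}"
      from eigenvectors[OF this] show "\<forall>\<^sub>F n in sequentially. w n j \<in> eigenspace D\<^sub>A A (complex_of_real (lam j)) \<and>
        scale_norm D\<^sub>A A (\<tau> - 1/2) (w n j) = 1"
        by eventually_elim (simp add: scale_norm_def)
    qed
  qed simp
  ultimately show ?thesis by blast
qed

end

theorem proposition4p1:
  fixes A M :: "'a::chilbert_space \<Rightarrow> 'a"
    and D\<^sub>A D\<^sub>M :: "'a set"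
    and G :: "'a \<Rightarrow> 'a \<Rightarrow> complex"
    and N :: enat and l :: nat
    and lam \<mu> :: "nat \<Rightarrow> real" and u q :: "nat \<Rightarrow> 'a"
    and \<tau> \<sigma> :: real
    and L :: "nat \<Rightarrow> nat \<Rightarrow> real" and U :: "nat \<Rightarrow> nat \<Rightarrow> 'a"
  assumes "separable_space (euclidean :: 'a topology)"
    and "selfadjoint cinner D\<^sub>A A" and "positive_definite cinner D\<^sub>A A"
    and "lists_eigenpairs_below (ess_inf D\<^sub>A A) cinner D\<^sub>A A {k. 1 \<le> k \<and> enat k \<le> N} lam u"
    and "enat l \<le> N"
    and "equivalent_ip G"
    and "selfadjoint G D\<^sub>M M" and "positive_definite G D\<^sub>M M"
    and "compact_operator G (inv_into D\<^sub>M M)"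
    and "lists_eigenpairs_below \<infinity> G D\<^sub>M M {1..} \<mu> q"
    and "filterlim \<mu> at_top sequentially"
    and "\<And>n. ritz_pairs D\<^sub>A A \<tau> q n (L n) (U n)"
    and "continuously_included
           (power_dom G D\<^sub>M M (1/2)) (\<lambda>v. ipnorm G (op_power G D\<^sub>M M (1/2) v))
           (power_dom cinner D\<^sub>A A (1/2)) (scale_norm D\<^sub>A A (1/2))"
    and "0 \<le> \<tau>" and "\<tau> \<le> 1/2" and "\<tau> \<le> \<sigma>"
    and "\<forall>j\<in>{1..l}. u j \<in> power_dom G D\<^sub>M M \<sigma>"
  shows "(\<forall>j\<in>{1..l}. (\<lambda>n. L n j - lam j) \<in> o(\<lambda>n. \<mu> (n + 1) powr (2 * \<tau> - 2 * \<sigma>))) \<and>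
    (\<exists>w :: nat \<Rightarrow> nat \<Rightarrow> 'a.
       (\<forall>\<^sub>F n in sequentially. \<forall>j\<in>{1..l}.
          w n j \<in> eigenspace D\<^sub>A A (complex_of_real (lam j)) \<and>
          scale_norm D\<^sub>A A (\<tau> - 1/2) (w n j) = 1) \<and>
       (\<forall>j\<in>{1..l}. (\<lambda>n. scale_norm D\<^sub>A A \<tau> (w n j - U n j)) \<in> o(\<lambda>n. \<mu> (n + 1) powr (\<tau> - \<sigma>))))"
proof -
  interpret trial_setting A M D\<^sub>A D\<^sub>M G \<mu> q
    by unfold_locales (use assms equivalent_ip_cinner in auto)
  show ?thesis
  proof (rule ritz_convergence)
    show "lists_eigenpairs_below (ess_inf D\<^sub>A A) cinner D\<^sub>A A {k. 1 \<le> k \<and> enat k \<le> N} lam u"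
      by (rule assms(4))
    show "i \<in> {k. 1 \<le> k \<and> enat k \<le> N}" if "j \<in> {k. 1 \<le> k \<and> enat k \<le> N}" "1 \<le> i" "i \<le> j" for i j
      using that by (auto intro: order_trans[of _ "enat j"])
    show "{1..l} \<subseteq> {k. 1 \<le> k \<and> enat k \<le> N}"
      using assms(5) by (auto intro: order_trans[of _ "enat l"])
  qed (use assms in auto)
qed

end
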